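(* Let $r$ be an even integer with $r\ge 6$. Then every connected equimatchable $r$-regular graph $G$ with $|V(G)|$ odd and $\alpha(G)\ge 3$ is isomorphic to $F_r$.
   Context: All graphs are finite, simple and undirected. A matching of $G$ is a set of pairwise vertex-disjoint edges. $G$ is equimatchable if all of its (inclusion-)maximal matchings have the same size. $\alpha(G)$ is the independence number of $G$. For even $r\ge 2$, $F_r$ denotes the graph obtained from the complete bipartite graph $K_{r,r}$ by deleting all edges of a matching $M$ of size $\frac r2$ and adding a new vertex $u$ together with edges joining $u$ to all $r$ vertices that are ends of edges in $M$. *)

theory Defs
  imports Main
begin

record 'a graph =
  verts :: "'a set"
  edges :: "'a set set"

definition simple_graph :: "'a graph \<Rightarrow> bool" where
  "simple_graph G \<longleftrightarrow> finite (verts G) \<and> (\<forall>e\<in>edges G. e \<subseteq> verts G \<and> card e = 2)"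

definition adjacency :: "'a graph \<Rightarrow> 'a rel" where
  "adjacency G = {(u, v). {u, v} \<in> edges G}"

text \<open>The empty graph counts as connected here; graphs of odd order are never empty.\<close>

definition connected_graph :: "'a graph \<Rightarrow> bool" where
  "connected_graph G \<longleftrightarrow> (\<forall>u\<in>verts G. \<forall>v\<in>verts G. (u, v) \<in> (adjacency G)\<^sup>*)"

definition degree :: "'a graph \<Rightarrow> 'a \<Rightarrow> nat" where
  "degree G v = card {e \<in> edges G. v \<in> e}"

definition regular_graph :: "nat \<Rightarrow> 'a graph \<Rightarrow> bool" where
  "regular_graph r G \<longleftrightarrow> (\<forall>v\<in>verts G. degree G v = r)"

definition matching :: "'a graph \<Rightarrow> 'a set set \<Rightarrow> bool" where
  "matching G M \<longleftrightarrow> M \<subseteq> edges G \<and> (\<forall>e\<in>M. \<forall>f\<in>M. e \<noteq> f \<longrightarrow> e \<inter> f = {})"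

definition maximal_matching :: "'a graph \<Rightarrow> 'a set set \<Rightarrow> bool" where
  "maximal_matching G M \<longleftrightarrow> matching G M \<and> (\<nexists>N. matching G N \<and> M \<subset> N)"

definition equimatchable :: "'a graph \<Rightarrow> bool" where
  "equimatchable G \<longleftrightarrow>
    (\<forall>M N. maximal_matching G M \<longrightarrow> maximal_matching G N \<longrightarrow> card M = card N)"

definition independent_set :: "'a graph \<Rightarrow> 'a set \<Rightarrow> bool" where
  "independent_set G S \<longleftrightarrow> S \<subseteq> verts G \<and> (\<forall>u\<in>S. \<forall>v\<in>S. {u, v} \<notin> edges G)"

definition independence_number :: "'a graph \<Rightarrow> nat" where
  "independence_number G = Max (card ` {S. independent_set G S})"

definition graph_isomorphic :: "'a graph \<Rightarrow> 'b graph \<Rightarrow> bool" where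
  "graph_isomorphic G H \<longleftrightarrow>
    (\<exists>f. bij_betw f (verts G) (verts H) \<and>
      (\<forall>u\<in>verts G. \<forall>v\<in>verts G. {u, v} \<in> edges G \<longleftrightarrow> {f u, f v} \<in> edges H))"

datatype F_vertex = LeftV nat | RightV nat | Apex

definition complete_bipartite :: "nat \<Rightarrow> F_vertex graph" where
  "complete_bipartite r =
    \<lparr>verts = LeftV ` {..<r} \<union> RightV ` {..<r},
     edges = {{LeftV i, RightV j} | i j. i < r \<and> j < r}\<rparr>"

definition replace_matching :: "F_vertex graph \<Rightarrow> F_vertex set set \<Rightarrow> F_vertex graph" where
  "replace_matching G M =
    \<lparr>verts = insert Apex (verts G),
     edges = (edges G - M) \<union> {{Apex, x} | x. x \<in> \<Union>M}\<rparr>"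

text \<open>
  Up to isomorphism, \<open>replace_matching (complete_bipartite r) M\<close> depends only on the size of the
  matching \<open>M\<close>, so we fix the one below.
\<close>

definition F_matching :: "nat \<Rightarrow> F_vertex set set" where
  "F_matching r = {{LeftV i, RightV i} | i. i < r div 2}"

definition F_graph :: "nat \<Rightarrow> F_vertex graph" where
  "F_graph r = replace_matching (complete_bipartite r) (F_matching r)"

lemma matching_F_matching: "matching (complete_bipartite r) (F_matching r)"
proof -
  have "F_matching r \<subseteq> edges (complete_bipartite r)"
    unfolding F_matching_def complete_bipartite_def by fastforce
  then show ?thesis
    by (auto simp: matching_def F_matching_def)
qed

lemma card_F_matching: "card (F_matching r) = r div 2"
proof -
  have "F_matching r = (\<lambda>i. {LeftV i, RightV i}) ` {..<r div 2}"
    by (auto simp: F_matching_def)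
  moreover have "inj_on (\<lambda>i. {LeftV i, RightV i}) {..<r div 2}"
    by (auto simp: inj_on_def doubleton_eq_iff)
  ultimately show ?thesis by (simp add: card_image)
qed

lemma simple_graph_F_graph: "simple_graph (F_graph r)"
  by (auto simp: simple_graph_def F_graph_def replace_matching_def complete_bipartite_def
      F_matching_def)

end

theory Submission
  imports Defs
begin

text \<open>
  A graph of odd order all of whose maximal matchings have the same size is studied through
  the critical sets of Gallai and Edmonds. Regularity and Hall's theorem force the graph to
  be factor-critical, so every maximal matching misses exactly one vertex. Remove a maximum
  independent set \<open>S\<close>: a maximum matching of the rest still extends to one missing a single
  vertex, so it misses at least \<open>|S| - 1\<close> vertices, and a Gallai--Edmonds barrier of the
  rest yields a set \<open>T \<supseteq> S\<close> whose deletion leaves \<open>|T| - 1\<close> critical parts; these parts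
  contain an independent transversal, so \<open>T\<close> is \<open>S\<close> or \<open>S\<close> with one vertex \<open>c\<close> added.
  Counting edges between \<open>T\<close> and the parts, together with matchings that would miss more
  than one vertex, rules out \<open>T = S\<close> and shows in the other case that all parts are
  singletons. Then \<open>c\<close> has \<open>r / 2\<close> neighbours on either side of a bipartite graph, and one
  more application of Hall's theorem shows that both sides have exactly \<open>r\<close> vertices.
\<close>

section \<open>Finite sets and Hall's theorem\<close>

text \<open>Most contradictions have one source: when every maximal matching misses exactly one
  vertex, no matching can leave two vertices all of whose neighbours are covered, nor leave an
  independent set of two or more vertices as its whole remainder. The work lies in building such
  matchings. Counting supplies a small budget: \<open>T\<close> has one vertex more than there are
  parts, so its degrees leave only \<open>r\<close> edges beyond \<open>r\<close> per part, less two
  for each edge inside \<open>T\<close>. A part with \<open>k\<close> vertices,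
  \<open>3 \<le> k \<le> r - 1\<close>, takes at least
  \<open>k * (r + 1 - k) \<ge> 2 * r - 2\<close> edges, so two such parts overspend. The obstacle is
  a part with more than \<open>r\<close> vertices, where this bound is empty; there one exploits
  that no vertex can be adjacent to all of it. Evenness of \<open>r\<close> matters because critical
  parts have odd order, hence never exactly \<open>r\<close> vertices. When all parts are singletons
  they use \<open>r\<close> edges each, and the surplus \<open>r\<close> must be twice the degree of
  \<open>c\<close> into \<open>S\<close>: this is the origin of \<open>r / 2\<close>.\<close>

lemma two_elements:
  assumes "2 \<le> card A"
  shows "\<exists>x y. x \<in> A \<and> y \<in> A \<and> x \<noteq> y"
proof -
  have "finite A" using assms by (metis card.infinite not_numeral_le_zero)
  then show ?thesis using assms card_le_Suc0_iff_eq[of A] by fastforce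
qed

lemma card_Diff_pair:
  assumes "finite A" "a \<in> A" "b \<in> A" "a \<noteq> b"
  shows "card (A - {a, b}) + 2 = card A"
proof -
  have "card {a, b} = 2" using assms(4) by simp
  moreover have "card {a, b} \<le> card A" using assms by (intro card_mono) auto
  ultimately show ?thesis using assms by (simp add: card_Diff_subset)
qed

lemma ex_outside:
  assumes "finite F" "card F < card B"
  shows "\<exists>b. b \<in> B \<and> b \<notin> F"
  using assms card_mono[of F B] by (metis leD subsetI)

text \<open>Halmos-Vaughan induction: if every proper nonempty subfamily has a spare element, any
  choice for one index keeps the condition for the rest; otherwise the family splits at a tight
  \<open>J\<close>, and deleting the elements used by \<open>J\<close> keeps the condition outside
  it.\<close>

lemma hall:
  fixes N :: "'i \<Rightarrow> 'b set"
  assumes "finite I" "\<And>i. i \<in> I \<Longrightarrow> finite (N i)"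
    and "\<And>J. J \<subseteq> I \<Longrightarrow> card J \<le> card (\<Union>(N ` J))"
  shows "\<exists>f. inj_on f I \<and> (\<forall>i\<in>I. f i \<in> N i)"
  using assms
proof (induction "card I" arbitrary: I N rule: less_induct)
  case less
  show ?case
  proof (cases "I = {}")
    case False
    show ?thesis
    proof (cases "\<forall>J. J \<subset> I \<longrightarrow> J \<noteq> {} \<longrightarrow> card J < card (\<Union>(N ` J))")
      case True
      obtain i where i: "i \<in> I" using False by blast
      have "card {i} \<le> card (N i)" using less.prems(3)[of "{i}"] i by simp
      then obtain b where b: "b \<in> N i" by fastforce
      define N' where "N' = (\<lambda>j. N j - {b})"
      have "\<exists>f. inj_on f (I - {i}) \<and> (\<forall>j\<in>I - {i}. f j \<in> N' j)"
      proof (rule less.hyps)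
        show "card (I - {i}) < card I" using i less.prems(1) by (simp add: card_gt_0_iff False)
        fix J assume J: "J \<subseteq> I - {i}"
        show "card J \<le> card (\<Union>(N' ` J))"
        proof (cases "J = {}")
          case False
          have "J \<subset> I" using J i by blast
          then have "card J < card (\<Union>(N ` J))" using True False by blast
          moreover have "\<Union>(N' ` J) = \<Union>(N ` J) - {b}" by (auto simp: N'_def)
          ultimately show ?thesis by (cases "b \<in> \<Union>(N ` J)") (auto simp: card_Diff_singleton_if)
        qed simp
        next
        show "finite (N' j)" if "j \<in> I - {i}" for j using that less.prems(2) by (auto simp: N'_def)
        show "finite (I - {i})" using less.prems(1) by blast
      qed
      then obtain f where f: "inj_on f (I - {i})" "\<forall>j\<in>I - {i}. f j \<in> N' j" by blast
      have "inj_on (f(i := b)) I" using f by (auto simp: inj_on_def N'_def)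
      moreover have "\<forall>j\<in>I. (f(i := b)) j \<in> N j" using f b by (auto simp: N'_def)
      ultimately show ?thesis by blast
    next
      case False
      then have "\<exists>J. J \<subset> I \<and> J \<noteq> {} \<and> \<not> card J < card (\<Union>(N ` J))" by blast
      then obtain J where J: "J \<subset> I" "J \<noteq> {}" "card J \<ge> card (\<Union>(N ` J))" by (auto simp: not_less)
      have finJ: "finite J" using J less.prems(1) by (meson finite_subset psubset_imp_subset)
      define B where "B = \<Union>(N ` J)"
      have finB: "finite B" using J less.prems(2) finJ by (auto simp: B_def)
      have "\<exists>f. inj_on f J \<and> (\<forall>j\<in>J. f j \<in> N j)"
      proof (rule less.hyps)
        show "card J < card I" using J less.prems(1) by (simp add: psubset_card_mono)
        show "card L \<le> card (\<Union>(N ` L))" if "L \<subseteq> J" for L using that J less.prems(3)[of L] by blast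
        show "finite (N i)" if "i \<in> J" for i using that J less.prems(2) by blast
      qed (fact finJ)
      then obtain f where f: "inj_on f J" "\<forall>j\<in>J. f j \<in> N j" by blast
      define N' where "N' = (\<lambda>j. N j - B)"
      have "\<exists>f. inj_on f (I - J) \<and> (\<forall>j\<in>I - J. f j \<in> N' j)"
      proof (rule less.hyps)
        show "card (I - J) < card I" using J less.prems(1) by (intro psubset_card_mono) auto
        fix L assume L: "L \<subseteq> I - J"
        have finL: "finite L" using L less.prems(1) by (meson Diff_subset finite_subset)
        have "card (L \<union> J) = card L + card J" using L finL finJ by (intro card_Un_disjoint) auto
        moreover have "card (L \<union> J) \<le> card (\<Union>(N ` (L \<union> J)))"
          using L J(1) by (intro less.prems(3)) blast
        moreover have "\<Union>(N ` (L \<union> J)) = \<Union>(N' ` L) \<union> B" by (auto simp: N'_def B_def)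
        moreover have "card (\<Union>(N' ` L) \<union> B) = card (\<Union>(N' ` L)) + card B"
          using L finL finB less.prems(2) by (intro card_Un_disjoint) (auto simp: N'_def)
        ultimately show "card L \<le> card (\<Union>(N' ` L))" using J(3) by (simp add: B_def)
        next
        show "finite (N' j)" if "j \<in> I - J" for j using that less.prems(2) by (auto simp: N'_def)
        show "finite (I - J)" using less.prems(1) by blast
      qed
      then obtain g where g: "inj_on g (I - J)" "\<forall>j\<in>I - J. g j \<in> N' j" by blast
      define h where "h = (\<lambda>j. if j \<in> J then f j else g j)"
      have fg: "f x \<noteq> g y" if "x \<in> J" "y \<in> I - J" for x y
        using f(2) g(2) that by (force simp: N'_def B_def)
      have "inj_on h I"
      proof (rule inj_onI)
        fix x y assume "x \<in> I" "y \<in> I" "h x = h y"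
        then show "x = y"
          using inj_onD[OF f(1), of x y] inj_onD[OF g(1), of x y] fg[of x y] fg[of y x]
          by (auto simp: h_def split: if_splits)
      qed
      moreover have "\<forall>j\<in>I. h j \<in> N j" using f g by (auto simp: h_def N'_def)
      ultimately show ?thesis by blast
    qed
  qed auto
qed

section \<open>Perfect matchings of vertex sets, parity counts and alternating paths\<close>

locale sgraph =
  fixes adj :: "'a \<Rightarrow> 'a \<Rightarrow> bool" (infix "\<sim>" 50)
  assumes adj_sym: "u \<sim> v \<Longrightarrow> v \<sim> u"
    and adj_irrefl: "\<not> u \<sim> u"
begin

text \<open>
  Matchings enter through the vertex sets they cover: \<open>pm W\<close> says that the subgraph induced by \<open>W\<close>
  has a perfect matching.
\<close>

inductive pm :: "'a set \<Rightarrow> bool" where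
  pm_empty: "pm {}"
| pm_insert: "pm W \<Longrightarrow> u \<sim> v \<Longrightarrow> u \<notin> W \<Longrightarrow> v \<notin> W \<Longrightarrow> pm (insert u (insert v W))"

definition nb :: "'a \<Rightarrow> 'a set \<Rightarrow> 'a set" where
  "nb v B = {b \<in> B. v \<sim> b}"

abbreviation deg :: "'a \<Rightarrow> 'a set \<Rightarrow> nat" where
  "deg v B \<equiv> card (nb v B)"

definition indep :: "'a set \<Rightarrow> bool" where
  "indep A \<longleftrightarrow> (\<forall>u\<in>A. \<forall>v\<in>A. \<not> u \<sim> v)"

text \<open>Factor-critical in the usual terminology, as a property of the vertex set alone.\<close>

definition critical :: "'a set \<Rightarrow> bool" where
  "critical K \<longleftrightarrow> K \<noteq> {} \<and> (\<forall>x\<in>K. pm (K - {x}))"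

lemma adj_neq: "u \<sim> v \<Longrightarrow> u \<noteq> v"
  using adj_irrefl by blast

lemma adj_commute: "u \<sim> v \<longleftrightarrow> v \<sim> u"
  using adj_sym by blast

lemma mem_nb: "b \<in> nb v B \<longleftrightarrow> b \<in> B \<and> v \<sim> b"
  by (simp add: nb_def)

lemma finite_nb: "finite B \<Longrightarrow> finite (nb v B)"
  by (simp add: nb_def)

lemma nb_subset: "nb v B \<subseteq> B"
  by (auto simp: nb_def)

lemma sum_nb_swap:
  assumes "finite A" "finite B"
  shows "(\<Sum>a\<in>A. deg a B) = (\<Sum>b\<in>B. deg b A)"
proof -
  have "(\<Sum>a\<in>A. deg a B) = (\<Sum>a\<in>A. \<Sum>b\<in>B. if a \<sim> b then 1 else 0)"
    unfolding nb_def card_eq_sum sum.inter_filter[OF assms(2)] ..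
  also have "\<dots> = (\<Sum>b\<in>B. \<Sum>a\<in>A. if a \<sim> b then 1 else 0)" by (rule sum.swap)
  also have "\<dots> = (\<Sum>b\<in>B. \<Sum>a\<in>A. if b \<sim> a then 1 else 0)"
    using adj_sym by (intro sum.cong) auto
  also have "\<dots> = (\<Sum>b\<in>B. deg b A)"
    unfolding nb_def card_eq_sum sum.inter_filter[OF assms(1)] ..
  finally show ?thesis .
qed

lemma card_nb_Un:
  assumes "finite A" "finite B" "A \<inter> B = {}"
  shows "deg v (A \<union> B) = deg v A + deg v B"
proof -
  have "nb v (A \<union> B) = nb v A \<union> nb v B" by (auto simp: nb_def)
  then show ?thesis using assms by (simp add: card_Un_disjoint finite_nb nb_def disjoint_iff)
qed

lemma pm_finite: "pm W \<Longrightarrow> finite W"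
  by (induction rule: pm.induct) auto

lemma pm_even: "pm W \<Longrightarrow> even (card W)"
proof (induction rule: pm.induct)
  case (pm_insert W u v)
  then have "card (insert u (insert v W)) = card W + 2"
    using pm_finite adj_neq[of u v] by simp
  then show ?case using pm_insert by simp
qed simp

lemma pm_pair: "u \<sim> v \<Longrightarrow> pm {u, v}"
  using pm_insert[OF pm_empty, of u v] by simp

lemma pm_Un: "pm A \<Longrightarrow> pm B \<Longrightarrow> A \<inter> B = {} \<Longrightarrow> pm (A \<union> B)"
proof (induction rule: pm.induct)
  case (pm_insert W u v)
  then show ?case using pm.pm_insert[of "W \<union> B" u v] by auto
qed simp

lemma pm_UN:
  assumes "finite I" "\<And>i. i \<in> I \<Longrightarrow> pm (g i)"
    and "\<And>i j. i \<in> I \<Longrightarrow> j \<in> I \<Longrightarrow> i \<noteq> j \<Longrightarrow> g i \<inter> g j = {}"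
  shows "pm (\<Union>(g ` I))"
  using assms
proof (induction I rule: finite_induct)
  case (insert i I)
  have "pm (g i \<union> \<Union>(g ` I))"
  proof (rule pm_Un)
    show "g i \<inter> \<Union>(g ` I) = {}" using insert.prems(2) insert.hyps by fastforce
  qed (use insert in auto)
  then show ?case by simp
qed (simp add: pm_empty)

lemma pm_remove: "pm W \<Longrightarrow> t \<in> W \<Longrightarrow> \<exists>s\<in>W. t \<sim> s \<and> pm (W - {t, s})"
proof (induction rule: pm.induct)
  case (pm_insert W u v)
  consider "t = u" | "t = v" | "t \<in> W" "t \<noteq> u" "t \<noteq> v" using pm_insert.prems by blast
  then show ?case
  proof cases
    case 1
    have "insert u (insert v W) - {u, v} = W" using pm_insert by blast
    then show ?thesis using 1 pm_insert by (intro bexI[of _ v]) auto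
  next
    case 2
    have "insert u (insert v W) - {v, u} = W" using pm_insert by blast
    then show ?thesis using 2 pm_insert adj_sym by (intro bexI[of _ u]) auto
  next
    case 3
    then obtain s where s: "s \<in> W" "t \<sim> s" "pm (W - {t, s})" using pm_insert.IH by blast
    have "pm (insert u (insert v (W - {t, s})))" using s pm_insert by (intro pm.pm_insert) auto
    moreover have "insert u (insert v (W - {t, s})) = insert u (insert v W) - {t, s}"
      using 3 s pm_insert by auto
    ultimately show ?thesis using s by auto
  qed
qed simp

lemma pm_restrict:
  "pm W \<Longrightarrow> (\<And>x y. x \<in> W \<inter> K \<Longrightarrow> y \<in> W - K \<Longrightarrow> \<not> x \<sim> y) \<Longrightarrow> pm (W \<inter> K)"
proof (induction rule: pm.induct)
  case (pm_insert W u v)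
  have IH: "pm (W \<inter> K)" using pm_insert by blast
  consider "u \<in> K" "v \<in> K" | "u \<notin> K" "v \<notin> K"
    using pm_insert.prems[of u v] pm_insert.prems[of v u] pm_insert.hyps adj_sym by blast
  then show ?case
  proof cases
    case 1
    then show ?thesis using pm.pm_insert[OF IH, of u v] pm_insert.hyps by simp
  qed (use IH in simp)
qed (simp add: pm_empty)

text \<open>Recovers an actual matching, as the map to partners, from the covered set; needed when
  partners have to be followed individually. \<open>involution_pm\<close> is the converse.\<close>

lemma pm_involution:
  "pm W \<Longrightarrow> \<exists>f. \<forall>v\<in>W. f v \<in> W \<and> v \<sim> f v \<and> f (f v) = v"
proof (induction rule: pm.induct)
  case (pm_insert W u v)
  then obtain f where f: "\<forall>v\<in>W. f v \<in> W \<and> v \<sim> f v \<and> f (f v) = v" by blast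
  let ?g = "f(u := v, v := u)"
  have uv: "u \<noteq> v" "v \<sim> u" using pm_insert.hyps adj_neq adj_sym by blast+
  have "?g w \<in> insert u (insert v W) \<and> w \<sim> ?g w \<and> ?g (?g w) = w" if w: "w \<in> insert u (insert v W)"
    for w
  proof (cases "w \<in> W")
    case True
    then have "f w \<in> W" "w \<noteq> u" "w \<noteq> v" "f w \<noteq> u" "f w \<noteq> v" using f pm_insert.hyps by metis+
    then show ?thesis using f True by simp
  next
    case False
    then show ?thesis using w uv pm_insert.hyps(2) by auto
  qed
  then show ?case by blast
qed simp

lemma involution_pm:
  assumes "finite K" "\<And>v. v \<in> K \<Longrightarrow> f v \<in> K \<and> v \<sim> f v \<and> f (f v) = v"
  shows "pm K"
  using assms
proof (induction "card K" arbitrary: K rule: less_induct)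
  case less
  show ?case
  proof (cases "K = {}")
    case False
    then obtain v where v: "v \<in> K" by blast
    let ?L = "K - {v, f v}"
    have "pm ?L"
    proof (rule less.hyps)
      show "card ?L < card K" using v less.prems(1) by (intro psubset_card_mono) auto
      show "f x \<in> ?L \<and> x \<sim> f x \<and> f (f x) = x" if "x \<in> ?L" for x
        using that v less.prems(2)[of x] less.prems(2)[of v] by auto
    qed (use less.prems in auto)
    then have "pm (insert v (insert (f v) ?L))" using less.prems(2) v by (intro pm_insert) auto
    moreover have "insert v (insert (f v) ?L) = K" using less.prems(2) v by auto
    ultimately show ?thesis by simp
  qed (simp add: pm_empty)
qed

lemma critical_finite: "critical K \<Longrightarrow> finite K"
proof -
  assume "critical K"
  then obtain x where "pm (K - {x})" unfolding critical_def by blast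
  then show ?thesis using pm_finite by fastforce
qed

lemma critical_odd: "critical K \<Longrightarrow> odd (card K)"
proof -
  assume K: "critical K"
  then obtain x where x: "x \<in> K" "pm (K - {x})" unfolding critical_def by blast
  then have "card K = Suc (card (K - {x}))" using card.remove[OF critical_finite[OF K]] by blast
  then show ?thesis using pm_even[OF x(2)] by simp
qed

lemma critical_nb:
  assumes "critical K" "z \<in> K" "card K \<noteq> 1"
  shows "nb z K \<noteq> {}"
proof -
  have "K \<noteq> {z}" using assms(3) by auto
  then obtain x where x: "x \<in> K" "x \<noteq> z" using assms(2) by blast
  have "pm (K - {x})" using assms(1) x(1) by (simp add: critical_def)
  moreover have "z \<in> K - {x}" using assms(2) x by blast
  ultimately obtain s where "s \<in> K - {x}" "z \<sim> s" using pm_remove by blast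
  then show ?thesis unfolding nb_def by blast
qed

text \<open>A part of odd order cannot be matched inside itself, so some matching edge leaves it,
  and by \<open>out\<close> that edge ends in \<open>T\<close>. Partners are unique, so different
  parts use different exits.\<close>

lemma pm_odd_exits:
  assumes "pm W" and "\<And>K. K \<in> \<C> \<Longrightarrow> K \<subseteq> W \<and> odd (card K)"
    and disj: "\<And>K L. K \<in> \<C> \<Longrightarrow> L \<in> \<C> \<Longrightarrow> K \<noteq> L \<Longrightarrow> K \<inter> L = {}"
    and out: "\<And>K z v. K \<in> \<C> \<Longrightarrow> z \<in> K \<Longrightarrow> v \<in> W \<Longrightarrow> z \<sim> v \<Longrightarrow> v \<in> K \<union> T"
  shows "\<exists>\<mu>. inj_on \<mu> \<C> \<and> (\<forall>K\<in>\<C>. \<mu> K \<in> T \<inter> W \<and> (\<exists>z\<in>K. z \<sim> \<mu> K))"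
proof -
  obtain f where f: "\<And>v. v \<in> W \<Longrightarrow> f v \<in> W \<and> v \<sim> f v \<and> f (f v) = v"
    using pm_involution[OF assms(1)] by blast
  have "\<exists>z. z \<in> K \<and> f z \<notin> K" if K: "K \<in> \<C>" for K
  proof (rule ccontr)
    assume "\<not> ?thesis"
    then have "pm K" using f assms(2)[OF K] pm_finite[OF assms(1)]
      by (intro involution_pm[of K f]) (auto intro: finite_subset)
    then show False using pm_even assms(2)[OF K] by blast
  qed
  then obtain g where g: "\<And>K. K \<in> \<C> \<Longrightarrow> g K \<in> K \<and> f (g K) \<notin> K" by metis
  have gW: "g K \<in> W" if "K \<in> \<C>" for K using g assms(2) that by blast
  have "inj_on (\<lambda>K. f (g K)) \<C>"
  proof (rule inj_onI)
    fix K L assume KL: "K \<in> \<C>" "L \<in> \<C>" "f (g K) = f (g L)"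
    then have "g K = g L" using f[OF gW[OF KL(1)]] f[OF gW[OF KL(2)]] by metis
    then show "K = L" using disj[OF KL(1,2)] g[OF KL(1)] g[OF KL(2)] by auto
  qed
  moreover have "\<forall>K\<in>\<C>. f (g K) \<in> T \<inter> W \<and> (\<exists>z\<in>K. z \<sim> f (g K))"
  proof
    fix K assume K: "K \<in> \<C>"
    have "f (g K) \<in> W" "g K \<sim> f (g K)" using f[OF gW[OF K]] by auto
    then show "f (g K) \<in> T \<inter> W \<and> (\<exists>z\<in>K. z \<sim> f (g K))" using out[OF K, of "g K"] g[OF K] by blast
  qed
  ultimately show ?thesis by blast
qed

text \<open>The easy inequality of Tutte and Berge, for a matching that need not cover the parts: a
  part inside \<open>W\<close> uses a vertex of \<open>T\<close>, any other part has an uncovered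
  vertex of its own.\<close>

lemma pm_count:
  assumes "pm W" "finite \<C>" "\<And>K. K \<in> \<C> \<Longrightarrow> finite K \<and> odd (card K)"
    and disj: "\<And>K L. K \<in> \<C> \<Longrightarrow> L \<in> \<C> \<Longrightarrow> K \<noteq> L \<Longrightarrow> K \<inter> L = {}"
    and out: "\<And>K z v. K \<in> \<C> \<Longrightarrow> z \<in> K \<Longrightarrow> v \<in> W \<Longrightarrow> z \<sim> v \<Longrightarrow> v \<in> K \<union> T"
  shows "card \<C> \<le> card (\<Union>\<C> - W) + card (T \<inter> W)"
proof -
  define \<A> where "\<A> = {K \<in> \<C>. K \<subseteq> W}"
  obtain \<mu> where mu: "inj_on \<mu> \<A>" "\<And>K. K \<in> \<A> \<Longrightarrow> \<mu> K \<in> T \<inter> W"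
  proof -
    have "\<exists>\<mu>. inj_on \<mu> \<A> \<and> (\<forall>K\<in>\<A>. \<mu> K \<in> T \<inter> W \<and> (\<exists>z\<in>K. z \<sim> \<mu> K))"
    proof (rule pm_odd_exits)
      show "K \<inter> L = {}" if "K \<in> \<A>" "L \<in> \<A>" "K \<noteq> L" for K L
        using disj that by (auto simp: \<A>_def)
      show "v \<in> K \<union> T" if "K \<in> \<A>" "z \<in> K" "v \<in> W" "z \<sim> v" for K z v
        using out that by (auto simp: \<A>_def)
    qed (use assms in \<open>auto simp: \<A>_def\<close>)
    then show thesis using that by blast
  qed
  have A: "card \<A> \<le> card (T \<inter> W)"
    using mu pm_finite[OF assms(1)] by (intro card_inj_on_le[of \<mu>]) auto
  have "\<exists>z. z \<in> K - W" if "K \<in> \<C> - \<A>" for K using that by (auto simp: \<A>_def)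
  then obtain g where g: "\<And>K. K \<in> \<C> - \<A> \<Longrightarrow> g K \<in> K - W" by metis
  have "inj_on g (\<C> - \<A>)"
  proof (rule inj_onI)
    fix K L assume KL: "K \<in> \<C> - \<A>" "L \<in> \<C> - \<A>" "g K = g L"
    then show "K = L" using disj[of K L] g[of K] g[of L] by auto
  qed
  moreover have "g ` (\<C> - \<A>) \<subseteq> \<Union>\<C> - W" using g by blast
  moreover have "finite (\<Union>\<C> - W)" using assms by auto
  ultimately have "card (\<C> - \<A>) \<le> card (\<Union>\<C> - W)" by (meson card_inj_on_le)
  moreover have "card \<C> = card \<A> + card (\<C> - \<A>)"
    using assms(2) card_mono[of \<C> \<A>] by (subst card_Diff_subset) (auto simp: \<A>_def)
  ultimately show ?thesis using A by simp
qed

lemma ex_max_pm: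
  assumes "finite A"
  shows "\<exists>U. U \<subseteq> A \<and> pm U \<and> (\<forall>U'. U' \<subseteq> A \<longrightarrow> pm U' \<longrightarrow> card U' \<le> card U)"
proof -
  define S where "S = {U. U \<subseteq> A \<and> pm U}"
  have "finite S" using assms by (simp add: S_def)
  moreover have "S \<noteq> {}" using pm_empty by (auto simp: S_def)
  ultimately have "Max (card ` S) \<in> card ` S" by (intro Max_in) auto
  then obtain U where U: "U \<in> S" "card U = Max (card ` S)" by auto
  have "card U' \<le> card U" if "U' \<in> S" for U'
    using that \<open>finite S\<close> by (simp add: U(2))
  then show ?thesis using U(1) by (auto simp: S_def)
qed

text \<open>Independence of the uncovered vertices is how maximality of a matching is expressed
  throughout; a largest \<open>U\<close> in the complement of \<open>W\<close> achieves it.\<close>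

lemma pm_extend:
  assumes "finite V" "W \<subseteq> V" "pm W"
  shows "\<exists>U. U \<subseteq> V - W \<and> pm U \<and> indep (V - (W \<union> U))"
proof -
  obtain U where U: "U \<subseteq> V - W" "pm U" "\<And>U'. U' \<subseteq> V - W \<Longrightarrow> pm U' \<Longrightarrow> card U' \<le> card U"
    using ex_max_pm[of "V - W"] assms(1) by auto
  have "\<not> u \<sim> v" if "u \<in> V - (W \<union> U)" "v \<in> V - (W \<union> U)" for u v
  proof
    assume uv: "u \<sim> v"
    then have "pm (insert u (insert v U))" using U(2) that by (intro pm_insert) auto
    moreover have "insert u (insert v U) \<subseteq> V - W" using U(1) that by auto
    ultimately have "card (insert u (insert v U)) \<le> card U" by (rule U(3)[rotated])
    moreover have "card (insert u (insert v U)) = card U + 2"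
      using that pm_finite[OF U(2)] adj_neq[OF uv] by simp
    ultimately show False by simp
  qed
  then have "indep (V - (W \<union> U))" unfolding indep_def by blast
  then show ?thesis using U(1,2) by blast
qed

text \<open>
  The alternating path that starts at \<open>t\<close> in the symmetric difference of a perfect matching of
  \<open>W\<close> and one of \<open>W'\<close> ends either in \<open>W' - W\<close> or in \<open>W - W'\<close>.
\<close>

lemma pm_exchange:
  assumes "pm W" "pm W'" "t \<in> W" "t \<notin> W'"
  shows "(\<exists>x\<in>W' - W. pm (insert x (W - {t}))) \<or>
    (\<exists>s\<in>W - W'. s \<noteq> t \<and> pm (insert t (insert s W')))"
  using assms
proof (induction "card W" arbitrary: W W' t rule: less_induct)
  case less
  obtain s where s: "s \<in> W" "t \<sim> s" "pm (W - {t, s})" using pm_remove less.prems by blast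
  have ts: "t \<noteq> s" using s adj_neq by blast
  show ?case
  proof (cases "s \<in> W'")
    case False
    have "pm (insert t (insert s W'))" using less.prems s False by (intro pm_insert)
    then show ?thesis using s(1) ts False by (intro disjI2 bexI[of _ s]) auto
  next
    case True
    then obtain w where w: "w \<in> W'" "s \<sim> w" "pm (W' - {s, w})"
      using pm_remove less.prems by blast
    have sw: "s \<noteq> w" using w adj_neq by blast
    have wt: "w \<noteq> t" using w less.prems by blast
    show ?thesis
    proof (cases "w \<in> W")
      case False
      have "pm (insert s (insert w (W - {t, s})))" using s w False by (intro pm_insert) auto
      moreover have "insert s (insert w (W - {t, s})) = insert w (W - {t})" using s ts by auto
      ultimately show ?thesis using w False by auto
    next
      case True
      let ?X = "W - {t, s}" and ?X' = "W' - {s, w}"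
      have "card ?X < card W" using pm_finite less.prems by (intro psubset_card_mono) auto
      then have "(\<exists>x\<in>?X' - ?X. pm (insert x (?X - {w}))) \<or>
          (\<exists>y\<in>?X - ?X'. y \<noteq> w \<and> pm (insert w (insert y ?X')))"
        using less.hyps[of ?X ?X' w] s w True sw wt by blast
      then show ?thesis
      proof (elim disjE bexE conjE)
        fix x assume x: "x \<in> ?X' - ?X" "pm (insert x (?X - {w}))"
        then have xW: "x \<in> W' - W" using less.prems by auto
        have "pm (insert s (insert w (insert x (?X - {w}))))"
        proof (rule pm_insert[OF x(2) w(2)])
          show "s \<notin> insert x (?X - {w})" using xW s by auto
          show "w \<notin> insert x (?X - {w})" using xW True by auto
        qed
        moreover have "insert s (insert w (insert x (?X - {w}))) = insert x (W - {t})"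
          using s ts True wt by auto
        ultimately show ?thesis using xW by auto
      next
        fix y assume y: "y \<in> ?X - ?X'" "y \<noteq> w" "pm (insert w (insert y ?X'))"
        have "pm (insert t (insert s (insert w (insert y ?X'))))"
        proof (rule pm_insert[OF y(3) s(2)])
          show "t \<notin> insert w (insert y ?X')" using wt y less.prems by auto
          show "s \<notin> insert w (insert y ?X')" using sw y by auto
        qed
        moreover have "insert t (insert s (insert w (insert y ?X'))) = insert t (insert y W')"
          using w \<open>s \<in> W'\<close> by auto
        ultimately show ?thesis using y ts by auto
      qed
    qed
  qed
qed

end

section \<open>Gallai--Edmonds barriers\<close>

context sgraph
begin

text \<open>
  The parts of a barrier need not be connected; only the absence of edges between them matters.
\<close>

definition barrier :: "'a set \<Rightarrow> 'a set \<Rightarrow> 'a set set \<Rightarrow> bool" where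
  "barrier V T \<K> \<longleftrightarrow> T \<subseteq> V \<and> \<Union>\<K> = V - T \<and> (\<forall>K\<in>\<K>. critical K) \<and>
    (\<forall>K\<in>\<K>. \<forall>L\<in>\<K>. K \<noteq> L \<longrightarrow> K \<inter> L = {}) \<and>
    (\<forall>K\<in>\<K>. \<forall>u\<in>K. \<forall>v\<in>V - T. u \<sim> v \<longrightarrow> v \<in> K)"

text \<open>
  If every vertex is missed by a maximum matching, then "never missed together" is an equivalence
  relation by the exchange property, and its classes are critical.
\<close>

lemma critical_partition:
  assumes V: "finite V" and W: "W \<subseteq> V" "pm W"
    and max: "\<And>U. U \<subseteq> V \<Longrightarrow> pm U \<Longrightarrow> card U \<le> card W"
    and missed: "\<And>v. v \<in> V \<Longrightarrow> \<exists>U. U \<subseteq> V \<and> pm U \<and> card U = card W \<and> v \<notin> U"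
  shows "\<exists>\<K>. barrier V {} \<K> \<and> card \<K> = card (V - W)"
proof -
  define M where "M U \<longleftrightarrow> U \<subseteq> V \<and> pm U \<and> card U = card W" for U
  have M_W: "M W" using W by (simp add: M_def)
  have M_indep: "\<not> u \<sim> v" if "M U" "u \<in> V - U" "v \<in> V - U" for U u v
  proof
    assume uv: "u \<sim> v"
    have "pm (insert u (insert v U))" using that uv by (intro pm_insert) (auto simp: M_def)
    then have "card (insert u (insert v U)) \<le> card U" using that max by (auto simp: M_def)
    moreover have "card (insert u (insert v U)) = card U + 2"
      using that pm_finite[of U] adj_neq[OF uv] by (simp add: M_def)
    ultimately show False by simp
  qed
  have M_exchange: "\<exists>x\<in>U' - U. M (insert x (U - {t}))" if M: "M U" "M U'" "t \<in> U" "t \<notin> U'"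
    for U U' t
  proof -
    have pU: "pm U" "pm U'" "finite U" "finite U'" using that by (auto simp: M_def pm_finite)
    \<comment> \<open>The other possible end of the alternating path would enlarge the maximum
      \<open>U'\<close>.\<close>
    have "\<not> (\<exists>s\<in>U - U'. s \<noteq> t \<and> pm (insert t (insert s U')))"
    proof
      assume "\<exists>s\<in>U - U'. s \<noteq> t \<and> pm (insert t (insert s U'))"
      then obtain s where s: "s \<in> U - U'" "s \<noteq> t" "pm (insert t (insert s U'))" by blast
      have "insert t (insert s U') \<subseteq> V" using s that by (auto simp: M_def)
      from max[OF this s(3)] have "card (insert t (insert s U')) \<le> card U'"
        using that by (simp add: M_def)
      then show False using s pU that by simp
    qed
    then obtain x where x: "x \<in> U' - U" "pm (insert x (U - {t}))"
      using pm_exchange[OF pU(1,2) M(3,4)] by blast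
    have "card (insert x (U - {t})) = card U"
      using x that(3) pU(3) by (simp add: card_Suc_Diff1 del: card_Diff_insert)
    then show ?thesis using x that by (auto simp: M_def)
  qed
  define E where "E = {(u, v). u \<in> V \<and> v \<in> V \<and> (u = v \<or> \<not> (\<exists>U. M U \<and> u \<notin> U \<and> v \<notin> U))}"
  have E_I: "(u, v) \<in> E" if "u \<in> V" "v \<in> V" "\<And>U. M U \<Longrightarrow> u \<notin> U \<Longrightarrow> v \<notin> U \<Longrightarrow> False" for u v
    using that by (auto simp: E_def)
  have E_D: "False" if "(u, v) \<in> E" "u \<noteq> v" "M U" "u \<notin> U" "v \<notin> U" for u v U
    using that by (auto simp: E_def)
  have E_sym: "(v, u) \<in> E" if "(u, v) \<in> E" for u v using that by (auto simp: E_def)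
  have E_V: "u \<in> V \<and> v \<in> V" if "(u, v) \<in> E" for u v using that by (auto simp: E_def)
  have E_trans: "(u, v) \<in> E" if uw: "(u, w) \<in> E" and wv: "(w, v) \<in> E" for u v w
  proof (cases "u = w \<or> w = v \<or> u = v")
    case True
    then show ?thesis using uw wv E_V[OF uw] by (auto simp: E_def)
  next
    case False
    show ?thesis
    proof (rule E_I)
      fix U assume U: "M U" "u \<notin> U" "v \<notin> U"
      \<comment> \<open>Gallai's argument: a maximum \<open>U\<close> missing both \<open>u\<close>
        and \<open>v\<close> must cover \<open>w\<close>. Exchanging \<open>w\<close> for a single
        vertex \<open>x\<close> leaves \<open>w\<close> missed together with \<open>u\<close> or
        \<open>v\<close>, since \<open>x\<close> can be only one of them.\<close>
      have "w \<in> U" using E_D[OF uw _ U(1,2)] False by blast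
      obtain U' where U': "M U'" "w \<notin> U'" using missed[of w] E_V[OF uw] by (auto simp: M_def)
      then obtain x where xU: "x \<in> U' - U" and x: "M (insert x (U - {w}))"
        using M_exchange[OF U(1) U'(1) \<open>w \<in> U\<close>] by blast
      show False
      proof (cases "x = u")
        case True
        show False by (rule E_D[OF wv _ x]) (use True False U xU \<open>w \<in> U\<close> in auto)
      next
        case F: False
        show False by (rule E_D[OF uw _ x]) (use F False U xU \<open>w \<in> U\<close> in auto)
      qed
    qed (use E_V uw wv in auto)
  qed
  have equiv: "equiv V E"
  proof (rule equivI)
    show "E \<subseteq> V \<times> V" using E_V by auto
    show "refl_on V E" by (auto simp: refl_on_def E_def)
    show "sym E" using E_sym by (auto simp: sym_def)
    show "trans E" using E_trans by (auto simp: trans_def)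
  qed
  define \<K> where "\<K> = V // E"
  have sub: "K \<subseteq> V" if "K \<in> \<K>" for K using that equiv by (metis Union_quotient Union_upper \<K>_def)
  have same: "(u, v) \<in> E" if "K \<in> \<K>" "u \<in> K" "v \<in> K" for K u v
    using that equiv by (metis \<K>_def in_quotient_imp_in_rel empty_subsetI insert_subset)
  have closed: "v \<in> K" if "K \<in> \<K>" "u \<in> K" "(u, v) \<in> E" for K u v
    using that equiv by (metis \<K>_def in_quotient_imp_closed)
  have nocross: "v \<in> K" if K: "K \<in> \<K>" "u \<in> K" "v \<in> V" "u \<sim> v" for K u v
  proof (rule closed[OF K(1,2)], rule E_I)
    show "u \<in> V" using sub[OF K(1)] K(2) by blast
    show "v \<in> V" by fact
    show False if "M U" "u \<notin> U" "v \<notin> U" for U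
      using M_indep[OF that(1), of u v] that K \<open>u \<in> V\<close> by blast
  qed
  have restr: "pm (U \<inter> K)" if "M U" "K \<in> \<K>" for U K
  proof (rule pm_restrict)
    show "pm U" using that by (simp add: M_def)
    show "\<not> x \<sim> y" if "x \<in> U \<inter> K" "y \<in> U - K" for x y
      using nocross[OF \<open>K \<in> \<K>\<close>, of x y] that \<open>M U\<close> by (auto simp: M_def)
  qed
  have crit: "critical K" if K: "K \<in> \<K>" for K
  proof -
    have "pm (K - {x})" if x: "x \<in> K" for x
    proof -
      have "x \<in> V" using sub[OF K] x by blast
      then obtain U where U: "M U" "x \<notin> U" using missed[of x] by (auto simp: M_def)
      have "y \<in> U" if "y \<in> K" "y \<noteq> x" for y
        using E_D[OF same[OF K x that(1)] _ U] that by blast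
      then have "U \<inter> K = K - {x}" using U by blast
      then show ?thesis using restr[OF U(1) K] by simp
    qed
    moreover have "K \<noteq> {}" using K equiv by (metis \<K>_def in_quotient_imp_non_empty)
    ultimately show ?thesis by (simp add: critical_def)
  qed
  \<comment> \<open>A class has odd order and \<open>W\<close> meets it in a set with a perfect
    matching, so \<open>W\<close> misses a vertex of every class; by definition of \<open>E\<close>
    it misses no two vertices of one class.\<close>
  have "bij_betw (\<lambda>x. E `` {x}) (V - W) \<K>"
    unfolding bij_betw_def
  proof
    show "inj_on (\<lambda>x. E `` {x}) (V - W)"
    proof (rule inj_onI)
      fix x y assume xy: "x \<in> V - W" "y \<in> V - W" "E `` {x} = E `` {y}"
      then have "(x, y) \<in> E" using equiv eq_equiv_class_iff[OF equiv, of x y] by blast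
      then show "x = y" using E_D[OF _ _ M_W, of x y] xy by blast
    qed
    show "(\<lambda>x. E `` {x}) ` (V - W) = \<K>"
    proof (intro subset_antisym subsetI)
      fix K assume "K \<in> (\<lambda>x. E `` {x}) ` (V - W)"
      then show "K \<in> \<K>" by (auto simp: \<K>_def quotientI)
    next
      fix K assume K: "K \<in> \<K>"
      have "W \<inter> K \<noteq> K" using pm_even[OF restr[OF M_W K]] critical_odd[OF crit[OF K]] by metis
      then obtain x where x: "x \<in> K" "x \<notin> W" by blast
      have "E `` {x} = K"
      proof (intro subset_antisym subsetI)
        fix y assume "y \<in> E `` {x}" then show "y \<in> K" using closed[OF K x(1)] by blast
      next
        fix y assume "y \<in> K" then show "y \<in> E `` {x}" using same[OF K x(1)] by blast
      qed
      then show "K \<in> (\<lambda>x. E `` {x}) ` (V - W)" using x sub[OF K] by blast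
    qed
  qed
  then have "card \<K> = card (V - W)" using bij_betw_same_card by metis
  moreover have "barrier V {} \<K>"
    unfolding barrier_def
  proof (intro conjI ballI impI)
    show "\<Union>\<K> = V - {}" using Union_quotient[OF equiv] by (simp add: \<K>_def)
    show "K \<inter> L = {}" if "K \<in> \<K>" "L \<in> \<K>" "K \<noteq> L" for K L
      using quotient_disj[OF equiv, of K L] that by (auto simp: \<K>_def)
  qed (use crit nocross in auto)
  ultimately show ?thesis by blast
qed

text \<open>A vertex \<open>v\<close> covered by every maximum matching is put into
  \<open>T\<close>: without it the maximum drops by one edge, so one more vertex is missed among the
  rest, which pays for the larger \<open>T\<close>. If there is no such vertex, \<open>T\<close> is
  empty and \<open>critical_partition\<close> applies.\<close>

theorem gallai_edmonds_barrier:
  assumes "finite V"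
  shows "\<exists>T \<K> W. barrier V T \<K> \<and> W \<subseteq> V \<and> pm W \<and> (\<forall>U. U \<subseteq> V \<longrightarrow> pm U \<longrightarrow> card U \<le> card W) \<and>
    card \<K> = card T + card (V - W)"
  using assms
proof (induction "card V" arbitrary: V rule: less_induct)
  case less
  obtain W where W: "W \<subseteq> V" "pm W" "\<And>U. U \<subseteq> V \<Longrightarrow> pm U \<Longrightarrow> card U \<le> card W"
    using ex_max_pm[OF less.prems] by blast
  show ?case
  proof (cases "\<forall>v\<in>V. \<exists>U. U \<subseteq> V \<and> pm U \<and> card U = card W \<and> v \<notin> U")
    case True
    then obtain \<K> where "barrier V {} \<K>" "card \<K> = card (V - W)"
      using critical_partition[OF less.prems W] by blast
    then show ?thesis using W by (intro exI[of _ "{}"] exI[of _ \<K>] exI[of _ W]) auto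
  next
    case False
    then obtain v where v: "v \<in> V" "\<And>U. U \<subseteq> V \<Longrightarrow> pm U \<Longrightarrow> card U = card W \<Longrightarrow> v \<in> U" by blast
    have "card (V - {v}) < card V" using v less.prems by (intro psubset_card_mono) auto
    then obtain T \<K> W' where IH: "barrier (V - {v}) T \<K>" "W' \<subseteq> V - {v}" "pm W'"
      "\<And>U. U \<subseteq> V - {v} \<Longrightarrow> pm U \<Longrightarrow> card U \<le> card W'" "card \<K> = card T + card (V - {v} - W')"
      using less.hyps[of "V - {v}"] less.prems by blast
    have vW: "v \<in> W" using v(2)[OF W(1,2)] by simp
    obtain s where s: "s \<in> W" "v \<sim> s" "pm (W - {v, s})" using pm_remove[OF W(2) vW] by blast
    have finW: "finite W" "finite W'" using W IH pm_finite by auto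
    have vs: "v \<noteq> s" using s adj_neq by blast
    have "card (W - {v, s}) = card W - 2" using finW s vW vs by (simp add: card_Diff_subset)
    moreover have "card (W - {v, s}) \<le> card W'" using W(1) s by (intro IH(4)) auto
    ultimately have 1: "card W - 2 \<le> card W'" by simp
    have W'V: "W' \<subseteq> V" "v \<notin> W'" using IH(2) by auto
    have "card W' \<noteq> card W" using v(2)[OF W'V(1) IH(3)] W'V(2) by metis
    moreover have "card W' \<le> card W" by (rule W(3)[OF W'V(1) IH(3)])
    moreover have "even (card W)" "even (card W')" using pm_even W(2) IH(3) by auto
    moreover have "card W \<ge> 2" using card_mono[of W "{v, s}"] finW s vW vs by simp
    \<comment> \<open>Parity excludes the intermediate value \<open>card W - 1\<close>.\<close>
    ultimately have c: "card W = card W' + 2" using 1 by presburger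
    have T: "T \<subseteq> V - {v}" using IH(1) by (simp add: barrier_def)
    have "V - insert v T = V - {v} - T" by blast
    moreover have "insert v T \<subseteq> V" using T v(1) by blast
    ultimately have b: "barrier V (insert v T) \<K>" using IH(1) by (simp add: barrier_def)
    have "finite T" "v \<notin> T" using T less.prems finite_subset by auto
    then have "card (insert v T) = card T + 1" by simp
    moreover have "card (V - {v} - W') = card V - 1 - card W'"
      using IH(2) finW v less.prems by (subst card_Diff_subset) auto
    moreover have "card (V - W) = card V - card W" using W(1) finW by (subst card_Diff_subset) auto
    moreover have "card W \<le> card V" using W(1) less.prems card_mono by blast
    ultimately have "card \<K> = card (insert v T) + card (V - W)" using IH(5) c by simp
    then show ?thesis using b W by blast
  qed
qed

end

section \<open>Factor-criticality\<close>

context sgraph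
begin

lemma pm_inj_matching:
  assumes "finite A" "inj_on f A" "\<And>a. a \<in> A \<Longrightarrow> a \<sim> f a" "f ` A \<inter> A = {}"
  shows "pm (A \<union> f ` A)"
proof -
  have "pm (\<Union>((\<lambda>a. {a, f a}) ` A))"
  proof (rule pm_UN)
    fix a b assume ab: "a \<in> A" "b \<in> A" "a \<noteq> b"
    then have "f a \<noteq> f b" "f a \<noteq> b" "f b \<noteq> a" using assms(2,4) by (auto simp: inj_on_def)
    then show "{a, f a} \<inter> {b, f b} = {}" using ab by auto
  qed (use assms pm_pair in auto)
  moreover have "\<Union>((\<lambda>a. {a, f a}) ` A) = A \<union> f ` A" by auto
  ultimately show ?thesis by simp
qed

text \<open>An outside vertex with a neighbour \<open>z\<close> in a critical part completes it:
  match it to \<open>z\<close> and use the perfect matching of the part without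
  \<open>z\<close>.\<close>

lemma pm_critical_matched:
  assumes "finite \<A>" "\<And>K. K \<in> \<A> \<Longrightarrow> critical K"
    and disj: "\<And>K L. K \<in> \<A> \<Longrightarrow> L \<in> \<A> \<Longrightarrow> K \<noteq> L \<Longrightarrow> K \<inter> L = {}"
    and "inj_on f \<A>" "\<And>K. K \<in> \<A> \<Longrightarrow> \<exists>z\<in>K. z \<sim> f K" "f ` \<A> \<inter> \<Union>\<A> = {}"
  shows "pm (\<Union>\<A> \<union> f ` \<A>)"
proof -
  have "pm (\<Union>((\<lambda>K. insert (f K) K) ` \<A>))"
  proof (rule pm_UN)
    fix K assume K: "K \<in> \<A>"
    then obtain z where z: "z \<in> K" "z \<sim> f K" using assms(5) by blast
    have "pm (K - {z})" using assms(2)[OF K] z by (simp add: critical_def)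
    moreover have "f K \<notin> K" using assms(6) K by blast
    ultimately have "pm (insert z (insert (f K) (K - {z})))" using z by (intro pm_insert) auto
    moreover have "insert z (insert (f K) (K - {z})) = insert (f K) K" using z by auto
    ultimately show "pm (insert (f K) K)" by simp
  next
    fix K L assume KL: "K \<in> \<A>" "L \<in> \<A>" "K \<noteq> L"
    then have "f K \<noteq> f L" "f K \<notin> L" "f L \<notin> K" using assms(4,6) by (auto simp: inj_on_def)
    then show "insert (f K) K \<inter> insert (f L) L = {}" using disj[OF KL] by auto
  qed fact
  moreover have "\<Union>((\<lambda>K. insert (f K) K) ` \<A>) = \<Union>\<A> \<union> f ` \<A>" by auto
  ultimately show ?thesis by simp
qed

lemma pm_critical_missing:
  assumes "finite \<A>" "\<And>K. K \<in> \<A> \<Longrightarrow> critical K" "\<And>K. K \<in> \<A> \<Longrightarrow> z K \<in> K"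
    and disj: "\<And>K L. K \<in> \<A> \<Longrightarrow> L \<in> \<A> \<Longrightarrow> K \<noteq> L \<Longrightarrow> K \<inter> L = {}"
  shows "pm (\<Union>K\<in>\<A>. K - {z K})"
proof (rule pm_UN)
  show "(K - {z K}) \<inter> (L - {z L}) = {}" if "K \<in> \<A>" "L \<in> \<A>" "K \<noteq> L" for K L
    using disj[OF that] by blast
qed (use assms in \<open>auto simp: critical_def\<close>)

lemma
  assumes "barrier V T \<K>"
  shows barrier_subset: "T \<subseteq> V" and barrier_Union: "\<Union>\<K> = V - T"
    and barrier_critical: "K \<in> \<K> \<Longrightarrow> critical K"
    and barrier_disjoint: "K \<in> \<K> \<Longrightarrow> L \<in> \<K> \<Longrightarrow> K \<noteq> L \<Longrightarrow> K \<inter> L = {}"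
    and barrier_nocross: "K \<in> \<K> \<Longrightarrow> u \<in> K \<Longrightarrow> v \<in> V - T \<Longrightarrow> u \<sim> v \<Longrightarrow> v \<in> K"
  using assms by (simp_all add: barrier_def)

lemma barrier_count:
  assumes "finite V" "barrier V T \<K>" "U \<subseteq> V" "pm U"
  shows "card \<K> \<le> card (\<Union>\<K> - U) + card (T \<inter> U)"
proof (rule pm_count[OF assms(4)])
  have "\<Union>\<K> \<subseteq> V" using assms(2) by (auto simp: barrier_def)
  then show "finite \<K>" using assms(1) finite_UnionD finite_subset by blast
  show "finite K \<and> odd (card K)" if "K \<in> \<K>" for K
    using assms(2) critical_finite critical_odd that by (simp add: barrier_def)
  show "K \<inter> L = {}" if "K \<in> \<K>" "L \<in> \<K>" "K \<noteq> L" for K L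
    using assms(2) that by (simp add: barrier_def)
  show "v \<in> K \<union> T" if "K \<in> \<K>" "z \<in> K" "v \<in> U" "z \<sim> v" for K z v
    using barrier_nocross[OF assms(2) that(1,2) _ that(4)] assms(3) that(3) by blast
qed

end

text \<open>Connectedness is stated as the absence of proper nonempty sets closed under adjacency,
  and equimatchability through the vertex sets covered by maximal matchings: these are the forms in
  which both are applied.\<close>

locale regular_equimatchable = sgraph adj for adj :: "'a \<Rightarrow> 'a \<Rightarrow> bool" (infix "\<sim>" 50) +
  fixes V :: "'a set" and r :: nat
  assumes fin: "finite V"
    and adj_V: "u \<sim> v \<Longrightarrow> u \<in> V"
    and reg: "v \<in> V \<Longrightarrow> deg v V = r"
    and conn: "C \<subseteq> V \<Longrightarrow> C \<noteq> {} \<Longrightarrow> (\<And>u v. u \<in> C \<Longrightarrow> u \<sim> v \<Longrightarrow> v \<in> C) \<Longrightarrow> C = V"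
    and equi: "U \<subseteq> V \<Longrightarrow> pm U \<Longrightarrow> indep (V - U) \<Longrightarrow>
      U' \<subseteq> V \<Longrightarrow> pm U' \<Longrightarrow> indep (V - U') \<Longrightarrow> card U = card U'"
    and odd_V: "odd (card V)"
    and even_r: "even r"
    and r6: "r \<ge> 6"
begin

lemma adj_V2: "u \<sim> v \<Longrightarrow> v \<in> V"
  using adj_V adj_sym by blast

lemma card_nb_le: "B \<subseteq> V \<Longrightarrow> v \<in> V \<Longrightarrow> deg v B \<le> r"
  using reg[of v] card_mono[of "nb v V" "nb v B"] fin by (auto simp: nb_def)

text \<open>For \<open>a\<close> in \<open>T\<close> a matching is built that blocks
  \<open>a\<close>: parts consisting only of neighbours of \<open>a\<close> are covered with the
  help of \<open>T - {a}\<close>, every other part is covered up to a non-neighbour of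
  \<open>a\<close>. Every maximal extension misses \<open>a\<close>, yet maximal matchings must
  cover \<open>T\<close>. Hall's condition for the first kind of parts could fail only if the graph
  had exactly \<open>2 * r\<close> vertices, an even number.\<close>

lemma barrier_factor_critical:
  assumes bar: "barrier V T \<K>" and W: "W \<subseteq> V" "pm W" "indep (V - W)"
    and card: "card \<K> = card T + card (V - W)"
  shows "T = {}"
proof (rule ccontr)
  assume "T \<noteq> {}"
  then obtain a where a: "a \<in> T" by blast
  note TV = barrier_subset[OF bar] and UK = barrier_Union[OF bar]
    and crit = barrier_critical[OF bar]
    and disj = barrier_disjoint[OF bar] and nocross = barrier_nocross[OF bar]
  have finT: "finite T" using TV fin finite_subset by blast
  have fin\<K>: "finite \<K>" using UK fin by (metis finite_Diff finite_UnionD)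
  have same: "card (V - U) = card (V - W)" if "U \<subseteq> V" "pm U" "indep (V - U)" for U
    using equi[OF that W] that(1) W(1) fin by (simp add: card_Diff_subset finite_subset)
  \<comment> \<open>A vertex missed in \<open>T\<close> also leaves one more part deficient, while
    the number of missed vertices is fixed.\<close>
  have T_cov: "T \<subseteq> U" if U: "U \<subseteq> V" "pm U" "indep (V - U)" for U
  proof -
    have "V - U = (\<Union>\<K> - U) \<union> (T - U)" using UK TV by blast
    moreover have "card ((\<Union>\<K> - U) \<union> (T - U)) = card (\<Union>\<K> - U) + card (T - U)"
      using finT fin UK by (intro card_Un_disjoint) auto
    ultimately have "card (V - U) = card (\<Union>\<K> - U) + card (T - U)" by simp
    moreover have "card T = card (T \<inter> U) + card (T - U)" using finT
      by (metis Int_Diff_disjoint Int_Diff_Un card_Un_disjoint finite_Diff finite_Int)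
    ultimately have "card (T - U) = 0"
      using barrier_count[OF fin bar U(1,2)] same[OF U] card by simp
    then show ?thesis using finT by auto
  qed
  \<comment> \<open>An edge inside \<open>T\<close> uses up two vertices of \<open>T\<close> without
    serving a part, so two more parts would stay deficient.\<close>
  have T_indep: "\<not> u \<sim> v" if uv: "u \<in> T" "v \<in> T" for u v
  proof
    assume "u \<sim> v"
    then have p: "pm {u, v}" "u \<noteq> v" using pm_pair adj_neq by auto
    obtain U where U: "U \<subseteq> V - {u, v}" "pm U" "indep (V - ({u, v} \<union> U))"
      using pm_extend[OF fin, of "{u, v}"] p uv TV by blast
    have "pm ({u, v} \<union> U)" using pm_Un[OF p(1) U(2)] U(1) by blast
    then have eq: "card (V - ({u, v} \<union> U)) = card (V - W)"
      using same[of "{u, v} \<union> U"] U uv TV by blast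
    have "card (\<Union>\<K> - U) \<le> card (V - ({u, v} \<union> U))"
      using UK uv fin by (intro card_mono) auto
    moreover have "card (T \<inter> U) \<le> card (T - {u, v})" using U finT by (intro card_mono) auto
    moreover have "card (T - {u, v}) + 2 = card T"
      using uv p(2) finT card_mono[of T "{u, v}"] by (simp add: card_Diff_subset)
    moreover have "card \<K> \<le> card (\<Union>\<K> - U) + card (T \<inter> U)"
      using barrier_count[OF fin bar _ U(2)] U(1) by blast
    ultimately show False using card eq by simp
  qed
  define A where "A = {K \<in> \<K>. K \<subseteq> nb a V}"
  define N where "N K = {t \<in> T - {a}. \<exists>z\<in>K. z \<sim> t}" for K
  have "\<exists>f. inj_on f A \<and> (\<forall>K\<in>A. f K \<in> N K)"
  proof (rule hall)
    show "finite A" using fin\<K> by (simp add: A_def)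
    show "finite (N K)" for K using finT by (simp add: N_def)
    fix J assume J: "J \<subseteq> A"
    show "card J \<le> card (\<Union>(N ` J))"
    proof (rule ccontr)
      assume less: "\<not> card J \<le> card (\<Union>(N ` J))"
      define w where "w = \<Union>(N ` J)"
      define B where "B = \<Union>J"
      have finJ: "finite J" using J fin\<K> by (auto simp: A_def intro: finite_subset)
      have JK: "J \<subseteq> \<K>" using J by (auto simp: A_def)
      have wT: "w \<subseteq> T - {a}" by (auto simp: w_def N_def)
      have finw: "finite w" using wT finT finite_subset by blast
      have B_nb: "B \<subseteq> nb a V" using J by (auto simp: B_def A_def)
      then have BV: "B \<subseteq> V" "finite B" using fin by (auto simp: nb_def intro: finite_subset)
      have Br: "card B \<le> r" using card_mono[OF finite_nb[OF fin] B_nb] reg a TV by auto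
      have B_nb_w: "nb z (T - {a}) = nb z w" if "z \<in> K" "K \<in> J" for z K
        using that wT by (auto simp: nb_def w_def N_def)
      \<comment> \<open>A vertex of \<open>K\<close> has at most \<open>card K - 1\<close>
        neighbours in \<open>K\<close> and, besides those in \<open>w\<close>, only
        \<open>a\<close>; so \<open>K\<close> sends at least
        \<open>card K * (r - card K) \<ge> r - 1\<close> edges to \<open>w\<close>.\<close>
      have K1: "(\<Sum>z\<in>K. deg z w) \<ge> r - 1" if K: "K \<in> J" for K
      proof -
        have K\<K>: "K \<in> \<K>" using K JK by blast
        have finK: "finite K" "odd (card K)" using crit[OF K\<K>] critical_finite critical_odd by auto
        have "card K \<le> card B" using K BV by (intro card_mono) (auto simp: B_def)
        then have Kr: "card K \<le> r - 1" using Br finK(2) even_r r6 by (cases "card K = r") auto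
        have z: "deg z w \<ge> r - card K" if z: "z \<in> K" for z
        proof -
          have zV: "z \<in> V - T" using z K\<K> UK by blast
          have "nb z V \<subseteq> (K - {z}) \<union> ({a} \<union> nb z w)"
            using nocross[OF K\<K> z] B_nb_w[OF z K] adj_irrefl by (auto simp: nb_def)
          then have "deg z V \<le> card ((K - {z}) \<union> ({a} \<union> nb z w))"
            using finK finw by (intro card_mono) (auto simp: finite_nb)
          also have "\<dots> \<le> card (K - {z}) + (card {a} + deg z w)"
            by (meson add_left_mono card_Un_le order_trans)
          finally have "r \<le> card (K - {z}) + (1 + deg z w)" using reg[of z] zV by simp
          moreover have "card K = Suc (card (K - {z}))" by (rule card.remove[OF finK(1) z])
          ultimately show ?thesis by simp
        qed
        have "(\<Sum>z\<in>K. deg z w) \<ge> card K * (r - card K)"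
          using sum_bounded_below[of K "r - card K" "\<lambda>z. deg z w"] z by simp
        moreover obtain p where p: "card K = Suc p" using finK(2) by (cases "card K") auto
        moreover obtain q where q: "r - card K = Suc q" using Kr r6 by (cases "r - card K") auto
        moreover have "r - 1 = p + q + 1" using p q by simp
        ultimately show ?thesis by simp
      qed
      have Jfin: "\<forall>K\<in>J. finite K" using JK crit critical_finite by blast
      have Jdisj: "\<forall>K\<in>J. \<forall>L\<in>J. K \<noteq> L \<longrightarrow> K \<inter> L = {}"
      proof (intro ballI impI)
        fix K L assume "K \<in> J" "L \<in> J" "K \<noteq> L"
        then show "K \<inter> L = {}" using disj[of K L] JK by blast
      qed
      have sumB: "(\<Sum>z\<in>B. deg z w) = (\<Sum>K\<in>J. \<Sum>z\<in>K. deg z w)"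
        unfolding B_def using sum.Union_disjoint[OF Jfin Jdisj] by simp
      have low: "card J * (r - 1) \<le> (\<Sum>z\<in>B. deg z w)"
        unfolding sumB using sum_bounded_below[of J "r - 1" "\<lambda>K. \<Sum>z\<in>K. deg z w"] K1 by simp
      have swap: "(\<Sum>z\<in>B. deg z w) = (\<Sum>t\<in>w. deg t B)"
        using sum_nb_swap BV finw by simp
      have tr: "deg t B \<le> r" if "t \<in> w" for t using card_nb_le[OF BV(1)] that wT TV by blast
      have up: "(\<Sum>t\<in>w. deg t B) \<le> card w * r"
        using sum_bounded_above[of w "\<lambda>t. deg t B" r] tr by simp
      have "card J * (r - 1) \<le> card w * r" using low swap up by linarith
      moreover have wJ: "card w + 1 \<le> card J" using less by (simp add: w_def)
      ultimately have "(card w + 1) * (r - 1) \<le> card w * r" by (meson le_trans mult_le_mono1)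
      then have wr: "r - 1 \<le> card w" using r6 by (cases r) (auto simp: algebra_simps)
      have "card B = (\<Sum>K\<in>J. card K)"
        unfolding B_def using Jfin Jdisj
          by (intro card_Union_disjoint) (auto simp: pairwise_def disjnt_def)
      moreover have K_pos: "card K \<ge> 1" if "K \<in> J" for K
        using that JK crit[of K] critical_odd[of K] by (cases "card K") auto
      ultimately have JB: "card J \<le> card B" using sum_bounded_below[of J 1 card] by simp
      \<comment> \<open>The edge count is now tight: every part in \<open>J\<close> is a singleton,
        \<open>w\<close> sends all its edges to \<open>B\<close>, and \<open>B\<close> is the whole
        neighbourhood of \<open>a\<close>. Hence \<open>B\<close>, \<open>w\<close> and
        \<open>a\<close> form a component with \<open>2 * r\<close> vertices.\<close>
      have cw: "card w = r - 1" "card J = r" "card B = r" using wJ wr JB Br by auto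
      have sing: "K = {z}" if "K \<in> J" "z \<in> K" for K z
      proof -
        have "card K = 1"
        proof (rule ccontr)
          assume "card K \<noteq> 1"
          then have "card K > 1" using K_pos[OF that(1)] by simp
          then have "(\<Sum>K\<in>J. 1) < (\<Sum>K\<in>J. card K)"
            using K_pos that(1) finJ by (intro sum_strict_mono_ex1) auto
          then show False using \<open>card B = (\<Sum>K\<in>J. card K)\<close> cw by simp
        qed
        then show ?thesis using that(2) by (metis card_1_singletonE singletonD)
      qed
      have t_full: "nb t B = nb t V" if t: "t \<in> w" for t
      proof (rule ccontr)
        assume ne: "nb t B \<noteq> nb t V"
        have tV: "t \<in> V" using t wT TV by blast
        have "nb t B \<subset> nb t V" using ne BV by (auto simp: nb_def)
        then have "deg t B < r" using psubset_card_mono[OF finite_nb[OF fin]] reg[OF tV] by metis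
        then have "(\<Sum>t\<in>w. deg t B) < (\<Sum>t\<in>w. r)"
          using tr t finw by (intro sum_strict_mono_ex1) auto
        then show False using low swap cw by (simp add: algebra_simps)
      qed
      have nbB: "nb a V = B"
        using card_subset_eq[OF finite_nb[OF fin] B_nb] reg[of a] a TV cw by auto
      have "B \<union> w \<union> {a} = V"
      proof (rule conn)
        show "B \<union> w \<union> {a} \<subseteq> V" using BV wT TV a by blast
        fix u v assume u: "u \<in> B \<union> w \<union> {a}" and uv: "u \<sim> v"
        have vV: "v \<in> V" using adj_V2 uv by blast
        consider "u = a" | "u \<in> w" | "u \<in> B" using u by blast
        then show "v \<in> B \<union> w \<union> {a}"
        proof cases
          case 1
          then show ?thesis using nbB uv vV by (auto simp: nb_def)
        next
          case 2
          then show ?thesis using t_full[OF 2] uv vV by (auto simp: nb_def)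
        next
          case 3
          then obtain K where K: "K \<in> J" "u \<in> K" by (auto simp: B_def)
          show ?thesis
          proof (cases "v \<in> T")
            case True
            then show ?thesis using K uv by (auto simp: w_def N_def)
          next
            case False
            then have "v \<in> K" using nocross[of K u v] K JK uv vV by blast
            then show ?thesis using K by (auto simp: B_def)
          qed
        qed
      qed auto
      moreover have "card (B \<union> w \<union> {a}) = r + (r - 1) + 1"
      proof -
        have "B \<inter> T = {}" using JK UK by (auto simp: B_def)
        then have "card (B \<union> w) = r + (r - 1)" using cw wT BV finw by (subst card_Un_disjoint) auto
        moreover have "a \<notin> B \<union> w" using \<open>B \<inter> T = {}\<close> a wT by auto
        ultimately show ?thesis using BV finw by simp
      qed
      ultimately show False using odd_V r6 by simp
    qed
  qed
  then obtain f where f: "inj_on f A" "\<And>K. K \<in> A \<Longrightarrow> f K \<in> N K" by blast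
  have "\<exists>z. z \<in> K \<and> z \<notin> nb a V" if "K \<in> \<K> - A" for K using that by (auto simp: A_def)
  then obtain g where g: "\<And>K. K \<in> \<K> - A \<Longrightarrow> g K \<in> K \<and> g K \<notin> nb a V" by metis
  define P where "P = (\<Union>A \<union> f ` A) \<union> (\<Union>K\<in>\<K> - A. K - {g K})"
  have A\<K>: "A \<subseteq> \<K>" by (auto simp: A_def)
  have fT: "f ` A \<subseteq> T - {a}" using f(2) by (auto simp: N_def)
  have "pm (\<Union>A \<union> f ` A)"
  proof (rule pm_critical_matched)
    show "finite A" using A\<K> fin\<K> finite_subset by blast
    show "\<exists>z\<in>K. z \<sim> f K" if "K \<in> A" for K using f(2)[OF that] by (simp add: N_def)
    show "f ` A \<inter> \<Union>A = {}" using fT UK A\<K> by blast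
    show "critical K" if "K \<in> A" for K using crit A\<K> that by blast
    show "K \<inter> L = {}" if "K \<in> A" "L \<in> A" "K \<noteq> L" for K L using disj[of K L] A\<K> that by blast
  qed (fact f(1))
  moreover have "pm (\<Union>K\<in>\<K> - A. K - {g K})"
  proof (rule pm_critical_missing)
    show "K \<inter> L = {}" if "K \<in> \<K> - A" "L \<in> \<K> - A" "K \<noteq> L" for K L using disj[of K L] that by blast
  qed (use fin\<K> crit g in auto)
  moreover have "(\<Union>A \<union> f ` A) \<inter> (\<Union>K\<in>\<K> - A. K - {g K}) = {}"
  proof -
    have "\<Union>A \<inter> (\<Union>K\<in>\<K> - A. K - {g K}) = {}" using disj A\<K> by fastforce
    moreover have "f ` A \<inter> (\<Union>K\<in>\<K> - A. K - {g K}) = {}" using fT UK by blast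
    ultimately show ?thesis by blast
  qed
  ultimately have P: "pm P" unfolding P_def by (rule pm_Un)
  have PV: "P \<subseteq> V" using fT UK TV A\<K> unfolding P_def by blast
  obtain U where U: "U \<subseteq> V - P" "pm U" "indep (V - (P \<union> U))" using pm_extend[OF fin PV P] by blast
  have "pm (P \<union> U)" using pm_Un[OF P U(2)] U(1) by blast
  then have "T \<subseteq> P \<union> U" using T_cov[of "P \<union> U"] U PV by blast
  moreover have "a \<notin> P" using fT UK a A\<K> unfolding P_def by blast
  ultimately have "a \<in> U" using a by blast
  then obtain s where s: "s \<in> U" "a \<sim> s" using pm_remove[OF U(2)] by blast
  then have sV: "s \<in> V - T" using T_indep[OF a, of s] U(1) by blast
  then obtain K where K: "K \<in> \<K>" "s \<in> K" using UK by blast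
  have "s \<in> P"
  proof (cases "K \<in> A")
    case True
    then show ?thesis using K by (auto simp: P_def)
  next
    case False
    then have "s \<noteq> g K" using g[of K] K s sV by (auto simp: nb_def)
    then show ?thesis using K False by (auto simp: P_def)
  qed
  then show False using s U by blast
qed

text \<open>With \<open>T\<close> empty there are no edges between the parts, so connectedness
  leaves a single part.\<close>

theorem factor_critical:
  assumes "v \<in> V"
  shows "pm (V - {v})"
proof -
  obtain T \<K> W where b: "barrier V T \<K>" "W \<subseteq> V" "pm W"
    "\<And>U. U \<subseteq> V \<Longrightarrow> pm U \<Longrightarrow> card U \<le> card W" "card \<K> = card T + card (V - W)"
    using gallai_edmonds_barrier[OF fin] by blast
  obtain U where U: "U \<subseteq> V - W" "pm U" "indep (V - (W \<union> U))" using pm_extend[OF fin b(2,3)] by blast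
  have "card (W \<union> U) \<le> card W" using pm_Un[OF b(3) U(2)] U(1) b(2) by (intro b(4)) auto
  moreover have "card (W \<union> U) = card W + card U"
    using pm_finite b(3) U by (intro card_Un_disjoint) auto
  ultimately have "U = {}" using pm_finite[OF U(2)] by simp
  then have "T = {}" using barrier_factor_critical[OF b(1,2,3) _ b(5)] U(3) by simp
  then have UK: "\<Union>\<K> = V" "\<And>K. K \<in> \<K> \<Longrightarrow> critical K"
    "\<And>K u v. K \<in> \<K> \<Longrightarrow> u \<in> K \<Longrightarrow> v \<in> V \<Longrightarrow> u \<sim> v \<Longrightarrow> v \<in> K"
    using b(1) by (simp_all add: barrier_def)
  then obtain K where K: "K \<in> \<K>" "v \<in> K" using assms by blast
  have "K = V"
  proof (rule conn)
    show "y \<in> K" if "x \<in> K" "x \<sim> y" for x y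
      using UK(3)[OF K(1) that(1) _ that(2)] adj_V2 that by blast
  qed (use K UK in auto)
  then show ?thesis using UK(2)[OF K(1)] assms by (simp add: critical_def)
qed

lemma maximal_misses_one:
  assumes "U \<subseteq> V" "pm U" "indep (V - U)"
  shows "card (V - U) = 1"
proof -
  obtain v where v: "v \<in> V" using odd_V by fastforce
  have "V - (V - {v}) = {v}" using v by blast
  then have "indep (V - (V - {v}))" using adj_irrefl by (simp add: indep_def)
  from equi[OF assms _ factor_critical[OF v] this] have "card U = card (V - {v})" by blast
  then have "card V = card U + 1" using card.remove[OF fin v] by simp
  then show ?thesis using fin assms(1) by (simp add: card_Diff_subset finite_subset)
qed

lemma extend_misses_one:
  assumes "P \<subseteq> V" "pm P"
  shows "\<exists>U. U \<subseteq> V - P \<and> pm U \<and> indep (V - (P \<union> U)) \<and> card (V - (P \<union> U)) = 1"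
proof -
  obtain U where U: "U \<subseteq> V - P" "pm U" "indep (V - (P \<union> U))" using pm_extend[OF fin assms] by blast
  have "pm (P \<union> U)" using pm_Un[OF assms(2) U(2)] U(1) by blast
  then have "card (V - (P \<union> U)) = 1" using assms(1) U by (intro maximal_misses_one) auto
  then show ?thesis using U by blast
qed

text \<open>Such \<open>a\<close> and \<open>b\<close> stay uncovered in any extension of
  \<open>P\<close>. Several later constructions aim at exactly this contradiction.\<close>

lemma no_two_isolated:
  assumes P: "P \<subseteq> V" "pm P" and ab: "a \<in> V - P" "b \<in> V - P" "a \<noteq> b"
    and "nb a (V - P) = {}" "nb b (V - P) = {}"
  shows False
proof -
  obtain U where U: "U \<subseteq> V - P" "pm U" "card (V - (P \<union> U)) = 1"
    using extend_misses_one[OF P] by blast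
  have "x \<notin> U" if x: "nb x (V - P) = {}" for x
  proof
    assume "x \<in> U"
    then obtain s where "s \<in> U" "x \<sim> s" using pm_remove[OF U(2)] by blast
    then show False using x U(1) by (auto simp: nb_def)
  qed
  then have "{a, b} \<subseteq> V - (P \<union> U)" using ab assms(6,7) by blast
  then have "card {a, b} \<le> card (V - (P \<union> U))" using fin by (intro card_mono) auto
  then show False using U(3) ab(3) by simp
qed

end

section \<open>Barriers above a maximum independent set\<close>

context sgraph
begin

lemma card_nb_Union:
  assumes "finite \<A>" "\<And>K. K \<in> \<A> \<Longrightarrow> finite K"
    and disj: "\<And>K L. K \<in> \<A> \<Longrightarrow> L \<in> \<A> \<Longrightarrow> K \<noteq> L \<Longrightarrow> K \<inter> L = {}"
  shows "deg v (\<Union>\<A>) = (\<Sum>K\<in>\<A>. deg v K)"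
proof -
  have "nb v (\<Union>\<A>) = (\<Union>K\<in>\<A>. nb v K)" by (auto simp: nb_def)
  moreover have "card (\<Union>K\<in>\<A>. nb v K) = (\<Sum>K\<in>\<A>. deg v K)"
  proof (rule card_UN_disjoint)
    show "\<forall>K\<in>\<A>. \<forall>L\<in>\<A>. K \<noteq> L \<longrightarrow> nb v K \<inter> nb v L = {}"
    proof (intro ballI impI)
      fix K L assume "K \<in> \<A>" "L \<in> \<A>" "K \<noteq> L"
      from disj[OF this] show "nb v K \<inter> nb v L = {}" using nb_subset by blast
    qed
  qed (use assms finite_nb in auto)
  ultimately show ?thesis by simp
qed

lemma complete_pm:
  assumes "finite A" "even (card A)" "\<And>a b. a \<in> A \<Longrightarrow> b \<in> A \<Longrightarrow> a \<noteq> b \<Longrightarrow> a \<sim> b"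
  shows "pm A"
  using assms
proof (induction "card A" arbitrary: A rule: less_induct)
  case less
  show ?case
  proof (cases "A = {}")
    case False
    then obtain a where a: "a \<in> A" by blast
    have "A \<noteq> {a}" using less.prems(2) by auto
    then obtain b where b: "b \<in> A" "b \<noteq> a" using a by blast
    have c: "card (A - {a, b}) + 2 = card A"
      using a b less.prems(1) card_mono[of A "{a, b}"] by (simp add: card_Diff_subset)
    have "pm (A - {a, b})"
    proof (rule less.hyps)
      show "card (A - {a, b}) < card A" using c by simp
      show "even (card (A - {a, b}))" using c less.prems(2) by presburger
    qed (use less.prems in auto)
    then have "pm (insert a (insert b (A - {a, b})))"
      using less.prems(3) a b by (intro pm_insert) auto
    moreover have "insert a (insert b (A - {a, b})) = A" using a b by auto
    ultimately show ?thesis by simp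
  qed (simp add: pm_empty)
qed

end

context regular_equimatchable
begin

text \<open>
  Every matching of \<open>V - S\<close> extends to one missing a single vertex, and each vertex of \<open>S\<close> it then
  covers uses up a vertex missed before; a transversal of the parts is independent.
\<close>

lemma max_independent_barrier:
  assumes S: "S \<subseteq> V" "indep S" "S \<noteq> {}"
    and max: "\<And>I. I \<subseteq> V \<Longrightarrow> indep I \<Longrightarrow> card I \<le> card S"
  shows "\<exists>T \<K>. barrier V T \<K> \<and> S \<subseteq> T \<and> card T = card \<K> + 1 \<and> card T \<le> card S + 1"
proof -
  have finS: "finite S" using S(1) fin finite_subset by blast
  obtain T \<K> W where b: "barrier (V - S) T \<K>" "W \<subseteq> V - S" "pm W"
    "\<And>U. U \<subseteq> V - S \<Longrightarrow> pm U \<Longrightarrow> card U \<le> card W" "card \<K> = card T + card (V - S - W)"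
    using gallai_edmonds_barrier[of "V - S"] fin by blast
  have TV: "T \<subseteq> V - S" using barrier_subset[OF b(1)] .
  have finT: "finite T" using TV fin by (meson finite_Diff finite_subset)
  define L where "L = V - S - W"
  have finL: "finite L" using fin by (simp add: L_def)
  have L_indep: "\<not> u \<sim> v" if "u \<in> L" "v \<in> L" for u v
  proof
    assume uv: "u \<sim> v"
    have "pm (insert u (insert v W))" using b(3) uv that by (intro pm_insert) (auto simp: L_def)
    moreover have "insert u (insert v W) \<subseteq> V - S" using that b(2) by (auto simp: L_def)
    ultimately have "card (insert u (insert v W)) \<le> card W" by (intro b(4))
    moreover have "card (insert u (insert v W)) = card W + 2"
      using that pm_finite[OF b(3)] adj_neq[OF uv] by (simp add: L_def)
    ultimately show False by simp
  qed
  have WV: "W \<subseteq> V" using b(2) by blast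
  obtain U where U: "U \<subseteq> V - W" "pm U" "card (V - (W \<union> U)) = 1"
    using extend_misses_one[OF WV b(3)] by blast
  obtain f where f: "\<And>v. v \<in> U \<Longrightarrow> f v \<in> U \<and> v \<sim> f v \<and> f (f v) = v"
    using pm_involution[OF U(2)] by blast
  \<comment> \<open>Partners of vertices of \<open>S\<close> lie outside the independent
    \<open>S\<close> and outside \<open>W\<close>, hence in \<open>L\<close>; so \<open>S\<close>
    exceeds \<open>L\<close> by at most the one missed vertex.\<close>
  have "f ` (S \<inter> U) \<subseteq> L"
  proof
    fix y assume "y \<in> f ` (S \<inter> U)"
    then obtain x where x: "x \<in> S" "x \<in> U" "y = f x" by blast
    then have "y \<in> U" "x \<sim> y" using f by auto
    then show "y \<in> L" using U(1) S(2) x(1) by (auto simp: L_def indep_def)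
  qed
  moreover have "inj_on f (S \<inter> U)" by (rule inj_onI) (metis IntD2 f)
  ultimately have "card (S \<inter> U) \<le> card L" using finL by (meson card_inj_on_le)
  moreover have "card (S - U) \<le> 1"
    using card_mono[of "V - (W \<union> U)" "S - U"] U(3) fin S(1) b(2) by auto
  moreover have "card S = card (S \<inter> U) + card (S - U)"
    using finS by (metis Int_Diff_disjoint Int_Diff_Un card_Un_disjoint finite_Diff finite_Int)
  ultimately have SL: "card S \<le> card L + 1" by simp
  have cT: "card (S \<union> T) = card S + card T" using finS finT TV by (intro card_Un_disjoint) auto
  have "V - (S \<union> T) = V - S - T" by blast
  then have bar: "barrier V (S \<union> T) \<K>" using b(1) S(1) TV by (auto simp: barrier_def)
  obtain t where t: "t \<in> S" using S(3) by blast
  have tV: "t \<in> V" using t S(1) by blast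
  \<comment> \<open>Factor-criticality at a vertex \<open>t\<close> of \<open>S\<close> supplies the
    inequality opposite to \<open>SL\<close>.\<close>
  have "card \<K> \<le> card (\<Union>\<K> - (V - {t})) + card ((S \<union> T) \<inter> (V - {t}))"
    using barrier_count[OF fin bar _ factor_critical[OF tV]] by blast
  moreover have "\<Union>\<K> - (V - {t}) = {}" using barrier_Union[OF bar] t by auto
  moreover have "(S \<union> T) \<inter> (V - {t}) = (S \<union> T) - {t}" using S(1) TV by blast
  moreover have "card (S \<union> T - {t}) + 1 = card (S \<union> T)"
    using t finS finT by (metis Suc_eq_plus1 UnI1 card.remove finite_Un)
  ultimately have "card \<K> + 1 \<le> card (S \<union> T)" by (metis add.left_neutral add_le_mono1 card.empty)
  then have eq: "card (S \<union> T) = card \<K> + 1" using SL b(5) cT by (simp add: L_def)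
  define g where "g K = (SOME z. z \<in> K)" for K :: "'a set"
  have g: "g K \<in> K" if "K \<in> \<K>" for K
    using barrier_critical[OF bar that] some_in_eq[of K] by (simp add: g_def critical_def)
  have "inj_on g \<K>"
  proof (rule inj_onI)
    fix K L assume KL: "K \<in> \<K>" "L \<in> \<K>" "g K = g L"
    then show "K = L" using barrier_disjoint[OF bar KL(1,2)] g[OF KL(1)] g[OF KL(2)] by auto
  qed
  moreover have "indep (g ` \<K>)"
    unfolding indep_def
  proof (intro ballI notI)
    fix u v assume "u \<in> g ` \<K>" "v \<in> g ` \<K>" "u \<sim> v"
    then obtain K L where KL: "K \<in> \<K>" "L \<in> \<K>" "g K \<sim> g L" by blast
    have "g L \<in> V - (S \<union> T)" using g[OF KL(2)] barrier_Union[OF bar] KL(2) by blast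
    then have "g L \<in> K" using barrier_nocross[OF bar KL(1) g[OF KL(1)] _ KL(3)] by blast
    then have "K = L" using barrier_disjoint[OF bar KL(1,2)] g[OF KL(2)] by auto
    then show False using KL(3) adj_irrefl by simp
  qed
  moreover have "g ` \<K> \<subseteq> V" using g barrier_Union[OF bar] by blast
  ultimately have "card \<K> \<le> card S" using max[of "g ` \<K>"] by (simp add: card_image)
  then show ?thesis using bar eq by (intro exI[of _ "S \<union> T"] exI[of _ \<K>]) auto
qed

end

section \<open>Edge counts and exchange arguments for a barrier containing a maximum independent
  set\<close>

locale barrier_setting = regular_equimatchable adj V r
  for adj :: "'a \<Rightarrow> 'a \<Rightarrow> bool" (infix "\<sim>" 50) and V :: "'a set" and r :: nat +
  fixes S T :: "'a set" and \<K> :: "'a set set"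
  assumes bar: "barrier V T \<K>" and S_T: "S \<subseteq> T" and card_T: "card T = card \<K> + 1"
    and S_indep: "indep S"
    and S_max: "I \<subseteq> V \<Longrightarrow> indep I \<Longrightarrow> card I \<le> card S"
    and S3: "card S \<ge> 3"
begin

lemmas T_V = barrier_subset[OF bar] and Union_\<K> = barrier_Union[OF bar]
  and crit = barrier_critical[OF bar] and disj = barrier_disjoint[OF bar]
  and nocross = barrier_nocross[OF bar]

lemma fin_T: "finite T"
  using T_V fin finite_subset by blast

lemma fin_S: "finite S"
  using S_T fin_T finite_subset by blast

lemma fin_\<K>: "finite \<K>"
  using Union_\<K> fin by (metis finite_Diff finite_UnionD)

lemma fin_K: "K \<in> \<K> \<Longrightarrow> finite K"
  using crit critical_finite by blast

lemma odd_K: "K \<in> \<K> \<Longrightarrow> odd (card K)"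
  using crit critical_odd by blast

lemma K_sub: "K \<in> \<K> \<Longrightarrow> K \<subseteq> V - T"
  using Union_\<K> by blast

lemma card_nb_K_T:
  assumes "K \<in> \<K>" "z \<in> K"
  shows "deg z K + deg z T = r"
proof -
  have zV: "z \<in> V" using assms K_sub by blast
  have "nb z V = nb z (K \<union> T)"
    using nocross[OF assms] K_sub[OF assms(1)] T_V by (auto simp: nb_def)
  moreover have "deg z (K \<union> T) = deg z K + deg z T"
    using fin_K[OF assms(1)] fin_T K_sub[OF assms(1)] by (intro card_nb_Un) auto
  ultimately show ?thesis using reg[OF zV] by simp
qed

lemma card_nb_K_lt:
  assumes "K \<in> \<K>" "z \<in> K"
  shows "deg z K < card K"
  using assms fin_K[OF assms(1)] adj_irrefl by (intro psubset_card_mono) (auto simp: nb_def)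

lemma card_nb_T_ge:
  assumes "K \<in> \<K>" "z \<in> K"
  shows "r + 1 \<le> deg z T + card K"
  using card_nb_K_T[OF assms] card_nb_K_lt[OF assms] by simp

text \<open>The number of edges between \<open>K\<close> and \<open>T\<close>.\<close>

definition e :: "'a set \<Rightarrow> nat" where
  "e K = (\<Sum>t\<in>T. deg t K)"

lemma e_alt: "K \<in> \<K> \<Longrightarrow> e K = (\<Sum>z\<in>K. deg z T)"
  unfolding e_def using sum_nb_swap fin_T fin_K by blast

text \<open>Degree sum over \<open>T\<close>. As \<open>T\<close> has one vertex more than there are
  parts, the right-hand side is \<open>r\<close> per part plus a surplus of \<open>r\<close>, and
  this surplus limits everything below.\<close>

lemma e_total: "(\<Sum>K\<in>\<K>. e K) + (\<Sum>t\<in>T. deg t T) = r * card T"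
proof -
  have "deg t T + (\<Sum>K\<in>\<K>. deg t K) = r" if "t \<in> T" for t
  proof -
    have "card (nb t (T \<union> (V - T))) = deg t T + deg t (V - T)"
      using fin_T fin by (intro card_nb_Un) auto
    moreover have "T \<union> (V - T) = V" using T_V by blast
    moreover have "deg t (\<Union>\<K>) = (\<Sum>K\<in>\<K>. deg t K)"
      by (rule card_nb_Union[OF fin_\<K> fin_K disj])
    ultimately show ?thesis using reg that T_V Union_\<K> by auto
  qed
  then have "(\<Sum>t\<in>T. deg t T + (\<Sum>K\<in>\<K>. deg t K)) = (\<Sum>t\<in>T. r)"
    by (intro sum.cong) auto
  moreover have "(\<Sum>K\<in>\<K>. e K) = (\<Sum>t\<in>T. \<Sum>K\<in>\<K>. deg t K)"
    unfolding e_def by (rule sum.swap)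
  ultimately show ?thesis by (simp add: sum.distrib mult.commute)
qed

text \<open>A vertex of \<open>K\<close> has at most \<open>card K - 1\<close> neighbours inside
  \<open>K\<close>. Subtraction truncates, so the bound is void for parts with more than
  \<open>r\<close> vertices.\<close>

lemma e_ge:
  assumes "K \<in> \<K>"
  shows "card K * (r + 1 - card K) \<le> e K"
  unfolding e_alt[OF assms]
  using sum_bounded_below[of K "r + 1 - card K" "\<lambda>z. deg z T"] card_nb_T_ge[OF assms] by fastforce

lemma e_single: "K \<in> \<K> \<Longrightarrow> card K = 1 \<Longrightarrow> e K = r"
  using card_nb_K_T card_nb_K_lt by (fastforce simp: e_alt card_1_singleton_iff)

lemma e_ge_r:
  assumes "K \<in> \<K>" "card K \<le> r"
  shows "r \<le> e K"
proof -
  obtain p where p: "card K = Suc p" using odd_K[OF assms(1)] by (cases "card K") auto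
  obtain q where q: "r + 1 - card K = Suc q" using assms(2) by (cases "r + 1 - card K") auto
  have "r = p + q + 1" using p q by simp
  then have "r \<le> card K * (r + 1 - card K)" unfolding p q by simp
  then show ?thesis using e_ge[OF assms(1)] by simp
qed

text \<open>Parity excludes order \<open>r\<close>. The product in \<open>e_ge\<close> is concave in
  the order of the part, and between \<open>3\<close> and \<open>r - 1\<close> it is least at
  \<open>r - 1\<close>, with value \<open>2 * r - 2\<close>.\<close>

lemma e_ge_nonsingle:
  assumes "K \<in> \<K>" "card K \<le> r" "card K \<noteq> 1"
  shows "3 \<le> card K" "card K \<le> r - 1" "2 * r - 2 \<le> e K" "e K = 2 * r - 2 \<Longrightarrow> card K = r - 1"
proof -
  show 3: "3 \<le> card K" using odd_K[OF assms(1)] assms(3) by presburger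
  show K: "card K \<le> r - 1" using odd_K[OF assms(1)] even_r assms(2) by (cases "card K = r") auto
  obtain p where p: "card K = p + 3" using 3 by (metis le_Suc_ex add.commute)
  obtain q where q: "r = card K + q + 1" using K r6
    by (metis add.commute add.left_commute le_Suc_ex le_add_diff_inverse2 one_le_numeral order_trans)
  have eq: "card K * (r + 1 - card K) = 2 * r - 2 + (p + 1) * q"
    unfolding q p by (simp add: algebra_simps)
  show "2 * r - 2 \<le> e K" using e_ge[OF assms(1)] eq by simp
  show "card K = r - 1" if "e K = 2 * r - 2"
  proof -
    have "(p + 1) * q = 0" using e_ge[OF assms(1)] eq that by simp
    then show ?thesis using q by simp
  qed
qed

text \<open>\<open>V - {t}\<close> has a perfect matching, and every odd part must exit into
  \<open>T - {t}\<close>, which has exactly as many vertices as there are parts.\<close>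

lemma T_matching:
  assumes "t \<in> T"
  shows "\<exists>\<mu>. bij_betw \<mu> \<K> (T - {t}) \<and> (\<forall>K\<in>\<K>. \<exists>z\<in>K. z \<sim> \<mu> K)"
proof -
  have tV: "t \<in> V" using assms T_V by blast
  have "\<exists>\<mu>. inj_on \<mu> \<K> \<and> (\<forall>K\<in>\<K>. \<mu> K \<in> T \<inter> (V - {t}) \<and> (\<exists>z\<in>K. z \<sim> \<mu> K))"
  proof (rule pm_odd_exits[OF factor_critical[OF tV]])
    show "K \<subseteq> V - {t} \<and> odd (card K)" if "K \<in> \<K>" for K
      using K_sub[OF that] odd_K[OF that] assms by blast
    show "v \<in> K \<union> T" if "K \<in> \<K>" "z \<in> K" "v \<in> V - {t}" "z \<sim> v" for K z v
      using nocross[OF that(1,2) _ that(4)] that(3) by blast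
  qed (fact disj)
  then obtain \<mu> where mu: "inj_on \<mu> \<K>" "\<And>K. K \<in> \<K> \<Longrightarrow> \<mu> K \<in> T - {t} \<and> (\<exists>z\<in>K. z \<sim> \<mu> K)" by blast
  have "\<mu> ` \<K> = T - {t}"
  proof (rule card_subset_eq)
    show "card (\<mu> ` \<K>) = card (T - {t})" using card_image[OF mu(1)] card_T assms fin_T by simp
  qed (use fin_T mu in auto)
  then show ?thesis using mu by (auto simp: bij_betw_def)
qed

text \<open>Pairs of \<open>T\<close> that become free when \<open>K\<close> need not be served:
  together with one vertex of \<open>K\<close> they can be all that a matching leaves
  uncovered.\<close>

definition good :: "'a set \<Rightarrow> 'a \<Rightarrow> 'a \<Rightarrow> bool" where
  "good K t t' \<longleftrightarrow> t \<in> T \<and> t' \<in> T \<and> t \<noteq> t' \<and>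
    (\<exists>\<mu>. bij_betw \<mu> (\<K> - {K}) (T - {t, t'}) \<and> (\<forall>L\<in>\<K> - {K}. \<exists>z\<in>L. z \<sim> \<mu> L))"

text \<open>In a matching from \<open>T_matching\<close>, the vertex serving \<open>K\<close> is
  released.\<close>

lemma good_ex:
  assumes "K \<in> \<K>" "t \<in> T"
  shows "\<exists>t'. good K t t' \<and> nb t' K \<noteq> {}"
proof -
  obtain \<mu> where mu: "bij_betw \<mu> \<K> (T - {t})" "\<And>L. L \<in> \<K> \<Longrightarrow> \<exists>z\<in>L. z \<sim> \<mu> L"
    using T_matching[OF assms(2)] by blast
  have "bij_betw \<mu> (\<K> - {K}) (T - {t} - {\<mu> K})"
    using mu(1) assms(1) by (intro bij_betw_DiffI) (auto simp: bij_betw_def)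
  moreover have "T - {t} - {\<mu> K} = T - {t, \<mu> K}" by blast
  moreover have "\<mu> K \<in> T - {t}" using mu(1) assms(1) by (auto simp: bij_betw_def)
  ultimately have "good K t (\<mu> K)" using mu(2) assms(2) unfolding good_def by auto
  moreover have "nb (\<mu> K) K \<noteq> {}" using mu(2)[OF assms(1)] adj_sym by (auto simp: nb_def)
  ultimately show ?thesis by blast
qed

lemma pm_matched:
  assumes "\<A> \<subseteq> \<K>" "inj_on \<mu> \<A>" "\<mu> ` \<A> \<subseteq> T" "\<And>K. K \<in> \<A> \<Longrightarrow> \<exists>z\<in>K. z \<sim> \<mu> K"
  shows "pm (\<Union>\<A> \<union> \<mu> ` \<A>)"
proof (rule pm_critical_matched)
  show "finite \<A>" using assms(1) fin_\<K> finite_subset by blast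
  show "K \<inter> L = {}" if "K \<in> \<A>" "L \<in> \<A>" "K \<noteq> L" for K L using disj[of K L] assms(1) that by blast
  show "\<mu> ` \<A> \<inter> \<Union>\<A> = {}" using assms(1,3) Union_\<K> by blast
qed (use assms crit in auto)

text \<open>
  Otherwise some matching would miss exactly the independent set \<open>{t, t', z}\<close>.
\<close>

lemma good_cover:
  assumes K: "K \<in> \<K>" and g: "good K t t'" and "\<not> t \<sim> t'" "z \<in> K"
  shows "t \<sim> z \<or> t' \<sim> z"
proof (rule ccontr)
  assume n: "\<not> ?thesis"
  have tt: "t \<in> T" "t' \<in> T" "t \<noteq> t'" using g by (auto simp: good_def)
  obtain \<mu> where mu: "bij_betw \<mu> (\<K> - {K}) (T - {t, t'})" "\<forall>L\<in>\<K> - {K}. \<exists>z\<in>L. z \<sim> \<mu> L"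
    using g unfolding good_def by blast
  have im: "\<mu> ` (\<K> - {K}) = T - {t, t'}" using mu(1) by (simp add: bij_betw_def)
  have "pm (\<Union>(\<K> - {K}) \<union> \<mu> ` (\<K> - {K}))"
    by (rule pm_matched) (use mu im in \<open>auto simp: bij_betw_def\<close>)
  then have p1: "pm (\<Union>(\<K> - {K}) \<union> (T - {t, t'}))" using im by simp
  have p2: "pm (K - {z})" using crit[OF K] assms(4) by (simp add: critical_def)
  have dj: "K \<inter> \<Union>(\<K> - {K}) = {}" using disj[OF K] by blast
  have KT: "K \<inter> T = {}" using K_sub[OF K] by blast
  define B where "B = \<Union>(\<K> - {K})"
  have B: "V = T \<union> (B \<union> K)" "K \<inter> B = {}" "B \<inter> T = {}"
    using Union_\<K> T_V K dj by (auto simp: B_def)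
  let ?P = "B \<union> (T - {t, t'}) \<union> (K - {z})"
  have P: "pm ?P" by (rule pm_Un[OF p1[folded B_def] p2]) (use B KT in blast)
  have VP: "V - ?P = {t, t', z}" using B KT tt assms(4) by auto
  have PV: "?P \<subseteq> V" using B by blast
  have "indep (V - ?P)" unfolding VP using n assms(3) adj_sym adj_irrefl by (auto simp: indep_def)
  then have "card (V - ?P) = 1" using maximal_misses_one[OF PV P] by blast
  moreover have "card {t, t'} \<le> card (V - ?P)" unfolding VP by (intro card_mono) auto
  ultimately show False using tt by simp
qed

text \<open>
  \<open>T\<close> has only one vertex more than there are parts, so at most one vertex of \<open>T\<close> can be wasted on
  another one or on a part that is already served.
\<close>

lemma no_double_waste:
  assumes K: "K \<in> \<K>" and st: "s \<sim> s'" "s \<in> T" "s' \<in> T" "t1 \<in> T - {s, s'}" "t2 \<in> T - {s, s'}"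
    "t1 \<noteq> t2"
    and z: "z1 \<in> K" "z2 \<in> K" "z1 \<noteq> z2" "t1 \<sim> z1" "t2 \<sim> z2"
  shows False
proof -
  have KT: "K \<inter> T = {}" using K_sub[OF K] by blast
  let ?P = "{s, s'} \<union> ({t1, z1} \<union> {t2, z2})"
  have P: "pm ?P"
    by (intro pm_Un pm_pair) (use assms KT adj_neq[OF st(1)] in auto)
  have PV: "?P \<subseteq> V" using assms T_V K_sub by blast
  obtain U where U: "U \<subseteq> V - ?P" "pm U" "card (V - (?P \<union> U)) = 1"
    using extend_misses_one[OF PV P] by blast
  \<comment> \<open>\<open>K\<close> without \<open>z1\<close> and \<open>z2\<close> is still odd,
    so there are still \<open>card \<K>\<close> odd parts, while four vertices of \<open>T\<close>
    are gone: at least three vertices would be missed.\<close>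
  define K' where "K' = K - {z1, z2}"
  define \<C> where "\<C> = insert K' (\<K> - {K})"
  have cK': "card K' + 2 = card K"
    using z fin_K[OF K] card_mono[of K "{z1, z2}"] by (simp add: K'_def card_Diff_subset)
  then have oddK': "odd (card K')" using odd_K[OF K] by presburger
  have dK': "K' \<inter> L = {}" if "L \<in> \<K> - {K}" for L using disj[OF K, of L] that by (auto simp: K'_def)
  have "K' \<noteq> {}" using oddK' by auto
  then have "K' \<notin> \<K> - {K}" using dK' by blast
  then have "card \<C> = Suc (card (\<K> - {K}))"
    unfolding \<C>_def using fin_\<K> by (intro card_insert_disjoint) auto
  then have c\<C>: "card \<C> = card \<K>" using card.remove[OF fin_\<K> K] by metis
  have "card \<C> \<le> card (\<Union>\<C> - U) + card (T \<inter> U)"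
  proof (rule pm_count[OF U(2)])
    show "finite \<C>" using fin_\<K> by (simp add: \<C>_def)
    show "finite L \<and> odd (card L)" if "L \<in> \<C>" for L
      using that fin_K odd_K oddK' fin_K[OF K] by (auto simp: \<C>_def K'_def)
    show "L \<inter> M = {}" if "L \<in> \<C>" "M \<in> \<C>" "L \<noteq> M" for L M
      using that dK' disj[of L M] by (auto simp: \<C>_def)
    show "v \<in> L \<union> T" if L: "L \<in> \<C>" "x \<in> L" "v \<in> U" "x \<sim> v" for L x v
    proof (cases "L = K'")
      case True
      then have "x \<in> K" using L by (simp add: K'_def)
      then have "v \<in> K \<or> v \<in> T" using nocross[OF K _ _ L(4)] L(3) U(1) by blast
      then show ?thesis using True L(3) U(1) by (auto simp: K'_def)
    next
      case False
      then have "L \<in> \<K>" using L(1) by (auto simp: \<C>_def)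
      then show ?thesis using nocross[OF _ L(2) _ L(4)] L(3) U(1) by blast
    qed
  qed
  moreover have "card (\<Union>\<C> - U) \<le> card (V - (?P \<union> U))"
  proof (rule card_mono)
    have "\<Union>\<C> \<subseteq> V - T" using Union_\<K> K by (auto simp: \<C>_def K'_def)
    moreover have "z1 \<notin> \<Union>\<C>" "z2 \<notin> \<Union>\<C>" using z disj[OF K] by (auto simp: \<C>_def K'_def)
    ultimately show "\<Union>\<C> - U \<subseteq> V - (?P \<union> U)" using st by blast
  qed (use fin in auto)
  moreover have "card (T \<inter> U) \<le> card (T - {s, s', t1, t2})"
    using U(1) fin_T by (intro card_mono) auto
  moreover have "card {s, s', t1, t2} = 4" using st adj_neq[OF st(1)] by auto
  then have "card (T - {s, s', t1, t2}) + 4 = card T"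
    using st fin_T card_mono[of T "{s, s', t1, t2}"] by (simp add: card_Diff_subset)
  ultimately show False using U(3) c\<C> card_T by simp
qed

lemma outside_S_adj:
  assumes "v \<in> V - S"
  shows "nb v S \<noteq> {}"
proof
  assume "nb v S = {}"
  then have "indep (insert v S)" using S_indep adj_sym adj_irrefl by (auto simp: indep_def nb_def)
  moreover have "insert v S \<subseteq> V" using assms S_T T_V by blast
  ultimately have "card (insert v S) \<le> card S" by (rule S_max[rotated])
  then show False using assms fin_S by simp
qed

end

section \<open>A barrier with one vertex outside the independent set\<close>

context barrier_setting
begin

lemma e_sum_ge:
  assumes "\<A> \<subseteq> \<K>" "\<And>K. K \<in> \<K> - \<A> \<Longrightarrow> r \<le> e K"
  shows "(\<Sum>K\<in>\<A>. e K) + r * card (\<K> - \<A>) \<le> (\<Sum>K\<in>\<K>. e K)"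
proof -
  have "r * card (\<K> - \<A>) \<le> (\<Sum>K\<in>\<K> - \<A>. e K)"
    using sum_bounded_below[of "\<K> - \<A>" r e] assms(2) by (simp add: mult.commute)
  moreover have "(\<Sum>K\<in>\<K>. e K) = (\<Sum>K\<in>\<K> - \<A>. e K) + (\<Sum>K\<in>\<A>. e K)"
    by (rule sum.subset_diff[OF assms(1) fin_\<K>])
  ultimately show ?thesis by simp
qed

text \<open>
  The path \<open>u - x - t - y\<close> must close up: with \<open>z\<close> isolated, exchanging \<open>ux\<close>, \<open>ty\<close> for \<open>tx\<close>
  would leave \<open>z\<close>, \<open>u\<close> and \<open>y\<close> unmatched.
\<close>

lemma swap_nb:
  assumes K: "K \<in> \<K>" "z \<in> K" and ab: "a \<in> T" "b \<in> T" and Q: "pm ((K - {z}) \<union> {a, b})"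
    and z_nb: "nb z T \<subseteq> {a, b}" and u: "u \<in> T - {a, b}" and t: "t \<in> T - {a, b, u}"
    and x: "x \<in> V - T - K" "u \<sim> x" "t \<sim> x" and t_nb: "nb t V \<subseteq> V - T - K"
  shows "nb t V \<subseteq> nb u (V - T - K)"
proof
  fix y assume y: "y \<in> nb t V"
  then have ty: "t \<sim> y" "y \<in> V - T - K" using t_nb by (auto simp: nb_def)
  have "u \<sim> y"
  proof (rule ccontr)
    assume uy: "\<not> u \<sim> y"
    then have xy: "x \<noteq> y" using x by blast
    have KV: "K \<subseteq> V - T" using K_sub[OF K(1)] .
    define B where "B = (K - {z}) \<union> {a, b}"
    have BV: "B \<subseteq> V" using KV ab T_V by (auto simp: B_def)
    have nB: "u \<notin> B" "x \<notin> B" "t \<notin> B" "y \<notin> B" "z \<notin> B"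
      using u t x ty KV ab K(2) by (auto simp: B_def)
    have dist: "u \<noteq> t" "u \<noteq> x" "u \<noteq> y" "t \<noteq> x" "t \<noteq> y" "z \<noteq> u" "z \<noteq> t" "z \<noteq> x" "z \<noteq> y"
      using u t x ty KV K(2) by auto
    have inV: "u \<in> V" "t \<in> V" "x \<in> V" "y \<in> V" "z \<in> V" using u t x ty KV K(2) T_V by auto
    let ?P = "B \<union> ({u, x} \<union> {t, y})"
    have P: "pm ?P"
      by (intro pm_Un pm_pair Q[folded B_def]) (use x ty xy nB dist in auto)
    have PV: "?P \<subseteq> V" using BV inV by auto
    obtain U where U: "U \<subseteq> V - ?P" "pm U" "card (V - (?P \<union> U)) = 1"
      using extend_misses_one[OF PV P] by blast
    have zU: "z \<notin> U"
    proof
      assume "z \<in> U"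
      then obtain s where s: "s \<in> U" "z \<sim> s" using pm_remove[OF U(2)] by blast
      then have "s \<in> V" using adj_V2 by blast
      then have "s \<in> K \<or> s \<in> T" using nocross[OF K _ s(2)] by blast
      then have "s \<in> B" using s(2) z_nb adj_irrefl by (auto simp: B_def nb_def)
      then show False using s(1) U(1) by blast
    qed
    then have "z \<in> V - (?P \<union> U)" using inV nB dist by auto
    then have rest: "V - (?P \<union> U) = {z}" using U(3) by (metis card_1_singletonE singletonD)
    let ?R = "B \<union> ({t, x} \<union> U)"
    have R: "pm ?R"
      by (intro pm_Un pm_pair Q[folded B_def] U(2)) (use x(3) U(1) nB in auto)
    have RV: "?R \<subseteq> V" using BV inV U(1) by auto
    have VR: "V - ?R = {z, u, y}" using rest nB dist inV U(1) xy zU by auto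
    have "\<not> z \<sim> u" using z_nb u by (auto simp: nb_def)
    moreover have "\<not> z \<sim> y" using nocross[OF K, of y] ty by blast
    ultimately have "indep (V - ?R)"
      unfolding VR using uy adj_sym adj_irrefl by (auto simp: indep_def)
    from maximal_misses_one[OF RV R this] have "card {z, u, y} = 1" unfolding VR .
    then show False using dist by simp
  qed
  then show "y \<in> nb u (V - T - K)" using ty by (simp add: nb_def)
qed

end

locale star_setting = barrier_setting adj V r S T \<K>
  for adj :: "'a \<Rightarrow> 'a \<Rightarrow> bool" (infix "\<sim>" 50) and V :: "'a set" and r :: nat
    and S T :: "'a set" and \<K> :: "'a set set" +
  fixes c :: 'a
  assumes T_eq: "T = insert c S" and c_S: "c \<notin> S"
begin

lemma c_V: "c \<in> V"
  using T_eq T_V by blast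

lemma S_V: "S \<subseteq> V"
  using S_T T_V by blast

lemma card_\<K>: "card \<K> = card S"
  using card_T c_S fin_S by (simp add: T_eq)

lemma nb_c_S: "nb c S \<noteq> {}"
  using outside_S_adj c_V c_S by blast

lemma nb_c_T: "nb c T = nb c S"
  using adj_irrefl by (auto simp: T_eq nb_def)

lemma nb_S_T: "s \<in> S \<Longrightarrow> nb s T = nb s {c}"
  using S_indep by (auto simp: T_eq nb_def indep_def)

text \<open>Edges inside \<open>T\<close> all meet \<open>c\<close>, and the degree sum counts each
  of them twice.\<close>

lemma sum_nb_T: "(\<Sum>t\<in>T. deg t T) = 2 * deg c S"
proof -
  have "(\<Sum>t\<in>T. deg t T) = deg c T + (\<Sum>s\<in>S. deg s T)"
    using T_eq c_S fin_S by simp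
  also have "(\<Sum>s\<in>S. deg s T) = (\<Sum>s\<in>S. deg s {c})" using nb_S_T by simp
  also have "\<dots> = (\<Sum>b\<in>{c}. deg b S)" using fin_S by (intro sum_nb_swap) auto
  finally show ?thesis by (simp add: nb_c_T)
qed

lemma e_total_star: "(\<Sum>K\<in>\<K>. e K) + 2 * deg c S = r * card \<K> + r"
  using e_total sum_nb_T card_T by simp

text \<open>The edge \<open>cs\<close> already wastes a vertex of \<open>T\<close>. Hence any two
  edges between \<open>S - {s}\<close> and \<open>K\<close> share an end, so these edges form a
  star.\<close>

lemma waste_star:
  assumes "K \<in> \<K>" "s \<in> nb c S" "t1 \<in> S - {s}" "t2 \<in> S - {s}" "z1 \<in> K" "z2 \<in> K" "t1 \<sim> z1" "t2 \<sim> z2"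
  shows "t1 = t2 \<or> z1 = z2"
proof (rule ccontr)
  assume "\<not> ?thesis"
  then show False
    using no_double_waste[of K c s t1 t2 z1 z2] assms c_S by (auto simp: nb_def T_eq)
qed

lemma K_nb_S:
  assumes "K \<in> \<K>" "z \<in> K"
  obtains t where "t \<in> S" "t \<sim> z"
proof -
  have "z \<in> V - S" using assms K_sub S_T by blast
  then have "nb z S \<noteq> {}" by (rule outside_S_adj)
  then show ?thesis using that adj_sym by (auto simp: nb_def)
qed

text \<open>No vertex is adjacent to all of a part with more than \<open>r\<close> vertices. But by
  \<open>waste_star\<close> the edges from \<open>S - {s}\<close> to such a part all meet one vertex
  \<open>t\<close>, so a third vertex \<open>q\<close> of \<open>S\<close> sees nothing of it, and a
  good pair containing \<open>q\<close> leads to a vertex adjacent to the whole part.\<close>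

lemma K_small:
  assumes K: "K \<in> \<K>"
  shows "card K \<le> r"
proof (rule ccontr)
  assume large: "\<not> card K \<le> r"
  have not_sub: False if "t \<in> V" "\<And>z. z \<in> K \<Longrightarrow> t \<sim> z" for t
  proof -
    have "K \<subseteq> nb t V" using that K_sub[OF K] by (auto simp: nb_def)
    then have "card K \<le> deg t V" using fin by (intro card_mono finite_nb)
    then show False using large reg[OF that(1)] by simp
  qed
  obtain s where s: "s \<in> nb c S" using nb_c_S by blast
  then have sS: "s \<in> S" "c \<sim> s" by (auto simp: nb_def)
  have sV: "s \<in> V" using sS S_V by blast
  have cK: "c \<notin> K" using K_sub[OF K] T_eq by blast
  \<comment> \<open>The edge to \<open>c\<close> costs \<open>s\<close> one neighbour, so at least
    two vertices of \<open>K\<close> are not adjacent to \<open>s\<close>. Their neighbours in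
    \<open>S\<close> must coincide, and this common neighbour \<open>t\<close> is the centre of the
    star.\<close>
  have "nb s K \<subset> nb s V" using cK sS(2) c_V adj_sym K_sub[OF K] by (auto simp: nb_def)
  then have "deg s K < r" using psubset_card_mono[OF finite_nb[OF fin]] reg[OF sV] by metis
  moreover have "card (K - nb s K) = card K - deg s K"
    using fin_K[OF K] finite_nb by (intro card_Diff_subset) (auto simp: nb_def)
  ultimately have "2 \<le> card (K - nb s K)" using large by simp
  then obtain z z' where z: "z \<in> K" "z' \<in> K" "z \<noteq> z'" "\<not> s \<sim> z" "\<not> s \<sim> z'"
    using two_elements by (fastforce simp: nb_def)
  obtain t where t: "t \<in> S" "t \<sim> z" using K_nb_S[OF K z(1)] by blast
  obtain t' where t': "t' \<in> S" "t' \<sim> z'" using K_nb_S[OF K z(2)] by blast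
  have ts: "t \<noteq> s" "t' \<noteq> s" using t t' z by auto
  have "t = t'" using waste_star[OF K s, of t t' z z'] t t' z ts by blast
  then have tz': "t \<sim> z'" using t' by simp
  have only: "x = t" if "x \<in> S - {s}" "y \<in> K" "x \<sim> y" for x y
    using waste_star[OF K s that(1), of t y z] waste_star[OF K s that(1), of t y z'] that t tz' ts z
      by blast
  have "S - {s, t} \<noteq> {}"
  proof
    assume "S - {s, t} = {}"
    then have "card S \<le> card {s, t}" by (intro card_mono) auto
    then show False using S3 by (simp add: card_insert_if split: if_splits)
  qed
  then obtain q where q: "q \<in> S" "q \<noteq> s" "q \<noteq> t" by blast
  have q_no: "\<not> q \<sim> y" if "y \<in> K" for y using only[of q y] q that by blast
  obtain p where p: "good K q p" "nb p K \<noteq> {}" using good_ex[OF K, of q] q S_T by blast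
  have pT: "p \<in> T" using p(1) by (simp add: good_def)
  show False
  proof (cases "q \<sim> p")
    case False
    have "p \<sim> y" if "y \<in> K" for y using good_cover[OF K p(1) False that] q_no[OF that] by blast
    then show False using not_sub[of p] pT T_V by blast
  next
    case True
    then have "p = c" using pT q S_indep by (auto simp: T_eq indep_def)
    \<comment> \<open>Now \<open>q\<close> can take the role of \<open>s\<close> as the wasted
      neighbour of \<open>c\<close>, and the edges at \<open>s\<close> fall under the same
      restriction.\<close>
    then have qc: "q \<in> nb c S" using True q adj_sym by (auto simp: nb_def)
    show False
    proof (cases "nb s K = {}")
      case True
      have "t \<sim> y" if y: "y \<in> K" for y
      proof -
        obtain x where x: "x \<in> S" "x \<sim> y" using K_nb_S[OF K y] by blast
        then have "x \<noteq> s" using True y by (auto simp: nb_def)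
        then show ?thesis using only[of x y] x y by blast
      qed
      then show False using not_sub[of t] t S_V by blast
    next
      case False
      then obtain y where y: "y \<in> K" "s \<sim> y" by (auto simp: nb_def)
      then show False
        using waste_star[OF K qc, of s t y z] waste_star[OF K qc, of s t y z'] z sS t tz' q ts
          by blast
    qed
  qed
qed

text \<open>A larger part exhausts the surplus exactly: it is a clique on \<open>r - 1\<close>
  vertices, each with two neighbours in \<open>T\<close>, and \<open>c\<close> has a single
  neighbour \<open>s\<close> in \<open>S\<close>. Either this clique closes up to a component with
  \<open>c\<close> and \<open>s\<close>, or \<open>swap_nb\<close> gives some vertex too many
  neighbours.\<close>

lemma all_single:
  assumes K: "K \<in> \<K>"
  shows "card K = 1"
proof (rule ccontr)
  assume ns: "card K \<noteq> 1"
  note eK = e_ge_nonsingle[OF K K_small[OF K] ns]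
  have ge: "r \<le> e L" if "L \<in> \<K>" for L using e_ge_r[OF that K_small[OF that]] .
  have e0: "deg c S > 0" using nb_c_S finite_nb[OF fin_S] by (simp add: card_gt_0_iff)
  have "e K + r * card (\<K> - {K}) \<le> (\<Sum>K\<in>\<K>. e K)" using e_sum_ge[of "{K}"] K ge by simp
  moreover have "card \<K> = Suc (card (\<K> - {K}))" by (rule card.remove[OF fin_\<K> K])
  ultimately have "e K + 2 * deg c S \<le> 2 * r" using e_total_star by simp
  \<comment> \<open>Both lower bounds, \<open>2 * r - 2\<close> for \<open>e K\<close> and
    \<open>1\<close> for the degree of \<open>c\<close>, must be attained.\<close>
  then have e1: "deg c S = 1" and eK2: "e K = 2 * r - 2" using eK(3) e0 by auto
  then have cK: "card K = r - 1" using eK(4) by blast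
  have single: "card L = 1" if L: "L \<in> \<K>" "L \<noteq> K" for L
  proof (rule ccontr)
    assume "card L \<noteq> 1"
    then have "2 * r - 2 \<le> e L" using e_ge_nonsingle(3)[OF L(1) K_small[OF L(1)]] by blast
    moreover have "e K + e L + r * card (\<K> - {K, L}) \<le> (\<Sum>K\<in>\<K>. e K)"
      using e_sum_ge[of "{K, L}"] K L ge by simp
    moreover have "card \<K> = card (\<K> - {K, L}) + 2"
      using K L fin_\<K> card_mono[of \<K> "{K, L}"] by (simp add: card_Diff_subset)
    ultimately show False using e_total_star eK2 e1 r6 by (simp add: algebra_simps)
  qed
  have T2: "deg z T = 2" if z: "z \<in> K" for z
  proof (rule ccontr)
    have ge2: "2 \<le> deg y T" if "y \<in> K" for y using card_nb_T_ge[OF K that] cK r6 by simp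
    assume "deg z T \<noteq> 2"
    then have "2 < deg z T" using ge2[OF z] by simp
    then have "(\<Sum>y\<in>K. 2) < (\<Sum>y\<in>K. deg y T)"
      using ge2 z fin_K[OF K] by (intro sum_strict_mono_ex1) auto
    then show False using e_alt[OF K] eK2 cK r6 by simp
  qed
  have complete: "y \<sim> z" if "y \<in> K" "z \<in> K" "y \<noteq> z" for y z
  proof -
    have "deg y K = card (K - {y})"
      using card_nb_K_T[OF K that(1)] T2[OF that(1)] cK fin_K[OF K] that(1) r6 by simp
    then have "nb y K = K - {y}"
      using fin_K[OF K] adj_irrefl by (intro card_subset_eq) (auto simp: nb_def)
    then show ?thesis using that by (auto simp: nb_def)
  qed
  obtain s where s: "nb c S = {s}" using e1 by (rule card_1_singletonE)
  have sS: "s \<in> S" "c \<sim> s" "s \<in> nb c S" using s by (auto simp: nb_def)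
  have cs: "c \<noteq> s" using sS c_S by blast
  have cT: "c \<in> T" "s \<in> T" using T_eq sS by auto
  define N where "N = {t \<in> S - {s}. nb t K \<noteq> {}}"
  have N_sub: "N \<subseteq> S - {s}" by (auto simp: N_def)
  have N_pair: "z = z'" if "t \<in> N" "t' \<in> N" "t \<noteq> t'" "t \<sim> z" "t' \<sim> z'" "z \<in> K" "z' \<in> K"
    for t t' z z'
    using waste_star[OF K sS(3), of t t' z z'] that by (auto simp: N_def)
  have finN: "finite N" using fin_S by (simp add: N_def)
  \<comment> \<open>Three vertices in \<open>N\<close> would make the star centre a vertex of
    \<open>K\<close>, but that vertex has only two neighbours in \<open>T\<close>.\<close>
  have cardN: "card N \<le> 2"
  proof (rule ccontr)
    assume n: "\<not> card N \<le> 2"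
    then obtain t t' where tt: "t \<in> N" "t' \<in> N" "t \<noteq> t'" using two_elements[of N] by auto
    obtain z where z: "z \<in> K" "t \<sim> z" using tt(1) by (auto simp: N_def nb_def)
    have N': "t'' \<sim> z" if N'': "t'' \<in> N" for t''
    proof (cases "t'' = t")
      case False
      obtain y where y: "y \<in> K" "t'' \<sim> y" using N'' by (auto simp: N_def nb_def)
      then show ?thesis using N_pair[OF N'' tt(1) False y(2) z(2) y(1) z(1)] by simp
    qed (use z in simp)
    have "N \<subseteq> nb z T" using N' N_sub S_T adj_sym by (auto simp: nb_def)
    then have "card N \<le> deg z T" using fin_T by (intro card_mono finite_nb)
    then show False using T2[OF z(1)] n by simp
  qed
  define X where "X = V - T - K"
  have nb_split: "deg t T + deg t K + deg t X = r" if "t \<in> V" for t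
  proof -
    have "deg t (T \<union> K \<union> X) = deg t (T \<union> K) + deg t X"
      using fin_T fin_K[OF K] fin by (intro card_nb_Un) (auto simp: X_def)
    moreover have "deg t (T \<union> K) = deg t T + deg t K"
      using fin_T fin_K[OF K] K_sub[OF K] by (intro card_nb_Un) auto
    moreover have "T \<union> K \<union> X = V" using T_V K_sub[OF K] by (auto simp: X_def)
    ultimately show ?thesis using reg[OF that] by simp
  qed
  have nb_X: "nb x V = nb x T" if x: "x \<in> X" for x
  proof -
    obtain L where L: "L \<in> \<K>" "x \<in> L" using x Union_\<K> by (auto simp: X_def)
    have "L \<noteq> K" using L x by (auto simp: X_def)
    then have "L = {x}" using single[OF L(1)] L(2) by (metis card_1_singletonE singletonD)
    then have "v \<in> T" if "v \<in> V" "x \<sim> v" for v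
      using nocross[OF L _ that(2)] that adj_irrefl by blast
    then show ?thesis using T_V by (auto simp: nb_def)
  qed
  \<comment> \<open>As \<open>r \<ge> 6\<close> exceeds
    \<open>card ({c, s} \<union> N) \<le> 4\<close>, a neighbour \<open>x\<close> of
    \<open>u\<close> in \<open>X\<close> also has a neighbour \<open>t\<close> in \<open>T\<close>
    all of whose edges go to \<open>X\<close>. By \<open>swap_nb\<close> the \<open>r\<close>
    neighbours of \<open>t\<close> are neighbours of \<open>u\<close>, too many within
    \<open>X\<close>.\<close>
  have main: False
    if ab: "a \<in> {c, s} \<union> N" "b \<in> {c, s} \<union> N" and z: "z \<in> K" "nb z T \<subseteq> {a, b}"
      and Q: "pm ((K - {z}) \<union> {a, b})" and u: "u \<in> {c, s} \<union> N" "u \<notin> {a, b}" "nb u X \<noteq> {}"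
        "deg u X < r"
    for a b z u
  proof -
    obtain x where x: "x \<in> X" "u \<sim> x" using u(3) by (auto simp: nb_def)
    have xV: "x \<in> V" using x by (simp add: X_def)
    have "card ({c, s} \<union> N) \<le> 4" using card_Un_le[of "{c, s}" N] cardN cs by simp
    then have "card ({c, s} \<union> N) < deg x T" using nb_X[OF x(1)] reg[OF xV] r6 by simp
    then have "\<not> nb x T \<subseteq> {c, s} \<union> N" using finN card_mono[of "{c, s} \<union> N" "nb x T"] by auto
    then obtain t where t: "t \<in> T" "t \<sim> x" "t \<notin> {c, s} \<union> N" using adj_sym by (auto simp: nb_def)
    have tS: "t \<in> S - {s}" using t T_eq by auto
    have "nb t T = {}" using nb_S_T[of t] tS s adj_sym by (auto simp: nb_def)
    moreover have "nb t K = {}" using t tS by (auto simp: N_def)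
    ultimately have tX: "nb t V \<subseteq> X" by (auto simp: nb_def X_def)
    have NT: "{c, s} \<union> N \<subseteq> T" using N_sub S_T cT by auto
    have "nb t V \<subseteq> nb u X"
      unfolding X_def
    proof (rule swap_nb[OF K z(1) _ _ Q z(2)])
      show "t \<in> T - {a, b, u}" using t ab u by blast
    qed (use ab u NT x t tX X_def in blast)+
    moreover have "finite (nb u X)" using fin by (simp add: finite_nb X_def)
    ultimately have "deg t V \<le> deg u X" by (intro card_mono)
    then show False using reg[of t] t T_V u(4) by auto
  qed
  show False
  \<comment> \<open>In the first case \<open>c\<close> and \<open>s\<close> are matched to each
    other; in the second \<open>K - {z}\<close> has to absorb two vertices of
    \<open>T\<close>.\<close>
  proof (cases "\<exists>z\<in>K. nb z T \<subseteq> {c, s}")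
    case True
    then obtain z where z: "z \<in> K" "nb z T \<subseteq> {c, s}" by blast
    have "N \<noteq> {}"
    proof
      assume "N = {}"
      have all: "nb y T = {c, s}" if "y \<in> K" for y
      proof (rule card_subset_eq)
        show "nb y T \<subseteq> {c, s}"
          using \<open>N = {}\<close> that adj_sym by (auto simp: N_def nb_def T_eq)
      qed (use T2[OF that] cs in auto)
      have full: "nb t X = {}" if t: "t \<in> {c, s}" for t
      proof -
        have "t \<sim> y" if y: "y \<in> K" for y
        proof -
          have "t \<in> nb y T" using all[OF y] t by simp
          then show ?thesis using adj_sym by (simp add: nb_def)
        qed
        then have "nb t K = K" by (auto simp: nb_def)
        moreover have "nb t T \<noteq> {}" using t sS cT adj_sym by (auto simp: nb_def)
        then have "deg t T > 0" using finite_nb[OF fin_T] by (simp add: card_gt_0_iff)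
        moreover have "t \<in> V" using t cT T_V by blast
        ultimately have "deg t X = 0" using nb_split[of t] cK by simp
        then show ?thesis using finite_nb fin by (simp add: X_def)
      qed
      \<comment> \<open>With \<open>N\<close> empty the clique, \<open>c\<close> and
        \<open>s\<close> form a component, which leaves no room for a second part.\<close>
      have "K \<union> {c, s} = V"
      proof (rule conn)
        show "K \<union> {c, s} \<subseteq> V" using K_sub[OF K] cT T_V by blast
        fix x v assume x: "x \<in> K \<union> {c, s}" and xv: "x \<sim> v"
        have vV: "v \<in> V" using adj_V2[OF xv] .
        show "v \<in> K \<union> {c, s}"
        proof (cases "x \<in> K")
          case True
          then show ?thesis using nocross[OF K True _ xv] all[OF True] vV xv by (auto simp: nb_def)
        next
          case False
          then have xx: "x \<in> {c, s}" using x by blast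
          have "v \<notin> X" using full[OF xx] xv by (auto simp: nb_def)
          moreover have "v \<in> {c, s}" if "v \<in> T"
            using xx that xv s sS nb_c_T nb_S_T[OF sS(1)] by (auto simp: nb_def)
          ultimately show ?thesis using vV by (auto simp: X_def)
        qed
      qed auto
      then have cover: "V - T \<subseteq> K" using cT by blast
      have "L = K" if L: "L \<in> \<K>" for L
      proof (rule ccontr)
        assume "L \<noteq> K"
        then have "L \<inter> K = {}" using disj[OF L K] by blast
        moreover have "L \<noteq> {}" using crit[OF L] by (simp add: critical_def)
        ultimately show False using K_sub[OF L] cover by blast
      qed
      then have "\<K> \<subseteq> {K}" by blast
      then have "card \<K> \<le> card {K}" by (intro card_mono) auto
      then show False using card_\<K> S3 by simp
    qed
    then obtain u where u: "u \<in> N" by blast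
    have uS: "u \<in> S - {s}" "u \<in> V" using u N_sub S_V by auto
    have uT: "nb u T = {}" using nb_S_T[of u] uS s adj_sym by (auto simp: nb_def)
    have "nb u K \<noteq> {}" using u by (simp add: N_def)
    then have "deg u K > 0" using finite_nb[OF fin_K[OF K]] by (simp add: card_gt_0_iff)
    moreover have "deg u K \<le> r - 1" using cK card_mono[OF fin_K[OF K] nb_subset] by metis
    ultimately have uX: "deg u X < r" "deg u X > 0" using nb_split[OF uS(2)] uT r6 by simp_all
    have "pm (K - {z})" using crit[OF K] z(1) by (simp add: critical_def)
    then have "pm ((K - {z}) \<union> {c, s})"
      using pm_Un[of "K - {z}" "{c, s}"] pm_pair[OF sS(2)] K_sub[OF K] cT by blast
    moreover have "u \<noteq> c" "nb u X \<noteq> {}" using uS uX(2) c_S by auto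
    ultimately show False using main[of c s z u] z u uX uS by auto
  next
    case False
    have nbN: "\<exists>t\<in>N. t \<sim> z" if z: "z \<in> K" for z
    proof -
      obtain t where "t \<in> nb z T" "t \<notin> {c, s}" using False z by blast
      then show ?thesis using z adj_sym by (intro bexI[of _ t]) (auto simp: N_def nb_def T_eq)
    qed
    have "2 \<le> card K" using cK r6 by simp
    then obtain y y' where y: "y \<in> K" "y' \<in> K" "y \<noteq> y'" using two_elements by blast
    obtain t where t: "t \<in> N" "t \<sim> y" using nbN y by blast
    \<comment> \<open>Two different vertices of \<open>K\<close> have neighbours in
      \<open>N\<close>, so the centre of the star lies in \<open>N\<close> and not in
      \<open>K\<close>.\<close>
    have t_only: "t' = t" if t': "t' \<in> N" for t'
    proof (rule ccontr)
      assume ne: "t' \<noteq> t"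
      obtain x where x: "x \<in> K" "t' \<sim> x" using t' by (auto simp: N_def nb_def)
      then have xy: "x = y" using N_pair[OF t' t(1) ne x(2) t(2)] y by simp
      obtain q where q: "q \<in> N" "q \<sim> y'" using nbN y by blast
      show False
        using N_pair[OF q(1) t(1) _ q(2) t(2)] N_pair[OF q(1) t' _ q(2) x(2)] xy x y ne by blast
    qed
    have t_all: "t \<sim> z" if "z \<in> K" for z using nbN[OF that] t_only by blast
    have N_eq: "N = {t}" using t t_only by blast
    have tcs: "t \<noteq> c" "t \<noteq> s" using t N_sub c_S by auto
    have Kcs: "nb c K \<union> nb s K = K"
    proof
      show "K \<subseteq> nb c K \<union> nb s K"
      proof
        fix z assume z: "z \<in> K"
        show "z \<in> nb c K \<union> nb s K"
        proof (rule ccontr)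
          assume n: "z \<notin> nb c K \<union> nb s K"
          have "nb z T \<subseteq> {t}"
          proof
            fix v assume v: "v \<in> nb z T"
            then have "v \<sim> z" using adj_sym by (auto simp: nb_def)
            then have "v \<noteq> c" "v \<noteq> s" using n z by (auto simp: nb_def)
            then have "v \<in> N" using v z \<open>v \<sim> z\<close> by (auto simp: N_def nb_def T_eq)
            then show "v \<in> {t}" using N_eq by simp
          qed
          then have "deg z T \<le> 1" using card_mono[of "{t}"] by fastforce
          then show False using T2[OF z] by simp
        qed
      qed
    qed (auto simp: nb_def)
    have "card K \<le> deg c K + deg s K" using card_Un_le[of "nb c K" "nb s K"] Kcs by simp
    \<comment> \<open>Pigeonhole: \<open>K\<close> has at least five vertices, each adjacent to
      \<open>c\<close> or \<open>s\<close>.\<close>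
    then have "\<exists>a a'. {a, a'} = {c, s} \<and> 3 \<le> deg a K"
    proof (cases "3 \<le> deg c K")
      case False
      assume "card K \<le> deg c K + deg s K"
      then have "3 \<le> deg s K" using cK r6 False by simp
      then show ?thesis by (intro exI[of _ s] exI[of _ c]) auto
    qed blast
    then obtain a a' where a: "{a, a'} = {c, s}" "3 \<le> deg a K" by blast
    have aa: "a \<noteq> a'" "a \<sim> a'" "a \<in> T" "a' \<in> T" "t \<noteq> a" "t \<noteq> a'"
      using a(1) cs sS adj_sym tcs cT by (auto simp: doubleton_eq_iff)
    have nb_a': "nb a' T = {a}"
      using a(1) nb_c_T s nb_S_T[OF sS(1)] sS(2) adj_sym by (auto simp: doubleton_eq_iff nb_def)
    have "2 \<le> deg a K" using a(2) by simp
    then obtain z z2 where z: "z \<in> nb a K" "z2 \<in> nb a K" "z \<noteq> z2" using two_elements by blast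
    have zK: "z \<in> K" "z2 \<in> K" "a \<sim> z" "a \<sim> z2" using z by (auto simp: nb_def)
    have zT: "nb y T = {t, a}" if y: "y \<in> K" "a \<sim> y" for y
    proof -
      have "{t, a} = nb y T"
      proof (rule card_subset_eq[OF finite_nb[OF fin_T]])
        show "{t, a} \<subseteq> nb y T"
          using y t_all[OF y(1)] adj_sym aa N_sub t(1) S_T by (auto simp: nb_def)
        show "card {t, a} = deg y T" using T2[OF y(1)] aa by simp
      qed
      then show ?thesis by simp
    qed
    have cKz: "card (K - {z, z2}) = card K - 2"
      using zK z(3) fin_K[OF K] by (simp add: card_Diff_subset)
    then have "card (K - {z, z2}) \<noteq> 0" using cK r6 by simp
    then have "K - {z, z2} \<noteq> {}" by (metis card.empty)
    then obtain z1 where z1: "z1 \<in> K" "z1 \<noteq> z" "z1 \<noteq> z2" by blast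
    \<comment> \<open>\<open>t\<close> takes \<open>z1\<close> and \<open>a\<close> takes
      \<open>z2\<close>; the rest of the clique without \<open>z\<close> has even order and is
      matched within itself.\<close>
    let ?K = "K - {z, z1, z2}"
    have "card {z, z1, z2} = 3" using z1 z(3) by auto
    then have "card ?K + 3 = card K"
      using zK z1 fin_K[OF K] card_mono[of K "{z, z1, z2}"] by (simp add: card_Diff_subset)
    then have "even (card ?K)" using odd_K[OF K] by presburger
    then have "pm ?K" using fin_K[OF K] complete by (intro complete_pm) auto
    moreover have TK: "T \<inter> K = {}" using K_sub[OF K] by blast
    ultimately have "pm (?K \<union> ({t, z1} \<union> {a, z2}))"
      by (intro pm_Un pm_pair)
        (use zK z1 z(3) t_all[OF z1(1)] aa t(1) N_sub S_T in auto)
    moreover have "?K \<union> ({t, z1} \<union> {a, z2}) = (K - {z}) \<union> {t, a}" using zK z1 z(3) by auto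
    ultimately have Q: "pm ((K - {z}) \<union> {t, a})" by simp
    have a'V: "a' \<in> V" using aa T_V by blast
    have "nb a' K \<subseteq> K - {z, z2}"
    proof -
      have "\<not> a' \<sim> y" if "y \<in> K" "a \<sim> y" for y
      proof
        assume "a' \<sim> y"
        then have "a' \<in> nb y T" using adj_sym aa by (simp add: nb_def)
        then show False using zT[OF that] aa by auto
      qed
      then show ?thesis using zK by (auto simp: nb_def)
    qed
    then have "deg a' K \<le> card K - 2"
      using card_mono[of "K - {z, z2}"] fin_K[OF K] cKz by (metis finite_Diff)
    then have "deg a' X < r" "deg a' X > 0"
      using nb_split[OF a'V] nb_a' cK r6 by simp_all
    moreover have "a \<in> {c, s}" "a' \<in> {c, s}" using a(1) by auto
    moreover from calculation(2) have "nb a' X \<noteq> {}" by auto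
    ultimately show False using main[of t a z a'] Q zT[OF zK(1,3)] zK(1) N_eq aa by auto
  qed
qed

end

section \<open>An independent barrier\<close>

text \<open>What counting leaves of an independent barrier: the singletons use \<open>r\<close>
  edges each, so the whole surplus \<open>r\<close> of \<open>e_total\<close> falls to
  \<open>C\<close>, which gives \<open>2 * r\<close>.\<close>

locale one_nonsingle = barrier_setting adj V r S T \<K>
  for adj :: "'a \<Rightarrow> 'a \<Rightarrow> bool" (infix "\<sim>" 50) and V :: "'a set" and r :: nat
    and S T :: "'a set" and \<K> :: "'a set set" +
  fixes C :: "'a set"
  assumes T_indep: "indep T" and C_K: "C \<in> \<K>" and C_nonsingle: "card C \<noteq> 1"
    and singles: "\<And>K. K \<in> \<K> \<Longrightarrow> K \<noteq> C \<Longrightarrow> card K = 1" and e_C: "e C = 2 * r"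
    and r_le_T: "r \<le> card T"
begin

definition X :: "'a set" where "X = V - T - C"

lemma fin_X: "finite X"
  using fin by (simp add: X_def)

lemma V_eq: "V = T \<union> C \<union> X"
  using T_V K_sub[OF C_K] by (auto simp: X_def)

lemma dj: "T \<inter> C = {}" "T \<inter> X = {}" "C \<inter> X = {}"
  using K_sub[OF C_K] by (auto simp: X_def)

lemma singleton_X: "x \<in> X \<Longrightarrow> {x} \<in> \<K>"
proof -
  assume x: "x \<in> X"
  then obtain K where K: "K \<in> \<K>" "x \<in> K" using Union_\<K> by (auto simp: X_def)
  then have "K \<noteq> C" using x by (auto simp: X_def)
  then show ?thesis using singles[OF K(1)] K by (metis card_1_singletonE singletonD)
qed

lemma card_X: "card X + 2 = card T"
proof -
  have "bij_betw (\<lambda>x. {x}) X (\<K> - {C})"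
    unfolding bij_betw_def
  proof
    show "(\<lambda>x. {x}) ` X = \<K> - {C}"
    proof (intro subset_antisym subsetI)
      fix K assume "K \<in> (\<lambda>x. {x}) ` X"
      then show "K \<in> \<K> - {C}" using singleton_X C_nonsingle by auto
    next
      fix K assume K: "K \<in> \<K> - {C}"
      then have "card K = 1" using singles by blast
      then obtain x where x: "K = {x}" by (rule card_1_singletonE)
      then have "x \<in> X" using K K_sub disj[of K C] C_K by (auto simp: X_def)
      then show "K \<in> (\<lambda>x. {x}) ` X" using x by blast
    qed
  qed simp
  then have "card X = card (\<K> - {C})" by (rule bij_betw_same_card)
  then show ?thesis using card_T card.remove[OF fin_\<K> C_K] by simp
qed

lemma nb_X: "x \<in> X \<Longrightarrow> nb x V = nb x T"
  using nocross[OF singleton_X, of x x] adj_irrefl T_V by (auto simp: nb_def)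

lemma card_nb_X: "x \<in> X \<Longrightarrow> deg x T = r"
  using nb_X reg by (metis DiffE X_def)

lemma X_T: "x \<in> X \<Longrightarrow> x \<sim> v \<Longrightarrow> v \<in> T"
  using nb_X[of x] adj_V2[of x v] by (auto simp: nb_def)

lemma T_CX: "t \<in> T \<Longrightarrow> t \<sim> v \<Longrightarrow> v \<in> C \<union> X"
  using T_indep adj_V2[of t v] by (auto simp: indep_def X_def)

lemma card_nb_T: "t \<in> T \<Longrightarrow> deg t C + deg t X = r"
proof -
  assume t: "t \<in> T"
  have "nb t V = nb t (C \<union> X)" using T_CX[OF t] V_eq by (auto simp: nb_def)
  moreover have "deg t (C \<union> X) = deg t C + deg t X"
    using fin_X fin_K[OF C_K] dj by (intro card_nb_Un) auto
  ultimately show ?thesis using reg[of t] t T_V by auto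
qed

lemma C3: "3 \<le> card C"
  using odd_K[OF C_K] C_nonsingle by presburger

lemma nb_C_C: "z \<in> C \<Longrightarrow> nb z C \<noteq> {}"
  using critical_nb[OF crit[OF C_K] _ C_nonsingle] by blast

lemma card_nb_C_T: "z \<in> C \<Longrightarrow> deg z T \<le> r - 1"
proof -
  assume z: "z \<in> C"
  have "deg z C > 0" using nb_C_C[OF z] finite_nb[OF fin_K[OF C_K]] by (simp add: card_gt_0_iff)
  then show ?thesis using card_nb_K_T[OF C_K z] by simp
qed

lemma e_C_le:
  assumes "Y \<subseteq> T"
  shows "(\<Sum>t\<in>Y. deg t C) + (\<Sum>t\<in>T - Y. deg t C) = 2 * r"
  using sum.subset_diff[OF assms fin_T, of "\<lambda>t. deg t C"] e_C by (simp add: e_def)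

text \<open>\<open>C\<close> has at least three vertices, and
  \<open>3 * (r - 1) > 2 * r\<close>.\<close>

lemma not_all_high: "\<not> (\<forall>z\<in>C. r - 1 \<le> deg z T)"
proof
  assume "\<forall>z\<in>C. r - 1 \<le> deg z T"
  then have "card C * (r - 1) \<le> e C"
    using sum_bounded_below[of C "r - 1" "\<lambda>z. deg z T"] e_alt[OF C_K] by simp
  moreover have "3 * (r - 1) \<le> card C * (r - 1)" using C3 by (rule mult_le_mono1)
  ultimately have "3 * (r - 1) \<le> 2 * r" using e_C by linarith
  then show False using r6 by simp
qed

text \<open>The matching of \<open>T_matching\<close> with \<open>C\<close> dropped;
  \<open>q\<close> is the vertex that served \<open>C\<close>.\<close>

lemma vertex_matching:
  assumes "y \<in> T"
  obtains m q where "inj_on m X" "\<And>x. x \<in> X \<Longrightarrow> x \<sim> m x" "q \<in> T - {y}" "m ` X = T - {y, q}"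
proof -
  obtain \<mu> where mu: "bij_betw \<mu> \<K> (T - {y})" "\<And>K. K \<in> \<K> \<Longrightarrow> \<exists>z\<in>K. z \<sim> \<mu> K"
    using T_matching[OF assms] by blast
  have inj: "inj_on \<mu> \<K>" and im: "\<mu> ` \<K> = T - {y}" using mu(1) by (auto simp: bij_betw_def)
  define m where "m x = \<mu> {x}" for x
  have CX: "C \<noteq> {x}" for x using C_nonsingle by auto
  have "inj_on m X"
  proof (rule inj_onI)
    fix x x' assume x: "x \<in> X" "x' \<in> X" "m x = m x'"
    then have "\<mu> {x} = \<mu> {x'}" by (simp add: m_def)
    then have "{x} = {x'}" using singleton_X[OF x(1)] singleton_X[OF x(2)] by (rule inj_onD[OF inj])
    then show "x = x'" by simp
  qed
  moreover have "x \<sim> m x" if "x \<in> X" for x using mu(2)[OF singleton_X[OF that]] by (simp add: m_def)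
  moreover have q: "\<mu> C \<in> T - {y}" using im C_K by blast
  moreover have "m ` X = T - {y, \<mu> C}"
  proof (rule card_subset_eq)
    have "m x \<noteq> \<mu> C" if "x \<in> X" for x
      using inj_onD[OF inj, of "{x}" C] singleton_X[OF that] C_K CX by (auto simp: m_def)
    moreover have "m x \<in> T - {y}" if "x \<in> X" for x
      using im singleton_X[OF that] by (auto simp: m_def)
    ultimately show "m ` X \<subseteq> T - {y, \<mu> C}" by (auto simp: image_subset_iff)
    have "card (m ` X) = card X" using \<open>inj_on m X\<close> by (rule card_image)
    moreover have "card (T - {y, \<mu> C}) + 2 = card T"
      using assms q fin_T by (intro card_Diff_pair) auto
    ultimately show "card (m ` X) = card (T - {y, \<mu> C})" using card_X by simp
  qed (use fin_T in auto)
  ultimately show ?thesis by (intro that[of m "\<mu> C"])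
qed

text \<open>If \<open>T\<close> had only \<open>r\<close> vertices, every vertex of \<open>X\<close>
  would be adjacent to all of \<open>T\<close>, so any two vertices of \<open>T\<close> could be
  left uncovered. Then a vertex of \<open>C\<close> has at most one non-neighbour in
  \<open>T\<close>, against \<open>not_all_high\<close>.\<close>

lemma card_T_gt: "r < card T"
proof (rule ccontr)
  assume "\<not> r < card T"
  then have kr: "card T = r" using r_le_T by simp
  have full: "x \<sim> t" if "x \<in> X" "t \<in> T" for x t
  proof -
    have "nb x T = T" using card_nb_X[OF that(1)] kr fin_T
      by (intro card_subset_eq) (auto simp: nb_def)
    then show ?thesis using that by (auto simp: nb_def)
  qed
  have "r - 1 \<le> deg z T" if z: "z \<in> C" for z
  proof (rule ccontr)
    assume n: "\<not> ?thesis"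
    have "card (T - nb z T) = r - deg z T"
      using kr fin_T by (subst card_Diff_subset) (auto simp: nb_def)
    then have "2 \<le> card (T - nb z T)" using n by simp
    then obtain t t' where t: "t \<in> T" "t' \<in> T" "t \<noteq> t'" "\<not> z \<sim> t" "\<not> z \<sim> t'"
      using two_elements by (fastforce simp: nb_def)
    have "card (T - {t, t'}) + 2 = card T"
      using t fin_T by (intro card_Diff_pair)
    then have "card X = card (T - {t, t'})" using card_X by simp
    then obtain m where m: "bij_betw m X (T - {t, t'})"
      using finite_same_card_bij[OF fin_X] fin_T by blast
    have im: "inj_on m X" "m ` X = T - {t, t'}" using m by (auto simp: bij_betw_def)
    have "x \<sim> m x" if "x \<in> X" for x using full[OF that] im(2) that by blast
    moreover have "m ` X \<inter> X = {}" unfolding im(2) using dj by blast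
    ultimately have "pm (X \<union> m ` X)" using im(1) fin_X by (intro pm_inj_matching)
    then have p: "pm (X \<union> (T - {t, t'}))" using m by (simp add: bij_betw_def)
    have pz: "pm (C - {z})" using crit[OF C_K] z by (simp add: critical_def)
    let ?P = "X \<union> (T - {t, t'}) \<union> (C - {z})"
    have P: "pm ?P" by (rule pm_Un[OF p pz]) (use dj in auto)
    have PV: "?P \<subseteq> V" using V_eq by blast
    have VP: "V - ?P = {t, t', z}" using V_eq t z dj by auto
    have "\<not> t \<sim> t'" "\<not> t' \<sim> t" using T_indep t by (auto simp: indep_def)
    then have "indep (V - ?P)" unfolding VP using t adj_sym adj_irrefl by (auto simp: indep_def)
    then have "card {t, t', z} = 1" using maximal_misses_one[OF PV P] VP by simp
    moreover have "card {t, t'} \<le> card {t, t', z}" by (intro card_mono) auto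
    ultimately show False using t(3) by simp
  qed
  then show False using not_all_high by blast
qed

text \<open>If the neighbours of \<open>z\<close> in \<open>T\<close> could be matched into
  \<open>X\<close>, then \<open>z\<close> would be isolated beside a perfect matching of
  \<open>C - {z}\<close>. The rest of \<open>T\<close> could be matched only into the rest of
  \<open>X\<close>, which is two vertices short.\<close>

lemma hall_violator:
  assumes z: "z \<in> C"
  shows "\<exists>Y\<subseteq>nb z T. card (\<Union>t\<in>Y. nb t X) < card Y"
proof (rule ccontr)
  assume n: "\<not> ?thesis"
  let ?N = "nb z T"
  have finN: "finite ?N" using fin_T by (rule finite_nb)
  have "\<exists>f. inj_on f ?N \<and> (\<forall>t\<in>?N. f t \<in> nb t X)"
  proof (rule hall)
    show "card J \<le> card (\<Union>((\<lambda>t. nb t X) ` J))" if "J \<subseteq> ?N" for J using n that by (meson not_less)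
  qed (use finN fin_X finite_nb in auto)
  then obtain f where f: "inj_on f ?N" "\<And>t. t \<in> ?N \<Longrightarrow> f t \<in> X \<and> t \<sim> f t" by (auto simp: nb_def)
  have fX: "f ` ?N \<subseteq> X" using f by blast
  have NT: "?N \<subseteq> T" by (rule nb_subset)
  have p1: "pm (?N \<union> f ` ?N)"
    using f finN fX NT dj by (intro pm_inj_matching) auto
  have p2: "pm (C - {z})" using crit[OF C_K] z by (simp add: critical_def)
  let ?P = "?N \<union> f ` ?N \<union> (C - {z})"
  have P: "pm ?P" by (rule pm_Un[OF p1 p2]) (use dj fX NT in blast)
  have PV: "?P \<subseteq> V" using V_eq fX NT by blast
  obtain U where U: "U \<subseteq> V - ?P" "pm U" "card (V - (?P \<union> U)) = 1"
    using extend_misses_one[OF PV P] by blast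
  have zU: "z \<notin> U"
  proof
    assume "z \<in> U"
    then obtain s where s: "s \<in> U" "z \<sim> s" using pm_remove[OF U(2)] by blast
    then have "s \<in> X" using U(1) V_eq adj_irrefl by (auto simp: nb_def)
    then show False using X_T adj_sym s(2) z dj by blast
  qed
  define D where "D = (\<lambda>t. {t}) ` (T - ?N)"
  have "card D \<le> card (\<Union>D - U) + card (X \<inter> U)"
  proof (rule pm_count[OF U(2)])
    show "v \<in> K \<union> X" if K: "K \<in> D" "x \<in> K" "v \<in> U" "x \<sim> v" for K x v
    proof -
      have "x \<in> T" using K by (auto simp: D_def)
      then have "v \<in> C \<union> X" using T_CX K(4) by blast
      moreover have "v \<notin> C" using K(3) U(1) zU by blast
      ultimately show ?thesis by blast
    qed
  qed (use fin_T in \<open>auto simp: D_def\<close>)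
  moreover have "card D = card (T - ?N)" unfolding D_def by (simp add: card_image)
  moreover have "\<Union>D = T - ?N" by (auto simp: D_def)
  moreover have "card (X \<inter> U) \<le> card (X - f ` ?N)" using U(1) fin_X by (intro card_mono) auto
  moreover have "card (X - f ` ?N) = card X - card ?N"
    using fX finN card_image[OF f(1)] by (simp add: card_Diff_subset)
  moreover have "card (T - ?N) = card T - card ?N" using NT finN by (rule card_Diff_subset[rotated])
  moreover have "card ?N \<le> card X" using card_mono[OF fin_X fX] card_image[OF f(1)] by simp
  ultimately have "2 \<le> card (T - ?N - U)" using card_X by simp
  also have "\<dots> \<le> card (V - (?P \<union> U))"
  proof (rule card_mono)
    show "T - ?N - U \<subseteq> V - (?P \<union> U)" using V_eq dj fX by blast
  qed (use fin in auto)
  finally show False using U(3) by simp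
qed

text \<open>Deleting one vertex from a smallest violator restores Hall's condition, so the
  deficiency is exactly one.\<close>

lemma minimal_violator:
  assumes z: "z \<in> C"
  obtains Y where "Y \<subseteq> nb z T" "Y \<noteq> {}" "card (\<Union>t\<in>Y. nb t X) + 1 = card Y"
    "\<And>J. J \<subset> Y \<Longrightarrow> card J \<le> card (\<Union>t\<in>J. nb t X)"
proof -
  obtain Y0 where "Y0 \<subseteq> nb z T \<and> card (\<Union>t\<in>Y0. nb t X) < card Y0" using hall_violator[OF z] by blast
  then obtain Y where Y: "Y \<subseteq> nb z T \<and> card (\<Union>t\<in>Y. nb t X) < card Y"
    and least: "\<And>J. J \<subseteq> nb z T \<and> card (\<Union>t\<in>J. nb t X) < card J \<Longrightarrow> card Y \<le> card J"
    using exists_least_iff[of "\<lambda>n. \<exists>Y. (Y \<subseteq> nb z T \<and> card (\<Union>t\<in>Y. nb t X) < card Y) \<and> card Y = n"]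
    by (metis (no_types, lifting) leI)
  have finY: "finite Y" using Y fin_T finite_nb finite_subset by meson
  have ne: "Y \<noteq> {}" using Y by auto
  have min: "card J \<le> card (\<Union>t\<in>J. nb t X)" if "J \<subset> Y" for J
  proof (rule ccontr)
    assume "\<not> ?thesis"
    then have "card Y \<le> card J" using least[of J] that Y by auto
    then show False using psubset_card_mono[OF finY that] by simp
  qed
  obtain t where t: "t \<in> Y" using ne by blast
  have "card (Y - {t}) \<le> card (\<Union>t\<in>Y - {t}. nb t X)" using t by (intro min) blast
  also have "\<dots> \<le> card (\<Union>t\<in>Y. nb t X)"
  proof (rule card_mono)
    show "finite (\<Union>t\<in>Y. nb t X)" using finY finite_nb[OF fin_X] by blast
  qed auto
  finally have "card (Y - {t}) \<le> card (\<Union>t\<in>Y. nb t X)" .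
  then have "card (\<Union>t\<in>Y. nb t X) + 1 = card Y" using Y card.remove[OF finY t] by simp
  then show ?thesis using that Y ne min by blast
qed

text \<open>
  The contradiction is a matching that leaves \<open>y \<in> T - Y\<close> and a neighbour \<open>x\<close> of \<open>Y\<close> isolated: two
  vertices of \<open>Y\<close> are wasted on \<open>C\<close>, the others cover the remaining neighbours of \<open>Y\<close> in \<open>X\<close>.
\<close>

lemma mid_violator:
  assumes YT: "Y \<subseteq> T" and cA: "card (\<Union>t\<in>Y. nb t X) + 1 = card Y"
    and min: "\<And>J. J \<subset> Y \<Longrightarrow> card J \<le> card (\<Union>t\<in>J. nb t X)"
    and Y2: "2 \<le> card Y" "card Y \<le> r - 2"
  shows False
proof -
  define A where "A = (\<Union>t\<in>Y. nb t X)"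
  have finY: "finite Y" using YT fin_T finite_subset by blast
  have AX: "A \<subseteq> X" by (auto simp: A_def nb_def)
  have finA: "finite A" using AX fin_X finite_subset by blast
  have cA: "card A + 1 = card Y" using cA by (simp add: A_def)
  have nbA: "nb t X \<subseteq> A" if "t \<in> Y" for t using that by (auto simp: A_def)
  \<comment> \<open>A vertex of \<open>Y\<close> has at most \<open>card A = card Y - 1\<close>
    neighbours in \<open>X\<close>; all its others lie in \<open>C\<close>.\<close>
  have d_ge: "r + 1 - card Y \<le> deg t C" if "t \<in> Y" for t
    using card_nb_T[of t] card_mono[OF finA nbA[OF that]] cA that YT by auto
  have sumY: "card Y * (r + 1 - card Y) \<le> (\<Sum>t\<in>Y. deg t C)"
    using sum_bounded_below[of Y "r + 1 - card Y" "\<lambda>t. deg t C"] d_ge by simp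
  obtain t1 t2 where t: "t1 \<in> Y" "t2 \<in> Y" "t1 \<noteq> t2" using two_elements[OF Y2(1)] by blast
  have "\<exists>f. inj_on f (Y - {t1}) \<and> (\<forall>s\<in>Y - {t1}. f s \<in> nb s X)"
  proof (rule hall)
    show "card J \<le> card (\<Union>((\<lambda>s. nb s X) ` J))" if "J \<subseteq> Y - {t1}" for J
      using min[of J] that t(1) by blast
  qed (use finY fin_X finite_nb in auto)
  then obtain f where f: "inj_on f (Y - {t1})" "\<And>s. s \<in> Y - {t1} \<Longrightarrow> f s \<in> nb s X" by blast
  have fA: "f ` (Y - {t1}) = A"
  proof (rule card_subset_eq[OF finA])
    show "f ` (Y - {t1}) \<subseteq> A" using f(2) nbA by blast
    show "card (f ` (Y - {t1})) = card A"
      using card_image[OF f(1)] card.remove[OF finY t(1)] cA by simp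
  qed
  define x where "x = f t2"
  have x: "x \<in> A" "x \<in> X" "t2 \<sim> x" using f(2)[of t2] t fA AX by (auto simp: x_def nb_def)
  \<comment> \<open>A vertex \<open>w\<close> outside \<open>A\<close> has \<open>r\<close>
    neighbours, none in \<open>Y\<close>. Hence \<open>T - Y\<close> is large enough to contain at
    least as many non-neighbours of \<open>x\<close> as \<open>x\<close> has neighbours in
    \<open>Y\<close>.\<close>
  have "card A < card X" using card_X card_T_gt cA Y2 by simp
  then obtain w where w: "w \<in> X" "w \<notin> A" using ex_outside[OF finA] by blast
  have "nb w T \<subseteq> T - Y" using w nbA adj_sym by (auto simp: nb_def)
  then have rTY: "r \<le> card (T - Y)"
    using card_nb_X[OF w(1)] card_mono[of "T - Y"] fin_T by (metis finite_Diff)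
  define D where "D = (T - Y) - nb x (T - Y)"
  have "card (nb x (Y \<union> (T - Y))) = deg x Y + deg x (T - Y)"
    using finY fin_T by (intro card_nb_Un) auto
  moreover have "Y \<union> (T - Y) = T" using YT by blast
  ultimately have nbx: "deg x Y + deg x (T - Y) = r" using card_nb_X[OF x(2)] by simp
  have "card D = card (T - Y) - deg x (T - Y)"
    unfolding D_def using fin_T by (intro card_Diff_subset finite_nb nb_subset) auto
  then have D_ge: "deg x Y \<le> card D" using nbx rTY by simp
  have fin_nbx: "finite (nb x Y)" using finY by (rule finite_nb)
  have t2x: "t2 \<in> nb x Y" using x(3) t(2) adj_sym by (simp add: nb_def)
  \<comment> \<open>\<open>R\<close> counts the edges at \<open>C\<close> that avoid
    \<open>Y\<close>. It is \<open>0\<close> if \<open>card Y \<ge> 3\<close>, and at most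
    \<open>2\<close> if \<open>card Y = 2\<close>; in the latter case \<open>D\<close> has two
    vertices, so one of them has at most one neighbour in \<open>C\<close>.\<close>
  define R where "R = (\<Sum>t\<in>T - Y. deg t C)"
  have R: "R + card Y * (r + 1 - card Y) \<le> 2 * r" using e_C_le[OF YT] sumY by (simp add: R_def)
  have R_ge: "deg t C \<le> R" if "t \<in> T - Y" for t
    unfolding R_def using that fin_T by (intro member_le_sum) auto
  have "\<exists>y\<in>D. nb y C = {} \<or> (deg y C = 1 \<and> card Y = 2)"
  proof (cases "card Y = 2")
    case False
    then obtain p where p: "card Y = p + 3" using Y2(1)
      by (metis add.commute le_Suc_ex le_antisym not_less_eq_eq numeral_2_eq_2 numeral_3_eq_3)
    obtain q where q: "r = card Y + 2 + q"
      using Y2 by (metis add.commute le_Suc_ex le_diff_conv2 le_trans diff_le_self)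
    have "card Y * (r + 1 - card Y) = (p + 3) * (q + 3)" using p q by simp
    moreover have "2 * r \<le> (p + 3) * (q + 3)" using p q r6 by (simp add: algebra_simps)
    ultimately have "R = 0" using R by linarith
    have "card D > 0" using D_ge t2x fin_nbx by (metis card_gt_0_iff empty_iff le_zero_eq neq0_conv)
    then obtain y where y: "y \<in> D" by (metis card.empty ex_in_conv less_irrefl)
    then have "deg y C = 0" using R_ge[of y] \<open>R = 0\<close> by (simp add: D_def)
    then show ?thesis using y finite_nb[OF fin_K[OF C_K]] by auto
  next
    case Y_2: True
    then have "card A = 1" using cA by simp
    then have "A = {x}" using x(1) by (metis card_1_singletonE singletonD)
    have "card {t1} \<le> card (\<Union>t\<in>{t1}. nb t X)" using t by (intro min) auto
    then have "nb t1 X \<noteq> {}" by auto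
    then have "x \<in> nb t1 X" using nbA[OF t(1)] \<open>A = {x}\<close> by blast
    then have "{t1, t2} \<subseteq> nb x Y" using t2x t(1) adj_sym by (simp add: nb_def)
    then have "card {t1, t2} \<le> deg x Y" using fin_nbx by (intro card_mono)
    then have "2 \<le> card D" using D_ge t(3) by simp
    then obtain y y' where y: "y \<in> D" "y' \<in> D" "y \<noteq> y'" using two_elements by blast
    have "(\<Sum>t\<in>{y, y'}. deg t C) \<le> R"
      unfolding R_def using y fin_T by (intro sum_mono2) (auto simp: D_def)
    then have "deg y C + deg y' C \<le> 2" using y(3) R Y_2 r6 by simp
    then have "deg y C \<le> 1 \<or> deg y' C \<le> 1" by linarith
    then obtain v where v: "v \<in> D" "deg v C \<le> 1" using y by blast
    then show ?thesis using Y_2 finite_nb[OF fin_K[OF C_K], of v] by (cases "deg v C") auto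
  qed
  then obtain y where y: "y \<in> T" "y \<notin> Y" "\<not> x \<sim> y" "nb y C = {} \<or> (deg y C = 1 \<and> card Y = 2)"
    by (auto simp: D_def nb_def)
  \<comment> \<open>\<open>Q\<close> covers the only neighbour that \<open>y\<close> may have in
    \<open>C\<close>, away from the vertices \<open>z1\<close> and \<open>z2\<close> reserved for
    \<open>t1\<close> and \<open>t2\<close>.\<close>
  have "\<exists>z1 z2 Q. z1 \<in> nb t1 C \<and> z2 \<in> nb t2 C \<and> z1 \<noteq> z2 \<and> Q \<subseteq> C - {z1, z2} \<and> pm Q \<and>
      nb y C \<subseteq> {z1, z2} \<union> Q"
    using y(4)
  proof
    assume e: "nb y C = {}"
    have "2 < deg t1 C" "2 < deg t2 C" using d_ge[OF t(1)] d_ge[OF t(2)] Y2 by linarith+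
    then obtain z1 where z1: "z1 \<in> nb t1 C" by fastforce
    obtain z2 where z2: "z2 \<in> nb t2 C" "z2 \<notin> {z1}"
      using ex_outside[of "{z1}" "nb t2 C"] \<open>2 < deg t2 C\<close> by auto
    show ?thesis
      by (rule exI[of _ z1], rule exI[of _ z2], rule exI[of _ "{}"]) (use z1 z2 e pm_empty in auto)
  next
    assume s: "deg y C = 1 \<and> card Y = 2"
    then obtain v where v: "nb y C = {v}" by (meson card_1_singletonE)
    then have vC: "v \<in> C" by (auto simp: nb_def)
    obtain w where w: "w \<in> C" "v \<sim> w" using nb_C_C[OF vC] by (auto simp: nb_def)
    have d: "3 < deg t1 C" "3 < deg t2 C" using d_ge[OF t(1)] d_ge[OF t(2)] s r6 by linarith+
    have c2: "card {v, w} \<le> 2" by (simp add: card_insert_if)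
    obtain z1 where z1: "z1 \<in> nb t1 C" "z1 \<notin> {v, w}"
      using ex_outside[of "{v, w}" "nb t1 C"] d c2 by auto
    have "card {z1, v, w} \<le> 3" by (simp add: card_insert_if)
    then obtain z2 where z2: "z2 \<in> nb t2 C" "z2 \<notin> {z1, v, w}"
      using ex_outside[of "{z1, v, w}" "nb t2 C"] d by auto
    show ?thesis
    proof (rule exI[of _ z1], rule exI[of _ z2], rule exI[of _ "{v, w}"], intro conjI)
      show "z1 \<in> nb t1 C" "z2 \<in> nb t2 C" "z1 \<noteq> z2" using z1(1) z2 by auto
      show "{v, w} \<subseteq> C - {z1, z2}" using z1(2) z2(2) vC w(1) by auto
      show "pm {v, w}" by (rule pm_pair[OF w(2)])
      show "nb y C \<subseteq> {z1, z2} \<union> {v, w}" using v by auto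
    qed
  qed
  then obtain z1 z2 Q where z: "z1 \<in> C" "z2 \<in> C" "t1 \<sim> z1" "t2 \<sim> z2" "z1 \<noteq> z2"
    and Q: "Q \<subseteq> C - {z1, z2}" "pm Q" "nb y C \<subseteq> {z1, z2} \<union> Q"
    unfolding mem_nb by blast
  obtain m q where m: "inj_on m X" "\<And>v. v \<in> X \<Longrightarrow> v \<sim> m v" "q \<in> T - {y}" "m ` X = T - {y, q}"
    using vertex_matching[OF y(1)] by blast
  \<comment> \<open>Partners of \<open>Y\<close> under \<open>m\<close> lie in \<open>A\<close>,
    which has one vertex less than \<open>Y\<close>. So \<open>q\<close> belongs to
    \<open>Y\<close>, and \<open>m\<close> matches \<open>X - A\<close> exactly with
    \<open>T - Y - {y}\<close>.\<close>
  have "Y \<subseteq> insert q (m ` A)"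
  proof
    fix v assume v: "v \<in> Y"
    show "v \<in> insert q (m ` A)"
    proof (cases "v = q")
      case False
      then have "v \<in> m ` X" using v y(2) YT m(4) by auto
      then obtain u where u: "u \<in> X" "v = m u" by blast
      then have "u \<in> nb v X" using m(2) adj_sym by (simp add: nb_def)
      then show ?thesis using u nbA[OF v] by blast
    qed simp
  qed
  moreover have "card (insert q (m ` A)) \<le> card Y"
    using card_insert_le_m1[of "card Y" "m ` A" q] card_image_le[OF finA, of m] cA Y2 by simp
  ultimately have Y_eq: "Y = insert q (m ` A)" using finA by (intro card_seteq) auto
  have "m ` (X - A) = m ` X - m ` A" using AX by (intro inj_on_image_set_diff[OF m(1)]) auto
  also have "\<dots> = T - Y - {y}" unfolding m(4) Y_eq by blast
  finally have mXA: "m ` (X - A) = T - Y - {y}" .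
  have "pm ((X - A) \<union> m ` (X - A))"
    using m(1,2) fin_X mXA dj by (intro pm_inj_matching) (auto intro: inj_on_subset)
  then have p1: "pm ((X - A) \<union> (T - Y - {y}))" by (simp add: mXA)
  have "f ` (Y - {t1} - {t2}) = f ` (Y - {t1}) - f ` {t2}"
    using t by (intro inj_on_image_set_diff[OF f(1)]) auto
  then have fY: "f ` (Y - {t1, t2}) = A - {x}"
    by (simp add: fA x_def Diff_insert[symmetric] insert_commute)
  have "pm ((Y - {t1, t2}) \<union> f ` (Y - {t1, t2}))"
  proof (rule pm_inj_matching)
    show "inj_on f (Y - {t1, t2})" using f(1) by (rule inj_on_subset) auto
    show "s \<sim> f s" if "s \<in> Y - {t1, t2}" for s using f(2)[of s] that by (auto simp: nb_def)
    show "f ` (Y - {t1, t2}) \<inter> (Y - {t1, t2}) = {}" unfolding fY using AX YT dj by blast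
  qed (use finY in auto)
  then have p2: "pm ((Y - {t1, t2}) \<union> (A - {x}))" by (simp add: fY)
  have tC: "t1 \<notin> C" "t2 \<notin> C" using t YT dj by auto
  have p3: "pm ({t1, z1} \<union> ({t2, z2} \<union> Q))"
    by (intro pm_Un pm_pair Q(2)) (use z t Q(1) tC in auto)
  let ?P = "((X - A) \<union> (T - Y - {y})) \<union> (((Y - {t1, t2}) \<union> (A - {x})) \<union> ({t1, z1} \<union> ({t2, z2} \<union> Q)))"
  have tYT: "t1 \<in> T" "t2 \<in> T" "t1 \<noteq> y" "t2 \<noteq> y" using t YT y by auto
  have "pm (((Y - {t1, t2}) \<union> (A - {x})) \<union> ({t1, z1} \<union> ({t2, z2} \<union> Q)))"
    by (rule pm_Un[OF p2 p3]) (use z Q(1) AX YT dj tYT in auto)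
  then have P: "pm ?P"
    by (rule pm_Un[OF p1]) (use z Q(1) AX YT dj t tYT in auto)
  have eq: "?P = (X - {x}) \<union> (T - {y}) \<union> ({z1, z2} \<union> Q)" using AX YT t x y by auto
  have PV: "?P \<subseteq> V" unfolding eq using V_eq z Q(1) by blast
  show False
  proof (rule no_two_isolated[OF PV P])
    show "x \<in> V - ?P" unfolding eq using V_eq x dj z Q(1) by auto
    show "y \<in> V - ?P" unfolding eq using V_eq y dj z Q(1) by auto
    show "x \<noteq> y" using x y dj by auto
    show "nb x (V - ?P) = {}" unfolding eq using X_T[OF x(2)] y(3) by (auto simp: nb_def)
    show "nb y (V - ?P) = {}"
      unfolding eq using T_CX[OF y(1)] y(3) adj_sym Q(3) by (auto simp: nb_def)
  qed
qed

text \<open>By \<open>mid_violator\<close> a minimal violator in the neighbourhood of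
  \<open>z\<close> has \<open>1\<close> or \<open>r - 1\<close> elements. In the second case its
  vertices have at most \<open>r - 2\<close> neighbours in \<open>X\<close>, so each sends at least
  two edges to \<open>C\<close>.\<close>

lemma violator_dichotomy:
  assumes z: "z \<in> C"
  shows "(\<exists>t\<in>nb z T. nb t X = {}) \<or>
    (r - 1 \<le> deg z T \<and>
      (\<exists>Y\<subseteq>T. 2 * r - 2 \<le> (\<Sum>t\<in>Y. deg t C) \<and> (\<forall>t\<in>Y. nb t X \<noteq> {})))"
proof -
  obtain Y where Y: "Y \<subseteq> nb z T" "Y \<noteq> {}" "card (\<Union>t\<in>Y. nb t X) + 1 = card Y"
    "\<And>J. J \<subset> Y \<Longrightarrow> card J \<le> card (\<Union>t\<in>J. nb t X)"
    using minimal_violator[OF z] by blast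
  have YT: "Y \<subseteq> T" using Y(1) nb_subset by blast
  have finY: "finite Y" using YT fin_T finite_subset by blast
  have Yz: "card Y \<le> deg z T" using card_mono[OF finite_nb[OF fin_T] Y(1)] .
  have "\<not> (2 \<le> card Y \<and> card Y \<le> r - 2)" using mid_violator[OF YT Y(3,4)] by blast
  then consider "card Y = 1" | "card Y = r - 1" using Yz card_nb_C_T[OF z] Y(3) by linarith
  then show ?thesis
  proof cases
    case 1
    then obtain t where t: "Y = {t}" by (rule card_1_singletonE)
    then have "nb t X = {}" using Y(3) finite_nb[OF fin_X] by auto
    then show ?thesis using t Y(1) by blast
  next
    case 2
    have finA: "finite (\<Union>t\<in>Y. nb t X)" using finY finite_nb[OF fin_X] by blast
    have "2 \<le> deg t C" if t: "t \<in> Y" for t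
    proof -
      have "deg t X \<le> card (\<Union>t\<in>Y. nb t X)" using t by (intro card_mono[OF finA]) blast
      then show ?thesis using card_nb_T[of t] t YT Y(3) 2 r6 by auto
    qed
    then have "card Y * 2 \<le> (\<Sum>t\<in>Y. deg t C)"
      using sum_bounded_below[of Y 2 "\<lambda>t. deg t C"] by simp
    moreover have "nb t X \<noteq> {}" if t: "t \<in> Y" for t
    proof
      assume "nb t X = {}"
      moreover have "{t} \<noteq> Y" using 2 r6 by auto
      ultimately show False using Y(4)[of "{t}"] t by auto
    qed
    ultimately show ?thesis using 2 Yz YT by (intro disjI2 conjI exI[of _ Y]) auto
  qed
qed

text \<open>A vertex of \<open>B\<close> claims \<open>r\<close> of the \<open>2 * r\<close> edges
  at \<open>C\<close>. If \<open>B\<close> dominates \<open>C\<close>, it has two elements, since a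
  single one would give \<open>C\<close> the even order \<open>r\<close>; then \<open>B\<close> and
  \<open>C\<close> form a component. Otherwise a violator with \<open>r - 1\<close> elements leaves
  too few edges for any vertex of \<open>B\<close>, and with \<open>B\<close> empty every vertex of
  \<open>C\<close> has high degree into \<open>T\<close>.\<close>

theorem contradiction: False
proof -
  define B where "B = {t \<in> T. nb t X = {}}"
  have finB: "finite B" using fin_T by (simp add: B_def)
  have BT: "B \<subseteq> T" by (auto simp: B_def)
  have B_deg: "deg t C = r" if "t \<in> B" for t using card_nb_T[of t] that by (simp add: B_def)
  have C_V: "C \<subseteq> V" using V_eq by blast
  show False
  proof (cases "\<forall>z\<in>C. \<exists>t\<in>B. z \<sim> t")
    case True
    have sumB: "(\<Sum>t\<in>B. deg t C) = card B * r" using B_deg by simp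
    then have "card B * r \<le> 2 * r" using e_C_le[OF BT] by linarith
    then have B2: "card B \<le> 2" using r6 by (simp del: mult_le_cancel2 add: mult_le_cancel2)
    have "B \<noteq> {}" using True C3 by fastforce
    then have "card B \<noteq> 0" using finB by simp
    moreover have "card B \<noteq> 1"
    proof
      assume "card B = 1"
      then obtain t where t: "B = {t}" by (rule card_1_singletonE)
      then have "nb t C = C" using True adj_sym by (auto simp: nb_def)
      then have "card C = r" using B_deg[of t] t by simp
      then show False using odd_K[OF C_K] even_r by simp
    qed
    ultimately have "card B = 2" using B2 by simp
    then have "(\<Sum>t\<in>T - B. deg t C) = 0" using e_C_le[OF BT] sumB by simp
    then have none: "nb t C = {}" if "t \<in> T - B" for t
      using that fin_T finite_nb[OF fin_K[OF C_K]] by simp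
    have "C \<union> B = V"
    proof (rule conn)
      show "C \<union> B \<subseteq> V" using C_V BT T_V by blast
      show "C \<union> B \<noteq> {}" using \<open>B \<noteq> {}\<close> by blast
      fix u v assume u: "u \<in> C \<union> B" and uv: "u \<sim> v"
      have vV: "v \<in> V" using adj_V2[OF uv] .
      show "v \<in> C \<union> B"
      proof (cases "u \<in> C")
        case True
        have "v \<notin> X" using X_T[of v u] adj_sym[OF uv] True dj by blast
        moreover have "v \<in> B" if "v \<in> T"
          using none[of v] that True adj_sym[OF uv] by (auto simp: nb_def)
        ultimately show ?thesis using vV V_eq by blast
      next
        case False
        then have uB: "u \<in> B" using u by blast
        then have "v \<in> C \<union> X" using T_CX uv BT by blast
        moreover have "v \<notin> X" using uB uv by (auto simp: B_def nb_def)
        ultimately show ?thesis by blast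
      qed
    qed
    then have "X = {}" using V_eq dj BT by blast
    then show False using card_X card_T_gt r6 by simp
  next
    case False
    then obtain z where z: "z \<in> C" "\<And>t. t \<in> B \<Longrightarrow> \<not> z \<sim> t" by blast
    then have "\<not> (\<exists>t\<in>nb z T. nb t X = {})" by (auto simp: B_def nb_def)
    then obtain Y where Y: "Y \<subseteq> T" "2 * r - 2 \<le> (\<Sum>t\<in>Y. deg t C)" "\<forall>t\<in>Y. nb t X \<noteq> {}"
      using violator_dichotomy[OF z(1)] by blast
    have "B = {}"
    proof (rule ccontr)
      assume "B \<noteq> {}"
      then obtain b where b: "b \<in> B" by blast
      then have bY: "b \<in> T - Y" using Y(3) by (auto simp: B_def)
      then have "deg b C \<le> (\<Sum>t\<in>T - Y. deg t C)" using fin_T by (intro member_le_sum) auto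
      then show False using B_deg[OF b] e_C_le[OF Y(1)] Y(2) r6 by simp
    qed
    then have "r - 1 \<le> deg z' T" if "z' \<in> C" for z'
      using violator_dichotomy[OF that] by (auto simp: B_def nb_def)
    then show False using not_all_high by blast
  qed
qed

end

section \<open>Independent barriers: reduction to a single part that is not a singleton\<close>

context barrier_setting
begin

context
  assumes T_indep: "indep T"
begin

lemma not_adj_T: "s \<in> T \<Longrightarrow> t \<in> T \<Longrightarrow> \<not> s \<sim> t"
  using T_indep by (simp add: indep_def)

lemma T3: "3 \<le> card T"
  using S3 card_mono[OF fin_T S_T] by simp

lemma e_total_indep: "(\<Sum>K\<in>\<K>. e K) = r * card \<K> + r"
proof -
  have "nb t T = {}" if "t \<in> T" for t using not_adj_T that by (auto simp: nb_def)
  then have "(\<Sum>t\<in>T. deg t T) = 0" by simp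
  then show ?thesis using e_total card_T by simp
qed

lemma large_not_sub:
  assumes "K \<in> \<K>" "r < card K" "t \<in> T" "\<And>z. z \<in> K \<Longrightarrow> t \<sim> z"
  shows False
proof -
  have "K \<subseteq> nb t V" using assms(4) K_sub[OF assms(1)] by (auto simp: nb_def)
  then have "card K \<le> deg t V" using fin by (intro card_mono finite_nb)
  then show False using reg[of t] assms(2,3) T_V by auto
qed

text \<open>If \<open>t\<close> had no neighbour in \<open>K\<close>, its partner in a good pair
  would be adjacent to all of \<open>K\<close>.\<close>

lemma large_adj:
  assumes "K \<in> \<K>" "r < card K" "t \<in> T"
  shows "nb t K \<noteq> {}"
proof
  assume e: "nb t K = {}"
  obtain t' where t': "good K t t'" using good_ex[OF assms(1,3)] by blast
  then have t'T: "t' \<in> T" by (simp add: good_def)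
  have "t' \<sim> z" if "z \<in> K" for z
    using good_cover[OF assms(1) t' not_adj_T[OF assms(3) t'T] that] e that by (auto simp: nb_def)
  then show False using large_not_sub[OF assms(1,2) t'T] by blast
qed

text \<open>Replaces \<open>e_ge\<close> for large parts: a good pair sends at least
  \<open>card K\<close> edges to \<open>K\<close>, every other vertex of \<open>T\<close> at least
  one.\<close>

lemma large_e:
  assumes K: "K \<in> \<K>" "r < card K"
  shows "card K + card T \<le> e K + 2"
proof -
  have "T \<noteq> {}" using T3 by auto
  then obtain t where t: "t \<in> T" by blast
  obtain t' where g: "good K t t'" using good_ex[OF K(1) t] by blast
  then have t': "t' \<in> T" "t \<noteq> t'" by (auto simp: good_def)
  have "K \<subseteq> nb t K \<union> nb t' K"
    using good_cover[OF K(1) g not_adj_T[OF t t'(1)]] by (auto simp: nb_def)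
  then have "card K \<le> card (nb t K \<union> nb t' K)"
    using fin_K[OF K(1)] by (intro card_mono) (auto simp: finite_nb)
  also have "\<dots> \<le> deg t K + deg t' K" by (rule card_Un_le)
  finally have 1: "card K \<le> (\<Sum>s\<in>{t, t'}. deg s K)" using t'(2) by simp
  have pos: "1 \<le> deg s K" if "s \<in> T" for s
    using large_adj[OF K that] finite_nb[OF fin_K[OF K(1)]] by (simp add: Suc_le_eq card_gt_0_iff)
  have "card (T - {t, t'}) \<le> (\<Sum>s\<in>T - {t, t'}. deg s K)"
    using sum_bounded_below[of "T - {t, t'}" 1 "\<lambda>s. deg s K"] pos by simp
  moreover have "e K = (\<Sum>s\<in>T - {t, t'}. deg s K) + (\<Sum>s\<in>{t, t'}. deg s K)"
    unfolding e_def using t t' fin_T by (intro sum.subset_diff) auto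
  moreover have "card (T - {t, t'}) + 2 = card T" using fin_T t t' by (intro card_Diff_pair)
  ultimately show ?thesis using 1 by simp
qed

lemma e_ge_r_indep: "K \<in> \<K> \<Longrightarrow> r \<le> e K"
  using e_ge_r[of K] large_e[of K] T3 by (cases "card K \<le> r") auto

text \<open>Large parts have an edge to every vertex of \<open>T\<close>, so any bijection serves
  them.\<close>

lemma good_if_large:
  assumes "K \<in> \<K>" "t \<in> T" "t' \<in> T" "t \<noteq> t'" "\<And>L. L \<in> \<K> - {K} \<Longrightarrow> r < card L"
  shows "good K t t'"
proof -
  have "card (\<K> - {K}) = card (T - {t, t'})"
    using card_Diff_pair[OF fin_T assms(2,3,4)] card.remove[OF fin_\<K> assms(1)] card_T by simp
  then obtain \<mu> where mu: "bij_betw \<mu> (\<K> - {K}) (T - {t, t'})"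
    using finite_same_card_bij fin_\<K> fin_T by (metis finite_Diff)
  have "\<exists>z\<in>L. z \<sim> \<mu> L" if L: "L \<in> \<K> - {K}" for L
  proof -
    have "\<mu> L \<in> T" using bij_betwE[OF mu] L by blast
    then have "nb (\<mu> L) L \<noteq> {}" using large_adj[OF _ assms(5)[OF L]] L by blast
    then show ?thesis using adj_sym by (auto simp: nb_def)
  qed
  then show ?thesis using mu assms by (auto simp: good_def)
qed

text \<open>As for large parts only, except that \<open>K0\<close> is given its neighbour
  \<open>q\<close> in advance.\<close>

lemma good_if_large_but_one:
  assumes K: "K \<in> \<K>" "K0 \<in> \<K>" "K \<noteq> K0" and t: "t \<in> T" "t' \<in> T" "t \<noteq> t'"
    and q: "q \<in> T - {t, t'}" "nb q K0 \<noteq> {}" and large: "\<And>L. L \<in> \<K> - {K, K0} \<Longrightarrow> r < card L"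
  shows "good K t t'"
proof -
  have "card (\<K> - {K, K0}) + 2 = card \<K>" using fin_\<K> K by (intro card_Diff_pair)
  moreover have "T - {t, t', q} = T - {t, t'} - {q}" by blast
  then have "card (T - {t, t', q}) + 1 = card (T - {t, t'})"
    using card.remove[OF _ q(1)] fin_T by simp
  ultimately have "card (\<K> - {K, K0}) = card (T - {t, t', q})"
    using card_Diff_pair[OF fin_T t] card_T by simp
  then obtain g where g: "bij_betw g (\<K> - {K, K0}) (T - {t, t', q})"
    using finite_same_card_bij fin_\<K> fin_T by (metis finite_Diff)
  define \<mu> where "\<mu> = g(K0 := q)"
  have "bij_betw \<mu> (\<K> - {K, K0}) (T - {t, t', q})"
    using g by (rule bij_betw_cong[THEN iffD1, rotated]) (auto simp: \<mu>_def)
  then have "bij_betw \<mu> ((\<K> - {K, K0}) \<union> {K0}) ((T - {t, t', q}) \<union> {\<mu> K0})"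
    by (intro notIn_Un_bij_betw) (auto simp: \<mu>_def)
  moreover have "(\<K> - {K, K0}) \<union> {K0} = \<K> - {K}" using K by blast
  moreover have "(T - {t, t', q}) \<union> {\<mu> K0} = T - {t, t'}" using q by (auto simp: \<mu>_def)
  ultimately have mu: "bij_betw \<mu> (\<K> - {K}) (T - {t, t'})" by simp
  have "\<exists>z\<in>L. z \<sim> \<mu> L" if L: "L \<in> \<K> - {K}" for L
  proof (cases "L = K0")
    case True
    then show ?thesis using q(2) adj_sym by (auto simp: \<mu>_def nb_def)
  next
    case False
    have "\<mu> L \<in> T" using bij_betwE[OF mu] L by blast
    then have "nb (\<mu> L) L \<noteq> {}" using large_adj[OF _ large] L False by blast
    then show ?thesis using adj_sym by (auto simp: nb_def)
  qed
  then show ?thesis using mu t by (auto simp: good_def)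
qed

text \<open>No vertex of \<open>K\<close> can then have two non-neighbours in \<open>T\<close>, so
  each sends at least two edges; more than \<open>2 * r\<close> edges at one part exceed the
  surplus.\<close>

lemma large_all_good:
  assumes K: "K \<in> \<K>" "r < card K" and all: "\<And>t t'. t \<in> T \<Longrightarrow> t' \<in> T \<Longrightarrow> t \<noteq> t' \<Longrightarrow> good K t t'"
  shows False
proof -
  have "2 \<le> deg z T" if z: "z \<in> K" for z
  proof (rule ccontr)
    assume n: "\<not> ?thesis"
    have "card (T - nb z T) = card T - deg z T"
      using fin_T by (intro card_Diff_subset finite_nb nb_subset)
    then have "2 \<le> card (T - nb z T)" using T3 n by linarith
    then obtain t t' where t: "t \<in> T" "t' \<in> T" "t \<noteq> t'" "\<not> z \<sim> t" "\<not> z \<sim> t'"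
      using two_elements by (fastforce simp: nb_def)
    then show False
      using good_cover[OF K(1) all[OF t(1-3)] not_adj_T[OF t(1,2)] z] adj_sym by blast
  qed
  then have "card K * 2 \<le> e K"
    using sum_bounded_below[of K 2 "\<lambda>z. deg z T"] e_alt[OF K(1)] by simp
  moreover have "e K + r * card (\<K> - {K}) \<le> (\<Sum>K\<in>\<K>. e K)"
    using e_sum_ge[of "{K}"] K e_ge_r_indep by simp
  ultimately show False using e_total_indep card.remove[OF fin_\<K> K(1)] K(2) by simp
qed

text \<open>The two parts would use \<open>4 * r - 4\<close> edges, but only \<open>3 * r\<close>
  are available for them.\<close>

lemma two_nonsingle_small:
  assumes "K \<in> \<K>" "L \<in> \<K>" "K \<noteq> L" "2 * r - 2 \<le> e K" "2 * r - 2 \<le> e L"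
  shows False
proof -
  have "e K + e L + r * card (\<K> - {K, L}) \<le> (\<Sum>K\<in>\<K>. e K)"
    using e_sum_ge[of "{K, L}"] assms e_ge_r_indep by simp
  moreover have c: "card (\<K> - {K, L}) + 2 = card \<K>" using fin_\<K> assms by (intro card_Diff_pair)
  have "r * card \<K> = r * card (\<K> - {K, L}) + 2 * r"
    unfolding c[symmetric] by (simp add: algebra_simps)
  ultimately show False using e_total_indep assms(4,5) r6 by simp
qed

text \<open>Without singletons at most one part \<open>K0\<close> has \<open>r\<close> or fewer
  vertices. All pairs are good for a large part unless \<open>K0\<close> exists and has just two
  neighbours in \<open>T\<close>; that case forces \<open>card T = 3\<close> and ends in a parity
  contradiction.\<close>

lemma ex_single: "\<exists>K\<in>\<K>. card K = 1"
proof (rule ccontr)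
  assume "\<not> ?thesis"
  then have ns: "card K \<noteq> 1" if "K \<in> \<K>" for K using that by blast
  have "2 \<le> card \<K>" using card_T T3 by simp
  then obtain K1 K2 where K12: "K1 \<in> \<K>" "K2 \<in> \<K>" "K1 \<noteq> K2" using two_elements by blast
  show False
  proof (cases "\<forall>K\<in>\<K>. r < card K")
    case True
    then show False using large_all_good[OF K12(1)] good_if_large[OF K12(1)] K12(1) by blast
  next
    case False
    then obtain K0 where K0: "K0 \<in> \<K>" "card K0 \<le> r" by force
    note sm = e_ge_nonsingle[OF K0 ns[OF K0(1)]]
    have large: "r < card K" if "K \<in> \<K>" "K \<noteq> K0" for K
      using two_nonsingle_small[OF that(1) K0(1) that(2) _ sm(3)]
        e_ge_nonsingle(3)[OF that(1) _ ns[OF that(1)]] by (cases "card K \<le> r") auto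
    obtain K where K: "K \<in> \<K>" "K \<noteq> K0" using K12 by blast
    define N where "N = {t \<in> T. nb t K0 \<noteq> {}}"
    have finN: "finite N" using fin_T by (simp add: N_def)
    show False
    proof (cases "3 \<le> card N")
      case True
      have "good K t t'" if t: "t \<in> T" "t' \<in> T" "t \<noteq> t'" for t t'
      proof -
        have "card {t, t'} < card N" using True t(3) by simp
        then obtain q where "q \<in> N" "q \<notin> {t, t'}" using ex_outside[of "{t, t'}" N] by blast
        then show ?thesis
          using good_if_large_but_one[OF K(1) K0(1) K(2) t, of q] large by (auto simp: N_def)
      qed
      then show False using large_all_good[OF K(1) large[OF K]] by blast
    next
      case False
      have nb2: "2 \<le> deg z T" "nb z T \<subseteq> N" if "z \<in> K0" for z
        using card_nb_T_ge[OF K0(1) that] sm(2) that adj_sym r6 by (auto simp: N_def nb_def)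
      obtain z0 where z0: "z0 \<in> K0" using sm(1) by fastforce
      have "deg z0 T \<le> card N" using nb2(2)[OF z0] by (rule card_mono[OF finN])
      then have cN: "card N = 2" using nb2(1)[OF z0] False by linarith
      have nbN: "nb z T = N" if "z \<in> K0" for z
        using nb2[OF that] cN finN by (intro card_seteq) auto
      have cK0: "card K0 = r - 1" using card_nb_T_ge[OF K0(1) z0] nbN[OF z0] cN sm(2) by simp
      obtain t1 t2 where N: "N = {t1, t2}" "t1 \<noteq> t2" using cN by (meson card_2_iff)
      have tT: "t1 \<in> T" "t2 \<in> T" using N by (auto simp: N_def)
      have "card N < card T" using cN T3 by simp
      then obtain t3 where t3: "t3 \<in> T" "t3 \<notin> N" using ex_outside[OF finN] by blast
      have T_eq: "T = {t1, t2, t3}"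
      proof (rule ccontr)
        assume "T \<noteq> {t1, t2, t3}"
        then obtain t4 where t4: "t4 \<in> T" "t4 \<notin> N" "t4 \<noteq> t3" using N tT t3 by blast
        have "good K0 t3 t4" using good_if_large[OF K0(1) t3(1) t4(1)] t4(3) large by blast
        then have "t3 \<sim> z0 \<or> t4 \<sim> z0"
          using good_cover[OF K0(1) _ not_adj_T[OF t3(1) t4(1)] z0] by blast
        then show False using t3 t4 nbN[OF z0] adj_sym by (auto simp: nb_def)
      qed
      have t_ne: "t3 \<noteq> t1" "t3 \<noteq> t2" using t3(2) N by auto
      \<comment> \<open>Such a vertex is adjacent to all \<open>r - 1\<close> vertices of
        \<open>K0\<close>, so only one further edge is left.\<close>
      have d1: "deg t K \<le> 1" if t: "t \<in> N" for t
      proof -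
        have "nb t K0 = K0" using nbN t adj_sym by (fastforce simp: nb_def)
        moreover have "deg t (K0 \<union> K) = deg t K0 + deg t K"
          using fin_K K K0(1) disj[OF K0(1) K(1)] by (intro card_nb_Un) auto
        moreover have "deg t (K0 \<union> K) \<le> r"
          using K_sub[OF K(1)] K_sub[OF K0(1)] t T_V by (intro card_nb_le) (auto simp: N_def)
        ultimately show ?thesis using cK0 r6 by simp
      qed
      have gd: "good K t t3" if t: "t \<in> N" for t
      proof -
        obtain q where q: "q \<in> N" "q \<noteq> t" using N by auto
        show ?thesis
          by (rule good_if_large_but_one[OF K(1) K0(1) K(2), of t t3 q])
            (use t q t3 t_ne N large in \<open>auto simp: N_def\<close>)
      qed
      have cov: "t \<sim> z" if "t \<in> N" "z \<in> K" "\<not> t3 \<sim> z" for t z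
      proof -
        have "t \<in> T" using that(1) by (simp add: N_def)
        then show ?thesis
          using good_cover[OF K(1) gd[OF that(1)] not_adj_T[OF _ t3(1)] that(2)] that(3) by blast
      qed
      obtain x where x: "x \<in> K" "\<not> t3 \<sim> x" using large_not_sub[OF K(1) large[OF K] t3(1)] by blast
      have nbK: "nb t K = {x}" if t: "t \<in> N" for t
      proof -
        have "{x} = nb t K"
          by (rule card_seteq)
            (use cov[OF t x] x d1[OF t] fin_K[OF K(1)] finite_nb in \<open>auto simp: nb_def\<close>)
        then show ?thesis by simp
      qed
      have t3_all: "t3 \<sim> z" if "z \<in> K" "z \<noteq> x" for z
      proof (rule ccontr)
        assume "\<not> t3 \<sim> z"
        then have "z \<in> nb t1 K" using cov[of t1 z] that N by (simp add: nb_def)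
        then show False using nbK[of t1] that N by simp
      qed
      have x_T: "x \<notin> T" "x \<in> V" using x K_sub[OF K(1)] by auto
      have sub: "K - {x} \<subseteq> nb t3 V" using t3_all K_sub[OF K(1)] by (auto simp: nb_def)
      have "card (K - {x}) = card K - 1" using x fin_K[OF K(1)] by simp
      moreover have "deg t3 V = r" using reg t3 T_V by blast
      ultimately have "nb t3 V = K - {x}" and cKx: "card (K - {x}) = r"
        using large[OF K] card_seteq[OF finite_nb[OF fin] sub] card_mono[OF finite_nb[OF fin] sub]
        by auto
      \<comment> \<open>Once \<open>x\<close> is deleted, \<open>t3\<close> and its \<open>r\<close>
        neighbours are cut off from the rest; they are \<open>r + 1\<close> vertices, an odd number,
        against factor-criticality at \<open>x\<close>.\<close>
      define D where "D = insert t3 (K - {x})"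
      have t3K: "t3 \<notin> K" using t3 K_sub[OF K(1)] by auto
      have "pm ((V - {x}) \<inter> D)"
      proof (rule pm_restrict[OF factor_critical[OF x_T(2)]])
        fix u v assume u: "u \<in> (V - {x}) \<inter> D" and v: "v \<in> V - {x} - D"
        show "\<not> u \<sim> v"
        proof
          assume uv: "u \<sim> v"
          show False
          proof (cases "u = t3")
            case True
            then have "v \<in> nb t3 V" using uv v by (simp add: nb_def)
            then show False using v \<open>nb t3 V = K - {x}\<close> by (simp add: D_def)
          next
            case False
            then have uK: "u \<in> K" "u \<noteq> x" using u by (auto simp: D_def)
            show False
            proof (cases "v \<in> T")
              case True
              then have "v \<in> N" using T_eq N v by (auto simp: D_def)
              then have "u \<in> nb v K" using uK adj_sym[OF uv] by (simp add: nb_def)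
              then show False using nbK[OF \<open>v \<in> N\<close>] uK by simp
            next
              case False
              then have "v \<in> K" using nocross[OF K(1) uK(1) _ uv] v by blast
              then show False using v by (auto simp: D_def)
            qed
          qed
        qed
      qed
      moreover have "(V - {x}) \<inter> D = D" using K_sub[OF K(1)] t3 T_V x_T by (auto simp: D_def)
      moreover have "card D = r + 1" using t3K cKx fin_K[OF K(1)] by (simp add: D_def)
      ultimately have "even (r + 1)" using pm_even by metis
      then show False using even_r by simp
    qed
  qed
qed

text \<open>A singleton part has its \<open>r\<close> neighbours in \<open>T\<close>, so by
  \<open>large_e\<close> the parts with more than \<open>r\<close> vertices satisfy
  \<open>2 * r - 2 \<le> e K\<close> as well. Two parts of order greater than one are then
  impossible, and the surplus requires one.\<close>

theorem indep_T_contradiction: False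
proof -
  obtain K0 where K0: "K0 \<in> \<K>" "card K0 = 1" using ex_single by blast
  then obtain x where x: "K0 = {x}" by (meson card_1_singletonE)
  have "deg x K0 = 0" using card_nb_K_lt[OF K0(1), of x] x by simp
  then have "deg x T = r" using card_nb_K_T[OF K0(1), of x] x by simp
  then have rT: "r \<le> card T" using card_mono[OF fin_T nb_subset] by metis
  have high: "2 * r - 2 \<le> e K" if "K \<in> \<K>" "card K \<noteq> 1" for K
    using e_ge_nonsingle(3)[OF that(1) _ that(2)] large_e[OF that(1)] rT by (cases
      "card K \<le> r") auto
  have "\<exists>C\<in>\<K>. card C \<noteq> 1"
  proof (rule ccontr)
    assume "\<not> ?thesis"
    then have "(\<Sum>K\<in>\<K>. e K) = r * card \<K>" using e_single by simp
    then show False using e_total_indep r6 by simp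
  qed
  then obtain C where C: "C \<in> \<K>" "card C \<noteq> 1" by blast
  have others: "card K = 1" if "K \<in> \<K>" "K \<noteq> C" for K
    using two_nonsingle_small[OF that(1) C(1) that(2) _ high[OF C]] high[OF that(1)] by blast
  have "(\<Sum>K\<in>\<K>. e K) = e C + (\<Sum>K\<in>\<K> - {C}. e K)" using C(1) fin_\<K> by (rule sum.remove[rotated])
  also have "(\<Sum>K\<in>\<K> - {C}. e K) = r * card (\<K> - {C})" using e_single others by simp
  finally have "e C = 2 * r" using e_total_indep card.remove[OF fin_\<K> C(1)] by simp
  then interpret one_nonsingle adj V r S T \<K> C
    using T_indep C others rT by unfold_locales auto
  show False by (rule contradiction)
qed

end

end

section \<open>The balanced case\<close>

context sgraph
begin

lemma complete_bipartite_pm: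
  assumes "finite A" "finite B" "card A = card B" "A \<inter> B = {}"
    and "\<And>a b. a \<in> A \<Longrightarrow> b \<in> B \<Longrightarrow> a \<sim> b"
  shows "pm (A \<union> B)"
proof -
  obtain f where f: "bij_betw f A B" using finite_same_card_bij[OF assms(1-3)] by blast
  then have im: "inj_on f A" "f ` A = B" by (auto simp: bij_betw_def)
  have "pm (A \<union> f ` A)"
  proof (rule pm_inj_matching[OF assms(1) im(1)])
    show "a \<sim> f a" if "a \<in> A" for a using assms(5)[OF that] im(2) that by blast
    show "f ` A \<inter> A = {}" unfolding im(2) using assms(4) by blast
  qed
  then show ?thesis by (simp add: im(2))
qed

end

locale balanced = regular_equimatchable adj V r
  for adj :: "'a \<Rightarrow> 'a \<Rightarrow> bool" (infix "\<sim>" 50) and V :: "'a set" and r :: nat +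
  fixes S X :: "'a set" and c :: 'a
  assumes V_eq: "V = insert c (S \<union> X)" and c_SX: "c \<notin> S" "c \<notin> X" and dj: "S \<inter> X = {}"
    and indep_S: "indep S" and indep_X: "indep X" and card_SX: "card S = card X"
    and card_c_S: "deg c S = r div 2" and card_c_X: "deg c X = r div 2"
begin

lemma fin_S: "finite S" and fin_X: "finite X"
  using fin V_eq by auto

text \<open>The setting is symmetric in the two sides; facts about \<open>S\<close> are reused for
  \<open>X\<close> through this.\<close>

lemma swapped: "balanced adj V r X S c"
  by unfold_locales (use V_eq c_SX dj indep_S indep_X card_SX card_c_S card_c_X in auto)

abbreviation "S1 \<equiv> nb c S"
abbreviation "X1 \<equiv> nb c X"

lemma c_adj: "c \<sim> v \<Longrightarrow> v \<in> S1 \<union> X1"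
  using adj_V2[of c v] V_eq adj_irrefl by (auto simp: nb_def)

lemma S_adj: "s \<in> S \<Longrightarrow> s \<sim> v \<Longrightarrow> v \<in> X \<or> (v = c \<and> s \<in> S1)"
  using adj_V2[of s v] V_eq indep_S adj_sym by (auto simp: nb_def indep_def)

lemma X_adj: "x \<in> X \<Longrightarrow> x \<sim> v \<Longrightarrow> v \<in> S \<or> (v = c \<and> x \<in> X1)"
  using adj_V2[of x v] V_eq indep_X adj_sym by (auto simp: nb_def indep_def)

lemma card_nb_S1: "s \<in> S1 \<Longrightarrow> deg s X = r - 1"
proof -
  assume s: "s \<in> S1"
  then have sS: "s \<in> S" "s \<sim> c" using adj_sym by (auto simp: nb_def)
  have "nb s V = insert c (nb s X)" using S_adj[OF sS(1)] sS(2) V_eq by (auto simp: nb_def)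
  moreover have "card (insert c (nb s X)) = Suc (deg s X)"
    using c_SX finite_nb[OF fin_X] by (auto simp: nb_def)
  ultimately show ?thesis using reg[of s] sS V_eq by auto
qed

lemma card_nb_S2: "s \<in> S \<Longrightarrow> s \<notin> S1 \<Longrightarrow> deg s X = r"
proof -
  assume s: "s \<in> S" "s \<notin> S1"
  have "nb s V = nb s X" using S_adj[OF s(1)] s(2) V_eq by (auto simp: nb_def)
  then show ?thesis using reg[of s] s V_eq by auto
qed

lemma card_nb_X1: "x \<in> X1 \<Longrightarrow> deg x S = r - 1"
  using balanced.card_nb_S1[OF swapped] .

lemma card_nb_X2: "x \<in> X \<Longrightarrow> x \<notin> X1 \<Longrightarrow> deg x S = r"
  using balanced.card_nb_S2[OF swapped] .

lemma half: "3 \<le> r div 2" "2 * (r div 2) = r"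
  using r6 even_r by auto

text \<open>
  Otherwise the edge \<open>cs\<close> and a matching of the neighbours of \<open>u\<close> would isolate \<open>u\<close>,
  although \<open>X\<close> has one vertex more than \<open>S - {s}\<close>.
\<close>

lemma violator:
  assumes us: "u \<in> S1" "s \<in> S1" "u \<noteq> s"
  shows "\<exists>Y\<subseteq>nb u X. card (\<Union>x\<in>Y. nb x (S - {s, u})) < card Y"
proof (rule ccontr)
  assume n: "\<not> ?thesis"
  let ?N = "nb u X"
  have finN: "finite ?N" using fin_X by (rule finite_nb)
  have "\<exists>f. inj_on f ?N \<and> (\<forall>x\<in>?N. f x \<in> nb x (S - {s, u}))"
  proof (rule hall)
    show "card J \<le> card (\<Union>((\<lambda>x. nb x (S - {s, u})) ` J))" if "J \<subseteq> ?N" for J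
      using n that by (meson not_less)
  qed (use finN fin_S finite_nb in auto)
  then obtain f where f: "inj_on f ?N" "\<And>x. x \<in> ?N \<Longrightarrow> f x \<in> S - {s, u} \<and> x \<sim> f x"
    by (auto simp: nb_def)
  have fS: "f ` ?N \<subseteq> S - {s, u}" using f by blast
  have NX: "?N \<subseteq> X" by (rule nb_subset)
  have sS: "s \<in> S" "u \<in> S" "c \<sim> s" using us by (auto simp: nb_def)
  have "pm (?N \<union> f ` ?N)" using f finN fS NX dj by (intro pm_inj_matching) auto
  then have P: "pm ((?N \<union> f ` ?N) \<union> {c, s})"
    by (rule pm_Un[OF _ pm_pair[OF sS(3)]]) (use fS NX c_SX sS dj in auto)
  let ?P = "(?N \<union> f ` ?N) \<union> {c, s}"
  have PV: "?P \<subseteq> V" using V_eq fS NX sS by blast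
  obtain U where U: "U \<subseteq> V - ?P" "pm U" "card (V - (?P \<union> U)) = 1"
    using extend_misses_one[OF PV P] by blast
  have uU: "u \<notin> U"
  proof
    assume "u \<in> U"
    then obtain v where v: "v \<in> U" "u \<sim> v" using pm_remove[OF U(2)] by blast
    then show False using S_adj[OF sS(2) v(2)] U(1) by (auto simp: nb_def)
  qed
  define D where "D = (\<lambda>x. {x}) ` (X - ?N)"
  have "card D \<le> card (\<Union>D - U) + card (S \<inter> U)"
  proof (rule pm_count[OF U(2)])
    show "v \<in> K \<union> S" if K: "K \<in> D" "x \<in> K" "v \<in> U" "x \<sim> v" for K x v
    proof -
      have "x \<in> X" using K by (auto simp: D_def)
      then show ?thesis using X_adj K(3,4) U(1) by blast
    qed
  qed (use fin_X in \<open>auto simp: D_def\<close>)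
  moreover have "card D = card (X - ?N)" unfolding D_def by (simp add: card_image)
  moreover have "\<Union>D = X - ?N" by (auto simp: D_def)
  moreover have "card (S \<inter> U) \<le> card (S - {s, u} - f ` ?N)"
    using U(1) uU fin_S by (intro card_mono) auto
  moreover have "card (S - {s, u} - f ` ?N) = card (S - {s, u}) - card ?N"
    using fS finN card_image[OF f(1)] by (simp add: card_Diff_subset)
  moreover have "card (S - {s, u}) + 2 = card S"
    using fin_S sS us(3) by (intro card_Diff_pair) auto
  moreover have "card (X - ?N) = card X - card ?N" using NX finN by (intro card_Diff_subset)
  moreover have "card ?N \<le> card (S - {s, u})"
    using card_mono[OF _ fS] fin_S card_image[OF f(1)] by simp
  ultimately have "2 \<le> card (X - ?N - U)" using card_SX by simp
  also have "\<dots> \<le> card (V - (?P \<union> U))"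
  proof (rule card_mono)
    show "X - ?N - U \<subseteq> V - (?P \<union> U)" using V_eq dj fS c_SX sS by blast
  qed (use fin in auto)
  finally show False using U(3) by simp
qed

text \<open>A member of the violator \<open>Y\<close> has at most \<open>card Y + 1\<close>
  neighbours in \<open>S\<close>, since only \<open>s\<close> and \<open>u\<close> escape the count.
  Degrees then force \<open>Y\<close> to be the whole neighbourhood of \<open>u\<close> in
  \<open>X\<close>, and a member \<open>p\<close> outside \<open>X1\<close>, having \<open>r\<close>
  neighbours, sees everything that \<open>Y\<close> can see.\<close>

lemma S1_nb:
  assumes us: "u \<in> S1" "s \<in> S1" "u \<noteq> s"
  shows "\<exists>p\<in>nb u X. p \<notin> X1"
    and "\<And>p. p \<in> nb u X \<Longrightarrow> p \<notin> X1 \<Longrightarrow> s \<sim> p \<and> (\<forall>x\<in>nb u X. nb x S \<subseteq> nb p S)"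
proof -
  obtain Y where Y: "Y \<subseteq> nb u X" "card (\<Union>x\<in>Y. nb x (S - {s, u})) < card Y"
    using violator[OF us] by blast
  define Z where "Z = (\<Union>x\<in>Y. nb x (S - {s, u}))"
  have finu: "finite (nb u X)" using finite_nb[OF fin_X] .
  have finY: "finite Y" using Y(1) finu finite_subset by blast
  have finZ: "finite Z" unfolding Z_def using finY finite_nb fin_S by blast
  have YX: "Y \<subseteq> X" using Y(1) nb_subset by blast
  have Yle: "card Y \<le> r - 1" using card_mono[OF finu Y(1)] card_nb_S1[OF us(1)] by simp
  have low: "deg x S \<le> card Y + 1" "s \<sim> x \<or> deg x S \<le> card Y" if x: "x \<in> Y" for x
  proof -
    have sub: "nb x (S - {s, u}) \<subseteq> Z" using x by (auto simp: Z_def)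
    have 1: "nb x S \<subseteq> insert s (insert u Z)" using sub by (auto simp: nb_def)
    have "deg x S \<le> card (insert s (insert u Z))" using 1 finZ by (intro card_mono) auto
    also have "\<dots> \<le> card Z + 2" using finZ by (simp add: card_insert_if)
    finally show "deg x S \<le> card Y + 1" using Y(2) by (simp add: Z_def)
    show "s \<sim> x \<or> deg x S \<le> card Y"
    proof (cases "s \<sim> x")
      case False
      then have "nb x S \<subseteq> insert u Z" using 1 adj_sym by (auto simp: nb_def)
      then have "deg x S \<le> card (insert u Z)" using finZ by (intro card_mono) auto
      also have "\<dots> \<le> card Z + 1" using finZ by (simp add: card_insert_if)
      finally show ?thesis using Y(2) by (simp add: Z_def)
    qed simp
  qed
  \<comment> \<open>\<open>X1\<close> has only \<open>r / 2\<close> vertices, too few for a violator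
    whose members have \<open>r - 1\<close> neighbours in \<open>S\<close>.\<close>
  have "\<exists>p\<in>Y. p \<notin> X1"
  proof (rule ccontr)
    assume "\<not> ?thesis"
    then have YX1: "Y \<subseteq> X1" by blast
    then have "card Y \<le> r div 2" using card_mono[OF finite_nb[OF fin_X] YX1] card_c_X by simp
    moreover obtain x where "x \<in> Y" using Y(2) by fastforce
    then have "r - 1 \<le> card Y + 1" using low(1)[of x] card_nb_X1[of x] YX1 by auto
    ultimately show False using half r6 by simp
  qed
  then obtain p0 where p0: "p0 \<in> Y" "p0 \<notin> X1" by blast
  then have "r \<le> card Y + 1" using low(1)[of p0] card_nb_X2[of p0] YX by auto
  then have cY: "card Y = r - 1" using Yle by simp
  then have Yeq: "Y = nb u X" using card_nb_S1[OF us(1)] Y(1) finu by (intro card_subset_eq) auto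
  show "\<exists>p\<in>nb u X. p \<notin> X1" using p0 Yeq by blast
  fix p assume p: "p \<in> nb u X" "p \<notin> X1"
  have pX: "p \<in> X" "u \<sim> p" using p by (auto simp: nb_def)
  have cp: "deg p S = r" using card_nb_X2[OF pX(1) p(2)] .
  have sp: "s \<sim> p" using low(2)[of p] p(1) Yeq cp cY r6 by auto
  have usS: "u \<in> S" "s \<in> S" using us by (auto simp: nb_def)
  have "nb p S = insert s (insert u Z)"
  proof (rule card_seteq)
    show "nb p S \<subseteq> insert s (insert u Z)" using p Yeq by (auto simp: nb_def Z_def)
    have "card (insert s (insert u Z)) \<le> card Z + 2" using finZ by (simp add: card_insert_if)
    then show "card (insert s (insert u Z)) \<le> deg p S" using Y(2) cY cp by (simp add: Z_def)
  qed (use finZ in auto)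
  moreover have "nb x S \<subseteq> insert s (insert u Z)" if "x \<in> nb u X" for x
    using that Yeq by (auto simp: nb_def Z_def)
  ultimately show "s \<sim> p \<and> (\<forall>x\<in>nb u X. nb x S \<subseteq> nb p S)" using sp by simp
qed

text \<open>\<open>Z\<close> is the neighbourhood in \<open>S\<close> of a vertex \<open>p\<close>
  outside \<open>X1\<close>. By \<open>S1_nb\<close> this \<open>p\<close> is adjacent to all of
  \<open>S1\<close>, and its neighbourhood absorbs those of all neighbours of \<open>S1\<close> in
  \<open>X\<close>.\<close>

lemma hub:
  obtains Z where "Z \<subseteq> S" "card Z = r" "S1 \<subseteq> Z" "\<And>u x. u \<in> S1 \<Longrightarrow> x \<in> nb u X \<Longrightarrow> nb x S \<subseteq> Z"
    "\<And>u x. u \<in> S1 \<Longrightarrow> x \<in> nb u X \<Longrightarrow> x \<notin> X1 \<Longrightarrow> nb x S = Z"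
proof -
  have c2: "2 \<le> card S1" using card_c_S half by simp
  then obtain u0 u1 where u0: "u0 \<in> S1" "u1 \<in> S1" "u0 \<noteq> u1" using two_elements by blast
  obtain p where p: "p \<in> nb u0 X" "p \<notin> X1" using S1_nb(1)[OF u0] by blast
  have pX: "p \<in> X" "u0 \<sim> p" using p by (auto simp: nb_def)
  define Z where "Z = nb p S"
  have cZ: "card Z = r" using card_nb_X2[OF pX(1) p(2)] by (simp add: Z_def)
  have adj_p: "u \<sim> p" if "u \<in> S1" for u
    using S1_nb(2)[OF u0(1) that _ p] pX(2) by (cases "u = u0") auto
  have S1Z: "S1 \<subseteq> Z" using adj_p adj_sym by (auto simp: Z_def nb_def)
  have sub: "nb x S \<subseteq> Z" if x: "u \<in> S1" "x \<in> nb u X" for u x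
  proof -
    obtain s where s: "s \<in> S1" "u \<noteq> s" using u0 by blast
    have "p \<in> nb u X" using adj_p[OF x(1)] pX(1) by (simp add: nb_def)
    then show ?thesis using S1_nb(2)[OF x(1) s _ p(2)] x(2) by (simp add: Z_def)
  qed
  have eq: "nb x S = Z" if x: "u \<in> S1" "x \<in> nb u X" "x \<notin> X1" for u x
  proof (rule card_subset_eq)
    show "finite Z" using fin_S by (simp add: Z_def finite_nb)
    show "deg x S = card Z" using card_nb_X2[of x] x cZ by (auto simp: nb_def)
  qed (rule sub[OF x(1,2)])
  show ?thesis using that[of Z] nb_subset cZ S1Z sub eq by (simp add: Z_def)
qed

text \<open>A neighbour of \<open>u\<close> outside \<open>X1\<close> sees all of \<open>Z\<close>,
  in particular \<open>s\<close>; and all neighbours of \<open>s\<close> in \<open>X\<close> lie in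
  \<open>W\<close>, because \<open>s\<close> is itself a neighbour of \<open>x\<close> in
  \<open>X1\<close>.\<close>

lemma hub_nb:
  assumes Z: "S1 \<subseteq> Z" "\<And>u x. u \<in> S1 \<Longrightarrow> x \<in> nb u X \<Longrightarrow> x \<notin> X1 \<Longrightarrow> nb x S = Z"
    and W: "X1 \<subseteq> W" "\<And>v y. v \<in> X1 \<Longrightarrow> y \<in> nb v S \<Longrightarrow> nb y X \<subseteq> W"
    and edge: "s \<in> S1" "x \<in> X1" "s \<sim> x" and u: "u \<in> S1"
  shows "nb u X \<subseteq> W"
proof
  fix p assume p: "p \<in> nb u X"
  show "p \<in> W"
  proof (cases "p \<in> X1")
    case False
    then have "s \<in> nb p S" using Z(2)[OF u p] Z(1) edge(1) by blast
    then have "p \<in> nb s X" using p adj_sym by (auto simp: nb_def)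
    moreover have "s \<in> nb x S" using edge adj_sym by (auto simp: nb_def)
    ultimately show ?thesis using W(2)[OF edge(2)] by blast
  qed (use W(1) in blast)
qed

text \<open>
  If some \<open>q \<in> Z\<close> has no neighbour in \<open>X1\<close>, then all degrees inside \<open>Z \<union> W\<close> are forced,
  and matching \<open>q\<close> into \<open>W\<close> and its counterpart in \<open>W\<close> out of \<open>Z\<close> isolates \<open>c\<close> and another
  vertex.
\<close>

lemma hub_closed_or_gap:
  assumes Z: "Z \<subseteq> S" "card Z = r" "S1 \<subseteq> Z" "\<And>u x. u \<in> S1 \<Longrightarrow> x \<in> nb u X \<Longrightarrow> nb x S \<subseteq> Z"
      "\<And>u x. u \<in> S1 \<Longrightarrow> x \<in> nb u X \<Longrightarrow> x \<notin> X1 \<Longrightarrow> nb x S = Z"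
    and W: "W \<subseteq> X" "card W = r" "X1 \<subseteq> W" "\<And>v y. v \<in> X1 \<Longrightarrow> y \<in> nb v S \<Longrightarrow> nb y X \<subseteq> W"
      "\<And>v y. v \<in> X1 \<Longrightarrow> y \<in> nb v S \<Longrightarrow> y \<notin> S1 \<Longrightarrow> nb y X = W"
    and edge: "s \<in> S1" "x \<in> X1" "s \<sim> x"
    and q: "q \<in> Z" "q \<notin> S1" "nb q X1 = {}"
  shows False
proof -
  have finZ: "finite Z" "finite W" using Z(1) W(1) fin_S fin_X finite_subset by auto
  have xs: "x \<sim> s" using edge(3) by (rule adj_sym)
  have S1_W: "nb u X \<subseteq> W" if "u \<in> S1" for u
    by (rule hub_nb[of Z W s x u]) fact+
  have X1_Z: "nb v S \<subseteq> Z" if "v \<in> X1" for v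
    by (rule balanced.hub_nb[OF swapped, of W Z x s v]) fact+
  have X1_eq: "nb v S = Z - {q}" if v: "v \<in> X1" for v
  proof (rule card_subset_eq)
    show "nb v S \<subseteq> Z - {q}" using X1_Z[OF v] q(3) v adj_sym by (auto simp: nb_def)
    show "deg v S = card (Z - {q})" using card_nb_X1[OF v] Z(2) q(1) finZ by simp
  qed (use finZ in auto)
  \<comment> \<open>Otherwise \<open>s\<close> would be adjacent to all \<open>r\<close> vertices of
    \<open>W\<close> besides \<open>c\<close>.\<close>
  have "\<exists>q'. q' \<in> W \<and> q' \<notin> X1 \<and> nb q' S1 = {}"
  proof (rule ccontr)
    assume n: "\<not> ?thesis"
    have "s \<sim> w" if w: "w \<in> W" for w
    proof (cases "w \<in> X1")
      case True
      then have "s \<in> nb w S" using X1_eq edge(1) Z(3) q(2) by blast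
      then show ?thesis using adj_sym by (simp add: nb_def)
    next
      case False
      then obtain u where u: "u \<in> S1" "w \<sim> u" using n w by (auto simp: nb_def)
      then have "w \<in> nb u X" using w W(1) adj_sym by (auto simp: nb_def)
      then have "nb w S = Z" using Z(5)[OF u(1) _ False] by blast
      then have "s \<in> nb w S" using Z(3) edge(1) by blast
      then show ?thesis using adj_sym by (simp add: nb_def)
    qed
    then have "W \<subseteq> nb s X" using W(1) by (auto simp: nb_def)
    then have "r \<le> r - 1"
      using card_mono[OF finite_nb[OF fin_X]] W(2) card_nb_S1[OF edge(1)] by metis
    then show False using r6 by simp
  qed
  then obtain q' where q': "q' \<in> W" "q' \<notin> X1" "nb q' S1 = {}" by blast
  have S1_eq: "nb u X = W - {q'}" if u: "u \<in> S1" for u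
  proof (rule card_subset_eq)
    show "nb u X \<subseteq> W - {q'}" using S1_W[OF u] q'(3) u adj_sym by (auto simp: nb_def)
    show "deg u X = card (W - {q'})" using card_nb_S1[OF u] W(2) q'(1) finZ by simp
  qed (use finZ in auto)
  have Z2: "nb y X = W" if y: "y \<in> Z" "y \<notin> S1" "y \<noteq> q" for y
    using W(5)[OF edge(2) _ y(2)] X1_eq[OF edge(2)] y by blast
  have W2: "nb y S = Z" if y: "y \<in> W" "y \<notin> X1" "y \<noteq> q'" for y
    using Z(5)[OF edge(1) _ y(2)] S1_eq[OF edge(1)] y by blast
  have "card (insert q S1) < card Z"
    using Z(2) card_c_S half finite_nb[OF fin_S] by (simp add: card_insert_if)
  then obtain y where y: "y \<in> Z" "y \<notin> S1" "y \<noteq> q"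
    using ex_outside[of "insert q S1" Z] finite_nb[OF fin_S] by auto
  have "card (insert q' X1) < card W"
    using W(2) card_c_X half finite_nb[OF fin_X] by (simp add: card_insert_if)
  then obtain p where p: "p \<in> W" "p \<notin> X1" "p \<noteq> q'"
    using ex_outside[of "insert q' X1" W] finite_nb[OF fin_X] by auto
  \<comment> \<open>\<open>q'\<close> has \<open>r\<close> neighbours in \<open>S\<close>, none of
    them in \<open>S1\<close>, and only \<open>r / 2\<close> vertices of \<open>Z\<close> lie
    outside \<open>S1\<close>; so \<open>q'\<close> can be matched to some \<open>t\<close> outside
    \<open>Z\<close>.\<close>
  have "card (Z - S1) = r - r div 2"
    using Z(2,3) card_c_S finite_nb[OF fin_S] by (simp add: card_Diff_subset)
  moreover have "deg q' S = r" using card_nb_X2[of q'] q' W(1) by blast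
  ultimately have "card (Z - S1) < deg q' S" using half by simp
  then obtain t where t: "t \<in> nb q' S" "t \<notin> Z - S1" using ex_outside[of "Z - S1"] finZ by blast
  have tS: "t \<in> S" "q' \<sim> t" using t(1) by (auto simp: nb_def)
  then have "t \<notin> S1" using q'(3) by (auto simp: nb_def)
  then have tZ: "t \<notin> Z" using t(2) by blast
  have pq: "p \<sim> q" using W2[OF p] q(1) by (auto simp: nb_def)
  \<comment> \<open>All of \<open>W\<close> and all of \<open>Z\<close> except \<open>y\<close> get
    covered, and neither \<open>c\<close> nor \<open>y\<close> has a neighbour elsewhere.\<close>
  let ?A = "Z - {q, y}" and ?B = "W - {q', p}"
  have cA: "card ?A + 2 = card Z" by (rule card_Diff_pair[OF finZ(1) q(1) y(1) y(3)[symmetric]])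
  have cB: "card ?B + 2 = card W" by (rule card_Diff_pair[OF finZ(2) q'(1) p(1) p(3)[symmetric]])
  have "pm (?A \<union> ?B)"
  proof (rule complete_bipartite_pm)
    show "card ?A = card ?B" using cA cB Z(2) W(2) by simp
    show "?A \<inter> ?B = {}" using Z(1) W(1) dj by blast
    fix a b assume a: "a \<in> ?A" and b: "b \<in> ?B"
    show "a \<sim> b"
    proof (cases "a \<in> S1")
      case True
      then have "b \<in> nb a X" using S1_eq b by blast
      then show ?thesis by (simp add: nb_def)
    next
      case False
      then have "b \<in> nb a X" using Z2[of a] a b by blast
      then show ?thesis by (simp add: nb_def)
    qed
  qed (use finZ in auto)
  moreover have "pm ({p, q} \<union> {q', t})"
    by (intro pm_Un pm_pair pq tS(2)) (use p q q' tS tZ Z(1) W(1) dj in auto)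
  ultimately have P: "pm ((?A \<union> ?B) \<union> ({p, q} \<union> {q', t}))"
    by (rule pm_Un) (use p q q' y tS tZ Z(1) W(1) dj in auto)
  have eq: "(?A \<union> ?B) \<union> ({p, q} \<union> {q', t}) = (Z - {y}) \<union> W \<union> {t}" using p q q' y by auto
  have ycS: "y \<in> S" "y \<noteq> c" "y \<notin> X" "y \<noteq> t" using y Z(1) c_SX dj tZ by auto
  let ?P = "(Z - {y}) \<union> W \<union> {t}"
  show False
  proof (rule no_two_isolated[of ?P c y])
    show "?P \<subseteq> V" using Z(1) W(1) tS V_eq by blast
    show "pm ?P" using P eq by simp
    show "c \<in> V - ?P" using V_eq Z(1) W(1) c_SX tS by auto
    show "y \<in> V - ?P" using V_eq ycS W(1) by auto
    show "c \<noteq> y" using ycS by simp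
    have "S1 \<subseteq> ?P" "X1 \<subseteq> ?P" using Z(3) W(3) y(2) by auto
    then have "v \<in> ?P" if "c \<sim> v" for v using c_adj[OF that] by blast
    then show "nb c (V - ?P) = {}" by (auto simp: nb_def)
    have "v \<in> W" if "y \<sim> v" for v
      using S_adj[OF ycS(1) that] y(2) Z2[OF y] that by (auto simp: nb_def)
    then show "nb y (V - ?P) = {}" by (auto simp: nb_def)
  qed
qed

text \<open>Without edges between \<open>S1\<close> and \<open>X1\<close>, all of \<open>S1\<close>
  shares one set \<open>P\<close> of \<open>r - 1\<close> neighbours, completely joined to
  \<open>Z\<close>; likewise the neighbourhood \<open>P2\<close> of a vertex of \<open>X1\<close> is
  completely joined to \<open>W\<close>. Matching \<open>P\<close> with \<open>Z - {z}\<close> and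
  \<open>P2\<close> with \<open>W - {w}\<close> is balanced and leaves \<open>c\<close> and
  \<open>z\<close> to be isolated.\<close>

lemma hub_edge:
  assumes Z: "Z \<subseteq> S" "card Z = r" "S1 \<subseteq> Z"
      "\<And>u x. u \<in> S1 \<Longrightarrow> x \<in> nb u X \<Longrightarrow> x \<notin> X1 \<Longrightarrow> nb x S = Z"
    and W: "W \<subseteq> X" "card W = r" "X1 \<subseteq> W"
      "\<And>v y. v \<in> X1 \<Longrightarrow> y \<in> nb v S \<Longrightarrow> y \<notin> S1 \<Longrightarrow> nb y X = W"
  shows "\<exists>s\<in>S1. \<exists>x\<in>X1. s \<sim> x"
proof (rule ccontr)
  assume no: "\<not> ?thesis"
  have finZ: "finite Z" "finite W" using Z(1) W(1) fin_S fin_X finite_subset by auto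
  have "S1 \<noteq> {}" "X1 \<noteq> {}" using card_c_S card_c_X half by auto
  then obtain u v where u: "u \<in> S1" and v: "v \<in> X1" by blast
  define P where "P = nb u X"
  define P2 where "P2 = nb v S"
  have uS: "u \<in> S" "v \<in> X" using u v by (auto simp: nb_def)
  have PX: "P \<subseteq> X" "P2 \<subseteq> S" by (auto simp: P_def P2_def nb_def)
  have fP: "finite P" "finite P2" using finite_nb fin_S fin_X by (auto simp: P_def P2_def)
  have P_X1: "P \<inter> X1 = {}" using no u by (auto simp: P_def nb_def)
  have "p \<notin> S1" if "p \<in> P2" for p
  proof -
    have "p \<sim> v" using that adj_sym by (simp add: P2_def nb_def)
    then show ?thesis using no v by blast
  qed
  then have P2_S1: "P2 \<inter> S1 = {}" by blast
  have nbP: "nb p S = Z" if "p \<in> P" for p using Z(4)[OF u] that P_X1 by (auto simp: P_def)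
  have nbP2: "nb p X = W" if "p \<in> P2" for p using W(4)[OF v] that P2_S1 by (auto simp: P2_def)
  have cP: "card P = r - 1" "card P2 = r - 1"
    using card_nb_S1[OF u] card_nb_X1[OF v] by (auto simp: P_def P2_def)
  have S1_nb_eq: "nb s X = P" if s: "s \<in> S1" for s
  proof -
    have "P = nb s X"
    proof (rule card_subset_eq)
      show "finite (nb s X)" using finite_nb[OF fin_X] .
      show "P \<subseteq> nb s X"
      proof
        fix p assume p: "p \<in> P"
        then have "s \<in> nb p S" using nbP Z(3) s by blast
        then show "p \<in> nb s X" using p PX adj_sym by (auto simp: nb_def)
      qed
      show "card P = deg s X" using cP card_nb_S1[OF s] by simp
    qed
    then show ?thesis by simp
  qed
  \<comment> \<open>A common vertex would be adjacent to all of \<open>P2\<close> and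
    \<open>S1\<close>, which together have \<open>r - 1 + r / 2 > r\<close> vertices.\<close>
  have PW: "P \<inter> W = {}"
  proof (rule ccontr)
    assume "P \<inter> W \<noteq> {}"
    then obtain p where p: "p \<in> P" "p \<in> W" by blast
    have "P2 \<union> S1 \<subseteq> Z"
    proof
      fix y assume "y \<in> P2 \<union> S1"
      then show "y \<in> Z"
      proof
        assume y: "y \<in> P2"
        then have "p \<in> nb y X" using nbP2 p by blast
        then have "y \<in> nb p S" using y PX adj_sym by (auto simp: nb_def)
        then show ?thesis using nbP[OF p(1)] by simp
      qed (use Z(3) in blast)
    qed
    then have "card (P2 \<union> S1) \<le> r" using card_mono[OF finZ(1)] Z(2) by metis
    moreover have "card (P2 \<union> S1) = card P2 + card S1"
      using fP P2_S1 finite_nb[OF fin_S] by (intro card_Un_disjoint)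
    ultimately show False using cP card_c_S half by simp
  qed
  have P2Z: "P2 \<inter> Z = {}"
  proof (rule ccontr)
    assume "P2 \<inter> Z \<noteq> {}"
    then obtain y where y: "y \<in> P2" "y \<in> Z" by blast
    obtain p where p: "p \<in> P" using cP r6 by fastforce
    have "y \<in> nb p S" using nbP[OF p] y by simp
    then have "p \<in> nb y X" using p PX adj_sym by (auto simp: nb_def)
    then show False using nbP2[OF y(1)] p PW by blast
  qed
  have "card S1 < card Z" using Z(2) card_c_S half by simp
  then obtain z where z: "z \<in> Z" "z \<notin> S1" using ex_outside finite_nb[OF fin_S] by blast
  have zS: "z \<in> S" "z \<notin> P2" using z Z(1) P2Z by auto
  have Pz: "P \<subseteq> nb z X"
  proof
    fix p assume p: "p \<in> P"
    then have "z \<in> nb p S" using nbP z(1) by simp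
    then show "p \<in> nb z X" using p PX adj_sym by (auto simp: nb_def)
  qed
  \<comment> \<open>The one neighbour \<open>o'\<close> of \<open>z\<close> outside \<open>P\<close>
    must be covered too: if it lies in \<open>W\<close>, by choosing \<open>w\<close> different from
    it, and otherwise by an additional edge.\<close>
  have "card (nb z X - P) = 1"
    using card_nb_S2[OF zS(1) z(2)] cP fP Pz r6 by (simp add: card_Diff_subset)
  then obtain o' where "nb z X - P = {o'}" by (rule card_1_singletonE)
  then have o': "nb z X = insert o' P" "o' \<in> X" "o' \<notin> P" "z \<sim> o'" using Pz by (auto simp: nb_def)
  have "card (insert o' X1) < card W"
    using W(2) card_c_X half finite_nb[OF fin_X] by (simp add: card_insert_if)
  then obtain w where w: "w \<in> W" "w \<notin> X1" "w \<noteq> o'"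
    using ex_outside[of "insert o' X1" W] finite_nb[OF fin_X] by auto
  have "pm ((Z - {z}) \<union> P)"
  proof (rule complete_bipartite_pm)
    show "card (Z - {z}) = card P" using Z(2) z finZ cP by simp
    show "(Z - {z}) \<inter> P = {}" using Z(1) PX dj by blast
    show "a \<sim> b" if "a \<in> Z - {z}" "b \<in> P" for a b
    proof -
      have "a \<in> nb b S" using nbP[OF that(2)] that(1) by blast
      then show ?thesis using adj_sym by (simp add: nb_def)
    qed
  qed (use finZ fP in auto)
  moreover have "pm (P2 \<union> (W - {w}))"
  proof (rule complete_bipartite_pm)
    show "card P2 = card (W - {w})" using W(2) w finZ cP by simp
    show "P2 \<inter> (W - {w}) = {}" using W(1) PX dj by blast
    show "a \<sim> b" if "a \<in> P2" "b \<in> W - {w}" for a b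
    proof -
      have "b \<in> nb a X" using nbP2[OF that(1)] that(2) by blast
      then show ?thesis by (simp add: nb_def)
    qed
  qed (use finZ fP in auto)
  ultimately have Q0: "pm (((Z - {z}) \<union> P) \<union> (P2 \<union> (W - {w})))"
    by (rule pm_Un) (use Z(1) W(1) PX dj PW P2Z in blast)
  let ?Q = "((Z - {z}) \<union> P) \<union> (P2 \<union> (W - {w}))"
  have QV: "?Q \<subseteq> S \<union> X" using Z(1) W(1) PX by blast
  have zQ: "z \<notin> ?Q" using z zS PX W(1) dj by blast
  have "\<exists>R. pm (?Q \<union> R) \<and> R \<subseteq> S \<union> X \<and> z \<notin> R \<and> o' \<in> ?Q \<union> R"
  proof (cases "o' \<in> W")
    case True
    then have "o' \<in> ?Q" using w by blast
    then show ?thesis using Q0 by (intro exI[of _ "{}"]) simp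
  next
    case False
    then have o'X1: "o' \<notin> X1" using W(3) by blast
    have "card (Z - S1) = r - r div 2"
      using Z(2,3) card_c_S finite_nb[OF fin_S] by (simp add: card_Diff_subset)
    then have "card (Z - S1) < deg o' S" using card_nb_X2[OF o'(2) o'X1] half by simp
    then obtain t where t: "t \<in> nb o' S" "t \<notin> Z - S1" using ex_outside[of "Z - S1"] finZ by blast
    have tS: "t \<in> S" "o' \<sim> t" "t \<sim> o'" using t(1) adj_sym by (auto simp: nb_def)
    have "t \<notin> S1"
    proof
      assume "t \<in> S1"
      then have "o' \<in> P" using S1_nb_eq[of t] tS o'(2) by (auto simp: nb_def)
      then show False using o' by simp
    qed
    then have tZ: "t \<notin> Z" using t(2) by blast
    have tP2: "t \<notin> P2"
    proof
      assume "t \<in> P2"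
      then have "o' \<in> W" using nbP2[of t] tS o'(2) by (auto simp: nb_def)
      then show False using False by simp
    qed
    have "pm (?Q \<union> {o', t})"
      by (rule pm_Un[OF Q0 pm_pair[OF tS(2)]]) (use o' tS tZ tP2 False Z(1) W(1) PX dj in auto)
    moreover have "z \<noteq> o'" using o'(2) zS dj by blast
    ultimately show ?thesis using tS o' tZ z by (intro exI[of _ "{o', t}"]) auto
  qed
  then obtain R where R: "pm (?Q \<union> R)" "R \<subseteq> S \<union> X" "z \<notin> R" "o' \<in> ?Q \<union> R" by blast
  show False
  proof (rule no_two_isolated[OF _ R(1), of c z])
    show "?Q \<union> R \<subseteq> V" using QV R(2) V_eq by blast
    show "c \<in> V - (?Q \<union> R)" using QV R(2) V_eq c_SX by blast
    show "z \<in> V - (?Q \<union> R)" using zQ R(3) V_eq zS by blast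
    show "c \<noteq> z" using zS c_SX by blast
    have "S1 \<union> X1 \<subseteq> ?Q" using Z(3) W(3) z(2) w(2) by blast
    then have "v \<in> ?Q \<union> R" if "c \<sim> v" for v using c_adj[OF that] by blast
    then show "nb c (V - (?Q \<union> R)) = {}" by (auto simp: nb_def)
    have "v \<in> ?Q \<union> R" if "z \<sim> v" for v
    proof -
      have "v \<in> X" using S_adj[OF zS(1) that] z(2) by blast
      then have "v \<in> insert o' P" using o'(1) that by (auto simp: nb_def)
      then show ?thesis using R(4) by blast
    qed
    then show "nb z (V - (?Q \<union> R)) = {}" by (auto simp: nb_def)
  qed
qed

text \<open>Vertices of \<open>Z\<close> and \<open>W\<close> have no neighbours outside
  \<open>Z\<close>, \<open>W\<close> and \<open>c\<close>, so connectedness identifies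
  \<open>Z\<close> with the side \<open>S\<close>.\<close>

theorem card_S: "card S = r"
proof -
  obtain Z where Z: "Z \<subseteq> S" "card Z = r" "S1 \<subseteq> Z" "\<And>u x. u \<in> S1 \<Longrightarrow> x \<in> nb u X \<Longrightarrow> nb x S \<subseteq> Z"
    "\<And>u x. u \<in> S1 \<Longrightarrow> x \<in> nb u X \<Longrightarrow> x \<notin> X1 \<Longrightarrow> nb x S = Z"
    using hub by blast
  obtain W where W: "W \<subseteq> X" "card W = r" "X1 \<subseteq> W" "\<And>v y. v \<in> X1 \<Longrightarrow> y \<in> nb v S \<Longrightarrow> nb y X \<subseteq> W"
    "\<And>v y. v \<in> X1 \<Longrightarrow> y \<in> nb v S \<Longrightarrow> y \<notin> S1 \<Longrightarrow> nb y X = W"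
    using balanced.hub[OF swapped] by blast
  have "\<exists>s\<in>S1. \<exists>x\<in>X1. s \<sim> x" by (rule hub_edge[of Z W]) fact+
  then obtain s x where e: "s \<in> S1" "x \<in> X1" "s \<sim> x" by blast
  have noZ: "nb q X1 \<noteq> {}" if "q \<in> Z" "q \<notin> S1" for q
  proof
    assume "nb q X1 = {}"
    show False by (rule hub_closed_or_gap[of Z W s x q]) fact+
  qed
  have e': "x \<sim> s" using e(3) by (rule adj_sym)
  have noW: "nb q S1 \<noteq> {}" if "q \<in> W" "q \<notin> X1" for q
  proof
    assume "nb q S1 = {}"
    show False by (rule balanced.hub_closed_or_gap[OF swapped, of W Z x s q]) fact+
  qed
  have S1_W: "nb u X \<subseteq> W" if "u \<in> S1" for u
    by (rule hub_nb[of Z W s x u]) fact+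
  have X1_Z: "nb v S \<subseteq> Z" if "v \<in> X1" for v
    by (rule balanced.hub_nb[OF swapped, of W Z x s v]) fact+
  have Z_W: "nb z X \<subseteq> W" if z: "z \<in> Z" for z
  proof (cases "z \<in> S1")
    case False
    then obtain v where "v \<in> X1" "z \<sim> v" using noZ[OF z] by (auto simp: nb_def)
    then have "z \<in> nb v S" using z Z(1) adj_sym by (auto simp: nb_def)
    then show ?thesis using W(4)[OF \<open>v \<in> X1\<close>] by blast
  qed (rule S1_W)
  have W_Z: "nb w S \<subseteq> Z" if w: "w \<in> W" for w
  proof (cases "w \<in> X1")
    case False
    then obtain u where "u \<in> S1" "w \<sim> u" using noW[OF w] by (auto simp: nb_def)
    then have "w \<in> nb u X" using w W(1) adj_sym by (auto simp: nb_def)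
    then show ?thesis using Z(4)[OF \<open>u \<in> S1\<close>] by blast
  qed (rule X1_Z)
  have "insert c (Z \<union> W) = V"
  proof (rule conn)
    show "insert c (Z \<union> W) \<subseteq> V" using Z(1) W(1) V_eq by blast
    fix u v assume u: "u \<in> insert c (Z \<union> W)" and uv: "u \<sim> v"
    consider "u = c" | "u \<in> Z" | "u \<in> W" using u by blast
    then show "v \<in> insert c (Z \<union> W)"
    proof cases
      case 1
      then show ?thesis using c_adj uv Z(3) W(3) by blast
    next
      case 2
      then show ?thesis using S_adj[of u v] uv Z(1) Z_W[OF 2] by (auto simp: nb_def)
    next
      case 3
      then show ?thesis using X_adj[of u v] uv W(1) W_Z[OF 3] by (auto simp: nb_def)
    qed
  qed auto
  then have "S \<subseteq> insert c (Z \<union> W)" using V_eq by auto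
  then have "S \<subseteq> Z" using c_SX W(1) dj by blast
  then have "Z = S" using Z(1) by blast
  then show ?thesis using Z(2) by simp
qed

text \<open>With \<open>r\<close> vertices on either side, a vertex of \<open>S1\<close> has exactly
  one non-neighbour in \<open>X\<close>. That one therefore lies in \<open>X1\<close>, and since it
  has only one non-neighbour in \<open>S\<close>, the assignment is injective.\<close>

theorem almost_complete:
  "\<exists>m. bij_betw m S1 X1 \<and> (\<forall>s\<in>S. \<forall>x\<in>X. s \<sim> x \<longleftrightarrow> \<not> (s \<in> S1 \<and> x = m s))"
proof -
  have card_X: "card X = r" using card_S card_SX by simp
  have full_S: "nb s X = X" if "s \<in> S" "s \<notin> S1" for s
    using card_nb_S2[OF that] card_X fin_X by (intro card_subset_eq) (auto simp: nb_def)
  have full_X: "nb x S = S" if "x \<in> X" "x \<notin> X1" for x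
    using card_nb_X2[OF that] card_S fin_S by (intro card_subset_eq) (auto simp: nb_def)
  have "\<exists>x. X - nb s X = {x}" if s: "s \<in> S1" for s
  proof -
    have "card (X - nb s X) = 1"
      using card_nb_S1[OF s] card_X r6 finite_nb[OF fin_X] by (simp add: card_Diff_subset nb_subset)
    then show ?thesis by (meson card_1_singletonE)
  qed
  then obtain m where m: "\<And>s. s \<in> S1 \<Longrightarrow> X - nb s X = {m s}" by metis
  have m_not: "m s \<in> X" "\<not> s \<sim> m s" if "s \<in> S1" for s using m[OF that] by (auto simp: nb_def)
  have mX1: "m s \<in> X1" if s: "s \<in> S1" for s
  proof (rule ccontr)
    assume "m s \<notin> X1"
    then have "s \<in> nb (m s) S" using full_X[OF m_not(1)[OF s]] s by (auto simp: nb_def)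
    then show False using m_not(2)[OF s] adj_sym by (auto simp: nb_def)
  qed
  have inj: "inj_on m S1"
  proof (rule inj_onI)
    fix s t assume st: "s \<in> S1" "t \<in> S1" "m s = m t"
    show "s = t"
    proof (rule ccontr)
      assume "s \<noteq> t"
      have stS: "s \<in> S" "t \<in> S" using st by (auto simp: nb_def)
      have "nb (m s) S \<subseteq> S - {s, t}"
        using m_not(2)[OF st(1)] m_not(2)[OF st(2)] st(3) adj_sym by (auto simp: nb_def)
      then have "deg (m s) S \<le> card (S - {s, t})" using fin_S by (intro card_mono) auto
      moreover have "card (S - {s, t}) + 2 = card S"
        using fin_S stS \<open>s \<noteq> t\<close> by (intro card_Diff_pair)
      ultimately show False using card_nb_X1[OF mX1[OF st(1)]] card_S r6 by simp
    qed
  qed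
  have "m ` S1 = X1"
  proof (rule card_subset_eq)
    show "card (m ` S1) = card X1" using card_image[OF inj] card_c_S card_c_X by simp
  qed (use mX1 finite_nb[OF fin_X] in auto)
  moreover have "s \<sim> x \<longleftrightarrow> \<not> (s \<in> S1 \<and> x = m s)" if "s \<in> S" "x \<in> X" for s x
  proof (cases "s \<in> S1")
    case True
    then have "x \<in> nb s X \<longleftrightarrow> x \<noteq> m s" using m[OF True] that(2) by blast
    then show ?thesis using True that(2) by (simp add: nb_def)
  next
    case False
    then show ?thesis using full_S[OF that(1) False] that(2) by (auto simp: nb_def)
  qed
  ultimately show ?thesis using inj by (auto simp: bij_betw_def)
qed

end

section \<open>The isomorphism\<close>

text \<open>Singletons use exactly \<open>r\<close> edges each, so \<open>e_total_star\<close> turns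
  the surplus into \<open>2 * deg c S = r\<close>.\<close>

lemma (in star_setting) balanced: "balanced adj V r S (V - T) c"
proof
  let ?X = "V - T"
  have single: "{x} \<in> \<K>" if x: "x \<in> ?X" for x
  proof -
    obtain K where K: "K \<in> \<K>" "x \<in> K" using x Union_\<K> by blast
    then show ?thesis using all_single[OF K(1)] by (metis card_1_singletonE singletonD)
  qed
  have "bij_betw (\<lambda>x. {x}) ?X \<K>"
    unfolding bij_betw_def
  proof
    show "(\<lambda>x. {x}) ` ?X = \<K>"
    proof (intro subset_antisym subsetI)
      fix K assume K: "K \<in> \<K>"
      then obtain x where "K = {x}" using all_single by (meson card_1_singletonE)
      then show "K \<in> (\<lambda>x. {x}) ` ?X" using K_sub[OF K] by blast
    qed (use single in auto)
  qed simp
  then show card_SX: "card S = card ?X" using card_\<K> bij_betw_same_card by metis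
  show V: "V = insert c (S \<union> ?X)" using T_eq T_V by blast
  show "c \<notin> S" by (rule c_S)
  show "c \<notin> ?X" using T_eq by blast
  show "S \<inter> ?X = {}" using S_T by blast
  show "indep S" by (rule S_indep)
  show "indep ?X"
    unfolding indep_def
  proof (intro ballI notI)
    fix x y assume xy: "x \<in> ?X" "y \<in> ?X" "x \<sim> y"
    then have "y \<in> {x}" using nocross[OF single[OF xy(1)], of x y] by blast
    then show False using xy(3) adj_irrefl by simp
  qed
  have "(\<Sum>K\<in>\<K>. e K) = r * card \<K>" using e_single all_single by simp
  then have c2: "2 * deg c S = r" using e_total_star by simp
  then show "deg c S = r div 2" by simp
  have "nb c V = nb c (S \<union> ?X)" using T_eq S_V adj_irrefl by (auto simp: nb_def)
  moreover have "deg c (S \<union> ?X) = deg c S + deg c ?X"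
    using fin fin_S S_T by (intro card_nb_Un) auto
  ultimately show "deg c ?X = r div 2" using reg[OF c_V] c2 by simp
qed

theorem (in regular_equimatchable) ex_balanced:
  assumes "I \<subseteq> V" "indep I" "3 \<le> card I"
  shows "\<exists>S X c. balanced adj V r S X c"
proof -
  define F where "F = {I. I \<subseteq> V \<and> indep I}"
  have F: "finite F" "I \<in> F" using assms fin by (auto simp: F_def)
  then have "Max (card ` F) \<in> card ` F" by (intro Max_in) auto
  then obtain S where S: "S \<in> F" "card S = Max (card ` F)" by auto
  have max: "card J \<le> card S" if "J \<subseteq> V" "indep J" for J
    using that F(1) by (simp add: S(2) F_def)
  have S_V: "S \<subseteq> V" "indep S" using S(1) by (auto simp: F_def)
  have S3: "3 \<le> card S" using max[OF assms(1,2)] assms(3) by simp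
  then have "S \<noteq> {}" by auto
  then obtain T \<K> where T: "barrier V T \<K>" "S \<subseteq> T" "card T = card \<K> + 1" "card T \<le> card S + 1"
    using max_independent_barrier[OF S_V _ max] by blast
  interpret barrier_setting adj V r S T \<K>
    by unfold_locales (use T S_V max S3 in auto)
  have "T \<noteq> S" using indep_T_contradiction S_V(2) by blast
  then obtain c where c: "c \<in> T" "c \<notin> S" using T(2) by blast
  have "insert c S = T"
    using c T(2,4) fin_T fin_S by (intro card_seteq) auto
  then interpret star_setting adj V r S T \<K> c
    using c(2) by unfold_locales auto
  show ?thesis using balanced by blast
qed

section \<open>Explicit adjacency in the target graph\<close>

lemma F_graph_verts: "verts (F_graph r) = insert Apex (LeftV ` {..<r} \<union> RightV ` {..<r})"
  by (simp add: F_graph_def replace_matching_def complete_bipartite_def)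

lemma F_graph_edges:
  "d \<in> edges (F_graph r) \<longleftrightarrow>
    (\<exists>i j. d = {LeftV i, RightV j} \<and> i < r \<and> j < r \<and> \<not> (i = j \<and> i < r div 2)) \<or>
    (\<exists>i<r div 2. d = {Apex, LeftV i} \<or> d = {Apex, RightV i})"
proof -
  have "F_matching r = (\<lambda>i. {LeftV i, RightV i}) ` {..<r div 2}" by (auto simp: F_matching_def)
  then have Un: "\<Union>(F_matching r) = LeftV ` {..<r div 2} \<union> RightV ` {..<r div 2}" by auto
  have M: "{LeftV i, RightV j} \<in> F_matching r \<longleftrightarrow> i = j \<and> i < r div 2" for i j
    by (auto simp: F_matching_def doubleton_eq_iff)
  have "d \<in> edges (complete_bipartite r) - F_matching r \<longleftrightarrow>
      (\<exists>i j. d = {LeftV i, RightV j} \<and> i < r \<and> j < r \<and> d \<notin> F_matching r)"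
    by (auto simp: complete_bipartite_def)
  also have "\<dots> \<longleftrightarrow> (\<exists>i j. d = {LeftV i, RightV j} \<and> i < r \<and> j < r \<and> \<not> (i = j \<and> i < r div 2))"
    using M by (intro ex_cong1) metis
  finally have "d \<in> edges (complete_bipartite r) - F_matching r \<longleftrightarrow>
      (\<exists>i j. d = {LeftV i, RightV j} \<and> i < r \<and> j < r \<and> \<not> (i = j \<and> i < r div 2))" .
  moreover have "d \<in> {{Apex, x} | x. x \<in> \<Union>(F_matching r)} \<longleftrightarrow>
      (\<exists>i<r div 2. d = {Apex, LeftV i} \<or> d = {Apex, RightV i})"
    unfolding Un by blast
  ultimately show ?thesis unfolding F_graph_def replace_matching_def by simp
qed

lemma F_graph_adj:
  "{LeftV i, RightV j} \<in> edges (F_graph r) \<longleftrightarrow> i < r \<and> j < r \<and> \<not> (i = j \<and> i < r div 2)"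
  "{RightV j, LeftV i} \<in> edges (F_graph r) \<longleftrightarrow> i < r \<and> j < r \<and> \<not> (i = j \<and> i < r div 2)"
  "{Apex, LeftV i} \<in> edges (F_graph r) \<longleftrightarrow> i < r div 2"
  "{LeftV i, Apex} \<in> edges (F_graph r) \<longleftrightarrow> i < r div 2"
  "{Apex, RightV i} \<in> edges (F_graph r) \<longleftrightarrow> i < r div 2"
  "{RightV i, Apex} \<in> edges (F_graph r) \<longleftrightarrow> i < r div 2"
  "{LeftV i, LeftV j} \<notin> edges (F_graph r)"
  "{RightV i, RightV j} \<notin> edges (F_graph r)"
  "{Apex} \<notin> edges (F_graph r)"
  by (simp_all add: F_graph_edges doubleton_eq_iff)

text \<open>
  The matching \<open>m\<close> of the non-adjacent pairs becomes the diagonal of the first \<open>r div 2\<close>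
  indices.
\<close>

lemma (in balanced) isomorphic_F_graph:
  "\<exists>f. bij_betw f V (verts (F_graph r)) \<and>
    (\<forall>u\<in>V. \<forall>v\<in>V. u \<sim> v \<longleftrightarrow> {f u, f v} \<in> edges (F_graph r))"
proof -
  obtain m where m: "bij_betw m S1 X1" "\<And>s x. s \<in> S \<Longrightarrow> x \<in> X \<Longrightarrow> s \<sim> x \<longleftrightarrow> \<not> (s \<in> S1 \<and> x = m s)"
    using almost_complete by blast
  have sub: "S1 \<subseteq> S" "X1 \<subseteq> X" by (rule nb_subset)+
  have fin1: "finite S1" "finite X1" using finite_nb fin_S fin_X by auto
  have card_X: "card X = r" using card_S card_SX by simp
  obtain g1 where g1: "bij_betw g1 S1 {..<r div 2}"
    using finite_same_card_bij[OF fin1(1), of "{..<r div 2}"] card_c_S by auto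
  have "card (S - S1) = card {r div 2..<r}" "card (X - X1) = card {r div 2..<r}"
    using card_S card_X card_c_S card_c_X sub fin1 by (simp_all add: card_Diff_subset)
  then obtain g2 h2 where g2: "bij_betw g2 (S - S1) {r div 2..<r}" and h2:
    "bij_betw h2 (X - X1) {r div 2..<r}"
    using finite_same_card_bij fin_S fin_X by (metis finite_Diff finite_atLeastLessThan)
  define h1 where "h1 = g1 \<circ> the_inv_into S1 m"
  have h1: "bij_betw h1 X1 {..<r div 2}"
    unfolding h1_def using bij_betw_the_inv_into[OF m(1)] g1 by (rule bij_betw_trans)
  have h1m: "h1 (m s) = g1 s" if "s \<in> S1" for s
    using that m(1) by (simp add: h1_def the_inv_into_f_f bij_betw_def)
  define g where "g s = (if s \<in> S1 then g1 s else g2 s)" for s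
  define h where "h x = (if x \<in> X1 then h1 x else h2 x)" for x
  have un: "{..<r div 2} \<union> {r div 2..<r} = {..<r}" by auto
  have "bij_betw g (S1 \<union> (S - S1)) ({..<r div 2} \<union> {r div 2..<r})"
    unfolding g_def using g1 g2 by (intro bij_betw_disjoint_Un) auto
  moreover have "S1 \<union> (S - S1) = S" using sub by blast
  ultimately have g: "bij_betw g S {..<r}" by (simp only: un)
  have "bij_betw h (X1 \<union> (X - X1)) ({..<r div 2} \<union> {r div 2..<r})"
    unfolding h_def using h1 h2 by (intro bij_betw_disjoint_Un) auto
  moreover have "X1 \<union> (X - X1) = X" using sub by blast
  ultimately have h: "bij_betw h X {..<r}" by (simp only: un)
  have gS1: "g s < r div 2 \<longleftrightarrow> s \<in> S1" if "s \<in> S" for s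
    using bspec[OF bij_betwE[OF g1], of s] bspec[OF bij_betwE[OF g2], of s] that
      by (auto simp: g_def)
  have hX1: "h x < r div 2 \<longleftrightarrow> x \<in> X1" if "x \<in> X" for x
    using bspec[OF bij_betwE[OF h1], of x] bspec[OF bij_betwE[OF h2], of x] that
      by (auto simp: h_def)
  have gr: "g s < r" if "s \<in> S" for s using bij_betwE[OF g] that by blast
  have hr: "h x < r" if "x \<in> X" for x using bij_betwE[OF h] that by blast
  have SX: "s \<sim> x \<longleftrightarrow> \<not> (g s = h x \<and> g s < r div 2)" if s: "s \<in> S" and x: "x \<in> X" for s x
  proof (cases "s \<in> S1")
    case True
    have mX: "m s \<in> X1" using bij_betwE[OF m(1)] True by blast
    have "h (m s) = g s" using h1m[OF True] mX True by (simp add: h_def g_def)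
    moreover have "inj_on h X" using h by (simp add: bij_betw_def)
    ultimately have "x = m s \<longleftrightarrow> g s = h x" using x mX sub(2) by (metis inj_onD subsetD)
    then show ?thesis using m(2)[OF s x] gS1[OF s] True by blast
  next
    case False
    then show ?thesis using m(2)[OF s x] gS1[OF s] by blast
  qed
  define f where "f v = (if v = c then Apex else if v \<in> S then LeftV (g v) else RightV (h v))" for v
  have fc: "f c = Apex" and fS: "\<And>s. s \<in> S \<Longrightarrow> f s = LeftV (g s)"
    and fX: "\<And>x. x \<in> X \<Longrightarrow> f x = RightV (h x)"
    using c_SX dj by (auto simp: f_def)
  have "inj_on f V"
  proof (rule inj_onI)
    fix u v assume uv: "u \<in> V" "v \<in> V" "f u = f v"
    have "inj_on g S" "inj_on h X" using g h by (auto simp: bij_betw_def)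
    then show "u = v" using uv V_eq fc fS fX by (auto dest: inj_onD)
  qed
  moreover have "f ` V = verts (F_graph r)"
  proof -
    have "f ` V = insert (f c) (f ` S \<union> f ` X)" using V_eq by blast
    moreover have "f ` S = LeftV ` g ` S" unfolding image_image using fS by (intro image_cong) auto
    moreover have "f ` X = RightV ` h ` X" unfolding image_image using fX by (intro image_cong) auto
    ultimately show ?thesis using g h fc by (simp add: F_graph_verts bij_betw_def)
  qed
  ultimately have "bij_betw f V (verts (F_graph r))" by (simp add: bij_betw_def)
  moreover have "u \<sim> v \<longleftrightarrow> {f u, f v} \<in> edges (F_graph r)" if uv: "u \<in> V" "v \<in> V" for u v
  proof -
    have cS: "c \<sim> s \<longleftrightarrow> s \<in> S1" if "s \<in> S" for s using that by (simp add: nb_def)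
    have cX: "c \<sim> x \<longleftrightarrow> x \<in> X1" if "x \<in> X" for x using that by (simp add: nb_def)
    consider "u = c" "v = c" | "u = c" "v \<in> S" | "u = c" "v \<in> X" | "u \<in> S" "v = c" | "u \<in> S" "v \<in> S"
      | "u \<in> S" "v \<in> X" | "u \<in> X" "v = c" | "u \<in> X" "v \<in> S" | "u \<in> X" "v \<in> X"
      using uv V_eq by blast
    then show ?thesis
    proof cases
      case 1
      then show ?thesis using fc adj_irrefl by (simp add: F_graph_adj)
    next
      case 2
      then show ?thesis using fc fS cS gS1 by (simp add: F_graph_adj)
    next
      case 3
      then show ?thesis using fc fX cX hX1 by (simp add: F_graph_adj)
    next
      case 4
      then show ?thesis using fc fS cS gS1 adj_commute[of u c] by (simp add: F_graph_adj)
    next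
      case 5
      then show ?thesis using fS indep_S by (simp add: F_graph_adj indep_def)
    next
      case 6
      then show ?thesis using fS fX SX gr hr by (simp add: F_graph_adj)
    next
      case 7
      then show ?thesis using fc fX cX hX1 adj_commute[of u c] by (simp add: F_graph_adj)
    next
      case 8
      then show ?thesis using fS fX SX gr hr adj_commute[of u v] by (simp add: F_graph_adj)
    next
      case 9
      then show ?thesis using fX indep_X by (simp add: F_graph_adj indep_def)
    qed
  qed
  ultimately show ?thesis by blast
qed

section \<open>Transfer between covered vertex sets and matchings as sets of edges\<close>

lemma (in sgraph) pm_imp_matching:
  assumes adj: "\<And>u v. u \<sim> v \<longleftrightarrow> {u, v} \<in> edges G"
  shows "pm U \<Longrightarrow> \<exists>M. matching G M \<and> \<Union>M = U \<and> finite M \<and> 2 * card M = card U"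
proof (induction rule: pm.induct)
  case pm_empty
  then show ?case by (intro exI[of _ "{}"]) (auto simp: matching_def)
next
  case (pm_insert W u v)
  then obtain M where M: "matching G M" "\<Union>M = W" "finite M" "2 * card M = card W" by blast
  let ?M = "insert {u, v} M"
  have new: "{u, v} \<notin> M" using M(2) pm_insert.hyps by blast
  have "{u, v} \<in> edges G" using adj pm_insert.hyps by blast
  moreover have "{u, v} \<inter> e = {}" if "e \<in> M" for e using that M(2) pm_insert.hyps by blast
  ultimately have "matching G ?M" using M(1) by (auto simp: matching_def)
  moreover have "\<Union>?M = insert u (insert v W)" using M(2) by auto
  moreover have "card (insert u (insert v W)) = card W + 2"
    using pm_insert.hyps pm_finite adj_neq[of u v] by simp
  ultimately show ?case using M new by (intro exI[of _ ?M]) simp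
qed

text \<open>An edge that extends \<open>M\<close> avoids \<open>U\<close> and contradicts the
  independence of the uncovered vertices. This makes \<open>equimatchable\<close> applicable to
  covered sets.\<close>

lemma (in sgraph) maximal_matching_of_pm:
  assumes adj: "\<And>u v. u \<sim> v \<longleftrightarrow> {u, v} \<in> edges G" and G: "simple_graph G"
    and U: "pm U" "indep (verts G - U)"
  shows "\<exists>M. maximal_matching G M \<and> 2 * card M = card U"
proof -
  obtain M where M: "matching G M" "\<Union>M = U" "2 * card M = card U"
    using pm_imp_matching[OF adj U(1)] by blast
  have "\<not> (matching G N \<and> M \<subset> N)" for N
  proof
    assume N: "matching G N \<and> M \<subset> N"
    then obtain d where d: "d \<in> N" "d \<notin> M" by blast
    then have "d \<in> edges G" using N by (auto simp: matching_def)
    then have "d \<subseteq> verts G" "card d = 2" using G by (auto simp: simple_graph_def)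
    then obtain a b where ab: "d = {a, b}" by (meson card_2_iff)
    have "d \<inter> m = {}" if "m \<in> M" for m
    proof -
      have "m \<in> N" "d \<noteq> m" using that N d by auto
      then show ?thesis using N d(1) by (simp add: matching_def)
    qed
    then have "d \<inter> U = {}" using M(2) by blast
    then have "a \<in> verts G - U" "b \<in> verts G - U" using ab \<open>d \<subseteq> verts G\<close> by auto
    moreover have "a \<sim> b" using adj ab \<open>d \<in> edges G\<close> by simp
    ultimately show False using U(2) by (auto simp: indep_def)
  qed
  then show ?thesis using M by (auto simp: maximal_matching_def)
qed

theorem theorem1p9:
  fixes G :: "'a graph" and r :: nat
  assumes "even r" and "r \<ge> 6"
    and "simple_graph G"
    and "connected_graph G"
    and "equimatchable G"
    and "regular_graph r G"
    and "odd (card (verts G))"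
    and "independence_number G \<ge> 3"
  shows "graph_isomorphic G (F_graph r)"
proof -
  define adj where "adj = (\<lambda>u v. {u, v} \<in> edges G)"
  have adj: "adj u v \<longleftrightarrow> {u, v} \<in> edges G" for u v by (simp add: adj_def)
  have edge: "d \<subseteq> verts G" "card d = 2" if "d \<in> edges G" for d
    using assms(3) that by (auto simp: simple_graph_def)
  interpret sgraph adj
  proof
    show "adj v u" if "adj u v" for u v using that by (simp add: adj insert_commute)
    show "\<not> adj u u" for u using edge(2)[of "{u, u}"] by (auto simp: adj)
  qed
  have fin: "finite (verts G)" using assms(3) by (simp add: simple_graph_def)
  interpret regular_equimatchable adj "verts G" r
  proof
    show "finite (verts G)" by fact
    show "u \<in> verts G" if "adj u v" for u v using edge(1)[of "{u, v}"] that by (simp add: adj)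
    show "deg v (verts G) = r" if v: "v \<in> verts G" for v
    proof -
      have "bij_betw (\<lambda>u. {v, u}) (nb v (verts G)) {d \<in> edges G. v \<in> d}"
        unfolding bij_betw_def
      proof
        show "inj_on (\<lambda>u. {v, u}) (nb v (verts G))" by (auto simp: inj_on_def doubleton_eq_iff)
        show "(\<lambda>u. {v, u}) ` nb v (verts G) = {d \<in> edges G. v \<in> d}"
        proof (intro subset_antisym subsetI)
          fix d assume "d \<in> {d \<in> edges G. v \<in> d}"
          then have d: "d \<in> edges G" "v \<in> d" by auto
          then obtain a b where "d = {a, b}" using edge(2) by (meson card_2_iff)
          then obtain u where u: "d = {v, u}" using d(2) by auto
          then have "u \<in> nb v (verts G)" using d(1) edge(1)[OF d(1)] by (simp add: nb_def adj)
          then show "d \<in> (\<lambda>u. {v, u}) ` nb v (verts G)" using u by blast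
        qed (auto simp: nb_def adj)
      qed
      then have "deg v (verts G) = degree G v" by (simp add: degree_def bij_betw_same_card)
      then show ?thesis using assms(6) v by (simp add: regular_graph_def)
    qed
    show "C = verts G" if C: "C \<subseteq> verts G" "C \<noteq> {}" "\<And>u v. u \<in> C \<Longrightarrow> adj u v \<Longrightarrow> v \<in> C" for C
    proof -
      obtain u where u: "u \<in> C" using C(2) by blast
      have "v \<in> C" if "v \<in> verts G" for v
      proof -
        have "(u, v) \<in> (adjacency G)\<^sup>*"
          using assms(4) u C(1) that by (auto simp: connected_graph_def)
        then show ?thesis
          by (induction rule: rtrancl_induct) (use u C(3) in \<open>auto simp: adjacency_def adj\<close>)
      qed
      then show ?thesis using C(1) by blast
    qed
    show "card U = card U'"
      if U: "pm U" "indep (verts G - U)" and U': "pm U'" "indep (verts G - U')" for U U'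
    proof -
      obtain M where M: "maximal_matching G M" "2 * card M = card U"
        using maximal_matching_of_pm[OF adj assms(3) U] by blast
      obtain N where N: "maximal_matching G N" "2 * card N = card U'"
        using maximal_matching_of_pm[OF adj assms(3) U'] by blast
      have "card M = card N" using assms(5) M(1) N(1) unfolding equimatchable_def by blast
      then show ?thesis using M(2) N(2) by simp
    qed
  qed (use assms in auto)
  define F where "F = {I. independent_set G I}"
  have "finite F" by (rule finite_subset[of _
    "Pow (verts G)"]) (use fin in \<open>auto simp: F_def independent_set_def\<close>)
  moreover have "{} \<in> F" by (simp add: F_def independent_set_def)
  ultimately have "Max (card ` F) \<in> card ` F" by (intro Max_in) auto
  then obtain I where I: "I \<in> F" "card I = independence_number G"
    by (auto simp: independence_number_def F_def)
  have "I \<subseteq> verts G" "indep I" using I(1) by (simp_all add: F_def independent_set_def indep_def adj)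
  moreover have "3 \<le> card I" using I(2) assms(8) by simp
  ultimately obtain S X c where "balanced adj (verts G) r S X c" using ex_balanced by blast
  from balanced.isomorphic_F_graph[OF this] show ?thesis unfolding graph_isomorphic_def adj .
qed

end
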